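(* Let $k$ be an algebraically closed field, $n\geq 1$, and let $f:\mathbf{P}^n\to\mathbf{P}^n$ be an endomorphism over $k$ satisfying $f^*\mathcal{O}_{\mathbf{P}^n}(1)\simeq\mathcal{O}_{\mathbf{P}^n}(q)$ for an integer $q>1$. Assume that $q$ is invertible in $k$ and $q\geq n+1$. Then the points of $\mathrm{CR}(f)$ are projectively linearly independent. In particular, $|\mathrm{CR}(f)|\leq n+1$, and this bound is sharp, i.e. for all integers $n\geq 1$ and $q\geq n+1$ with $q$ invertible in $k$ it is attained by some endomorphism $f:\mathbf{P}^n\to\mathbf{P}^n$ over $k$ with $f^*\mathcal{O}_{\mathbf{P}^n}(1)\simeq\mathcal{O}_{\mathbf{P}^n}(q)$.
   Context: A closed point $p\in\mathbf{P}^n$ is completely ramified (for $f$) if $f^{-1}(p)$ consists of one point set-theoretically. $\mathrm{CR}(f)$ denotes the set of completely ramified points of $f$. A set of points of $\mathbf{P}^n$ is projectively linearly independent if representing vectors in $k^{n+1}$ are linearly independent. *)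

theory Defs
  imports "HOL-Analysis.Analysis" "HOL-Library.Poly_Mapping"
    "HOL-Computational_Algebra.Polynomial"
begin

text \<open>
  We work with classical varieties over an algebraically closed field \<open>'k\<close>: all points below are
  closed points. The index type \<open>'n\<close> has \<open>n + 1\<close> elements when projective \<open>n\<close>-space is meant; it
  indexes the homogeneous coordinates. A point is a line through the origin of \<open>'k ^ 'n\<close>.
\<close>

typedef (overloaded) ('k :: field, 'n :: finite) proj =
  "{vec.span {v} | v :: 'k ^ 'n. v \<noteq> 0}"
  morphisms line Abs_proj
  using axis_eq_0_iff[of undefined "1 :: 'k"] by (auto intro!: exI[of _ "axis undefined 1"])

type_synonym ('k, 'n) mpoly = "('n \<Rightarrow>\<^sub>0 nat) \<Rightarrow>\<^sub>0 'k"

definition mpoly_eval :: "('k :: field, 'n :: finite) mpoly \<Rightarrow> 'k ^ 'n \<Rightarrow> 'k" where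
  "mpoly_eval F x =
     (\<Sum>m \<in> Poly_Mapping.keys F.
        Poly_Mapping.lookup F m * (\<Prod>i\<in>UNIV. x $ i ^ Poly_Mapping.lookup m i))"

definition homogeneous :: "nat \<Rightarrow> ('k :: field, 'n :: finite) mpoly \<Rightarrow> bool" where
  "homogeneous d F \<longleftrightarrow>
     (\<forall>m \<in> Poly_Mapping.keys F. (\<Sum>i\<in>UNIV. Poly_Mapping.lookup m i) = d)"

definition proj_zeros :: "('k :: field, 'n :: finite) mpoly set \<Rightarrow> ('k, 'n) proj set" where
  "proj_zeros S = {p. \<forall>F\<in>S. \<forall>v\<in>line p. mpoly_eval F v = 0}"

definition zariski :: "('k :: field, 'n :: finite) proj topology" where
  "zariski = topology (\<lambda>U. \<exists>S. (\<forall>F\<in>S. \<exists>d. homogeneous d F) \<and> U = - proj_zeros S)"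

definition regular_on ::
  "('k :: field, 'n :: finite) proj set \<Rightarrow> (('k, 'n) proj \<Rightarrow> 'k) \<Rightarrow> bool" where
  "regular_on U h \<longleftrightarrow>
     (\<forall>p\<in>U. \<exists>W d F G. openin zariski W \<and> p \<in> W \<and> W \<subseteq> U \<and>
        homogeneous d F \<and> homogeneous d G \<and>
        (\<forall>x\<in>W. \<forall>v \<in> line x - {0}.
           mpoly_eval G v \<noteq> 0 \<and> h x = mpoly_eval F v / mpoly_eval G v))"

text \<open>A morphism of classical varieties: a continuous map that pulls regular functions on open sets
  back to regular functions.\<close>

definition endomorphism :: "(('k :: field, 'n :: finite) proj \<Rightarrow> ('k, 'n) proj) \<Rightarrow> bool" where
  "endomorphism f \<longleftrightarrow>
     continuous_map zariski zariski f \<and>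
     (\<forall>V h. openin zariski V \<and> regular_on V h \<longrightarrow> regular_on (f -` V) (h \<circ> f))"

text \<open>
  The fibre of \<open>\<O>(d)\<close> at the point \<open>x\<close> is the one-dimensional space of functions on
  \<open>line x - {0}\<close> that are homogeneous of degree \<open>d\<close>. A section \<open>s\<close> over \<open>U\<close> is recorded as
  the function \<open>s x v\<close> of \<open>x \<in> U\<close> and \<open>v \<in> line x - {0}\<close>, extended by \<open>0\<close>, so
  that sections are equal iff the functions are. The fibre of the pullback along \<open>f\<close> at \<open>x\<close> is the
  fibre at \<open>f x\<close>; there \<open>v\<close> ranges over \<open>line (f x) - {0}\<close>.
\<close>

type_synonym ('k, 'n) section_fun = "('k, 'n) proj \<Rightarrow> 'k ^ 'n \<Rightarrow> 'k"

type_synonym ('k, 'n) sheaf = "('k, 'n) proj set \<Rightarrow> ('k, 'n) section_fun set"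

definition twist :: "int \<Rightarrow> ('k :: field, 'n :: finite) sheaf" where
  "twist d U = {s.
     (\<forall>x v. x \<notin> U \<or> v \<notin> line x - {0} \<longrightarrow> s x v = 0) \<and>
     (\<forall>p\<in>U. \<exists>W a b F G. openin zariski W \<and> p \<in> W \<and> W \<subseteq> U \<and>
        homogeneous a F \<and> homogeneous b G \<and> int a = int b + d \<and>
        (\<forall>x\<in>W. \<forall>v \<in> line x - {0}.
           mpoly_eval G v \<noteq> 0 \<and> s x v = mpoly_eval F v / mpoly_eval G v))}"

text \<open>Sections of \<open>f\<^sup>*M\<close>, the tensor product of \<open>f\<inverse>M\<close> with the structure
  sheaf, are locally finite sums of pulled-back sections of \<open>M\<close> with regular coefficients. Writing
  them as functions into the fibres loses nothing for the invertible sheaves \<open>M\<close> used here.\<close>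

definition pullback ::
  "(('k :: field, 'n :: finite) proj \<Rightarrow> ('k, 'n) proj) \<Rightarrow> ('k, 'n) sheaf \<Rightarrow> ('k, 'n) sheaf" where
  "pullback f M U = {s.
     (\<forall>x v. x \<notin> U \<longrightarrow> s x v = 0) \<and>
     (\<forall>p\<in>U. \<exists>W V (m :: nat) h t. openin zariski W \<and> p \<in> W \<and> W \<subseteq> U \<and>
        openin zariski V \<and> f ` W \<subseteq> V \<and>
        (\<forall>j<m. regular_on W (h j) \<and> t j \<in> M V) \<and>
        (\<forall>x\<in>W. \<forall>v. s x v = (\<Sum>j<m. h j x * t j (f x) v)))}"

definition restrict_section ::
  "('k :: field, 'n :: finite) proj set \<Rightarrow> ('k, 'n) section_fun \<Rightarrow> ('k, 'n) section_fun" where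
  "restrict_section V s = (\<lambda>x v. if x \<in> V then s x v else 0)"

definition sheaf_iso :: "('k :: field, 'n :: finite) sheaf \<Rightarrow> ('k, 'n) sheaf \<Rightarrow> bool" where
  "sheaf_iso M N \<longleftrightarrow> (\<exists>\<phi>.
     (\<forall>U. openin zariski U \<longrightarrow>
        bij_betw (\<phi> U) (M U) (N U) \<and>
        (\<forall>s \<in> M U. \<forall>t \<in> M U.
           \<phi> U (\<lambda>x v. s x v + t x v) = (\<lambda>x v. \<phi> U s x v + \<phi> U t x v)) \<and>
        (\<forall>h. \<forall>s \<in> M U. regular_on U h \<longrightarrow>
           \<phi> U (\<lambda>x v. h x * s x v) = (\<lambda>x v. h x * \<phi> U s x v))) \<and>
     (\<forall>U V. openin zariski U \<and> openin zariski V \<and> V \<subseteq> U \<longrightarrow>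
        (\<forall>s \<in> M U. \<phi> V (restrict_section V s) = restrict_section V (\<phi> U s))))"

definition CR :: "(('k :: field, 'n :: finite) proj \<Rightarrow> ('k, 'n) proj) \<Rightarrow> ('k, 'n) proj set" where
  "CR f = {p. \<exists>a. f -` {p} = {a}}"

text \<open>Distinct points are distinct lines, so a choice \<open>r\<close> of representing vectors is injective
  and independence of the family is independence of its image.\<close>

definition proj_independent :: "('k :: field, 'n :: finite) proj set \<Rightarrow> bool" where
  "proj_independent S \<longleftrightarrow>
     (\<forall>r. (\<forall>p\<in>S. r p \<in> line p - {0}) \<longrightarrow> vec.independent (r ` S))"

lemma mpoly_eval_superset:
  assumes "finite A" "Poly_Mapping.keys F \<subseteq> A"
  shows "mpoly_eval F x =
    (\<Sum>m\<in>A. Poly_Mapping.lookup F m * (\<Prod>i\<in>UNIV. x $ i ^ Poly_Mapping.lookup m i))"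
  unfolding mpoly_eval_def using assms
  by (intro sum.mono_neutral_left) (auto simp: in_keys_iff)

lemma mpoly_eval_zero [simp]: "mpoly_eval 0 x = 0"
  by (simp add: mpoly_eval_def)

lemma mpoly_eval_add: "mpoly_eval (F + G) x = mpoly_eval F x + mpoly_eval G x"
proof -
  let ?A = "Poly_Mapping.keys F \<union> Poly_Mapping.keys G"
  have "mpoly_eval H x = (\<Sum>m\<in>?A. Poly_Mapping.lookup H m *
      (\<Prod>i\<in>UNIV. x $ i ^ Poly_Mapping.lookup m i))" if "H \<in> {F, G, F + G}" for H
    using that Poly_Mapping.keys_add[of F G] by (intro mpoly_eval_superset) auto
  then show ?thesis
    by (simp add: lookup_add distrib_right sum.distrib)
qed

lemma mpoly_eval_single:
  "mpoly_eval (Poly_Mapping.single m c) x = c * (\<Prod>i\<in>UNIV. x $ i ^ Poly_Mapping.lookup m i)"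
  by (subst mpoly_eval_superset[of "{m}"]) auto

lemma mpoly_induct [case_names zero add]:
  fixes F :: "('k :: field, 'n :: finite) mpoly"
  assumes "P 0" "\<And>m c F. P F \<Longrightarrow> P (Poly_Mapping.single m c + F)"
  shows "P F"
proof (induction F rule: update_induct)
  case const
  then show ?case using assms(1) by simp
next
  case (update F m c)
  have "Poly_Mapping.update m c F = Poly_Mapping.single m c + F"
    using update by (intro poly_mapping_eqI)
      (auto simp: lookup_update lookup_add lookup_single when_def in_keys_iff)
  then show ?case using assms(2) update by simp
qed

lemma mpoly_eval_single_mult:
  fixes G :: "('k :: field, 'n :: finite) mpoly"
  shows "mpoly_eval (Poly_Mapping.single m c * G) x = mpoly_eval (Poly_Mapping.single m c) x * mpoly_eval G x"
  by (induction G rule: mpoly_induct)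
    (simp_all add: distrib_left mpoly_eval_add mult_single mpoly_eval_single lookup_add
      power_add prod.distrib mult_ac)

lemma mpoly_eval_mult: "mpoly_eval (F * G) x = mpoly_eval F x * mpoly_eval G x"
  by (induction F rule: mpoly_induct)
    (simp_all add: distrib_right mpoly_eval_add mpoly_eval_single_mult)

lemma mpoly_eval_scale:
  assumes "homogeneous d F"
  shows "mpoly_eval F (c *s x) = c ^ d * mpoly_eval F x"
proof -
  have "(\<Prod>i\<in>UNIV. (c *s x) $ i ^ Poly_Mapping.lookup m i) =
      c ^ d * (\<Prod>i\<in>UNIV. x $ i ^ Poly_Mapping.lookup m i)" if "m \<in> Poly_Mapping.keys F" for m
    using assms that
    by (auto simp: homogeneous_def power_mult_distrib prod.distrib simp flip: power_sum)
  then show ?thesis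
    by (auto simp: mpoly_eval_def sum_distrib_left mult_ac intro!: sum.cong)
qed

lemma homogeneous_mult:
  assumes "homogeneous d F" "homogeneous e G"
  shows "homogeneous (d + e) (F * G)"
  using assms keys_mult[of F G]
  by (fastforce simp: homogeneous_def lookup_add sum.distrib)

lemma line_eq_span: obtains u where "u \<noteq> 0" "line p = vec.span {u}"
  using line[of p] by auto

lemma proj_zeros_mult:
  assumes S: "\<forall>F\<in>S. \<exists>d. homogeneous d F" and T: "\<forall>F\<in>T. \<exists>d. homogeneous d F"
  shows "proj_zeros {F * G | F G. F \<in> S \<and> G \<in> T} = proj_zeros S \<union> proj_zeros T"
proof (intro equalityI subsetI)
  fix p assume p: "p \<in> proj_zeros {F * G | F G. F \<in> S \<and> G \<in> T}"
  obtain u where u: "line p = vec.span {u}" by (rule line_eq_span)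
  have *: "mpoly_eval H v = 0" if "\<exists>d. homogeneous d H" "mpoly_eval H u = 0" "v \<in> line p" for H v
    using that u by (auto simp: vec.span_singleton mpoly_eval_scale)
  have u': "u \<in> line p" using u by (simp add: vec.span_base)
  show "p \<in> proj_zeros S \<union> proj_zeros T"
  proof (rule ccontr)
    assume "p \<notin> proj_zeros S \<union> proj_zeros T"
    then obtain F G where "F \<in> S" "mpoly_eval F u \<noteq> 0" "G \<in> T" "mpoly_eval G u \<noteq> 0"
      using * S T unfolding proj_zeros_def by blast
    moreover from this have "mpoly_eval (F * G) u = 0"
      using p u' unfolding proj_zeros_def by blast
    ultimately show False by (simp add: mpoly_eval_mult)
  qed
qed (auto simp: proj_zeros_def mpoly_eval_mult)

lemma openin_zariski:
  fixes U :: "('k :: field, 'n :: finite) proj set"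
  shows "openin zariski U \<longleftrightarrow> (\<exists>S. (\<forall>F\<in>S. \<exists>d. homogeneous d F) \<and> U = - proj_zeros S)"
proof -
  define P :: "('k, 'n) proj set \<Rightarrow> bool"
    where "P = (\<lambda>U. \<exists>S. (\<forall>F\<in>S. \<exists>d. homogeneous d F) \<and> U = - proj_zeros S)"
  have "P (U \<inter> V)" if UV: "P U" "P V" for U V
  proof -
    obtain S T where S: "\<forall>F\<in>S. \<exists>d. homogeneous d F" "U = - proj_zeros S"
      and T: "\<forall>F\<in>T. \<exists>d. homogeneous d F" "V = - proj_zeros T" using UV unfolding P_def by blast
    then have "U \<inter> V = - proj_zeros {F * G | F G. F \<in> S \<and> G \<in> T}"
      by (simp add: proj_zeros_mult)
    moreover have "\<forall>H\<in>{F * G | F G. F \<in> S \<and> G \<in> T}. \<exists>d. homogeneous d H"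
      using S(1) T(1) homogeneous_mult by blast
    ultimately show ?thesis unfolding P_def by blast
  qed
  moreover have "P (\<Union>\<U>)" if "\<forall>U\<in>\<U>. P U" for \<U>
  proof -
    obtain S where S: "\<forall>U\<in>\<U>. (\<forall>F\<in>S U. \<exists>d. homogeneous d F) \<and> U = - proj_zeros (S U)"
      using \<open>\<forall>U\<in>\<U>. P U\<close> unfolding P_def by metis
    then have "\<Union>\<U> = (\<Union>U\<in>\<U>. - proj_zeros (S U))" by auto
    also have "\<dots> = - proj_zeros (\<Union>U\<in>\<U>. S U)" by (auto simp: proj_zeros_def)
    finally have "\<Union>\<U> = - proj_zeros (\<Union>U\<in>\<U>. S U)" .
    moreover have "\<forall>F\<in>(\<Union>U\<in>\<U>. S U). \<exists>d. homogeneous d F" using S by blast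
    ultimately show ?thesis unfolding P_def by blast
  qed
  ultimately have "istopology P"
    unfolding istopology_def by blast
  then have "openin (topology P) = P"
    by (rule topology_inverse')
  moreover have "zariski = topology P"
    unfolding zariski_def P_def ..
  ultimately have "openin zariski U = P U"
    by metis
  then show ?thesis
    unfolding P_def .
qed

end

theory Submission
  imports Defs "HOL-Library.Function_Algebras" "Jordan_Normal_Form.Char_Poly"
begin

text \<open>
  An endomorphism \<open>f\<close> with \<open>f\<^sup>*\<O>(1) \<simeq> \<O>(q)\<close> is given by forms \<open>F\<^sub>0, \<dots>, F\<^sub>n\<close> of degree
  \<open>q\<close> without a common zero: the isomorphism sends the pulled-back coordinates to global sections
  of \<open>\<O>(q)\<close>, and these are forms (\<open>global_sections\<close>, \<open>endomorphism_forms\<close>).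

  Let \<open>S\<close> be the ring of polynomials in \<open>n + 1\<close> variables and \<open>R\<close> its subring generated by the
  \<open>F\<^sub>i\<close>. By the Nullstellensatz \<open>S\<close> is a finite \<open>R\<close>-module, the \<open>F\<^sub>i\<close> are algebraically
  independent, and the rank of \<open>S\<close> over \<open>R\<close> is \<open>q\<^bsup>n+1\<^esup>\<close>, as one sees by comparing the dimensions
  of the spaces of polynomials of bounded degree (\<open>exists_rank_basis\<close>).

  The heart of the proof is a trace argument (\<open>trace_form\<close>). Let \<open>H\<close> be a form of degree \<open>q\<close>. The
  trace of multiplication by \<open>H\<close> on \<open>S\<close> over \<open>R\<close> lies in \<open>R\<close>, because \<open>R\<close> is normal, and so it
  is \<open>T(F\<^sub>0, \<dots>, F\<^sub>n)\<close> for a polynomial \<open>T\<close>. Let \<open>L\<close> be the linear part of \<open>T\<close>. If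
  the point of \<open>F a\<close> is completely ramified, with the point of \<open>a\<close> as its only preimage, take a
  linear form \<open>\<phi>\<close> with \<open>\<phi>(F a) = H a\<close>. Then \<open>H - \<phi>(F)\<close> is homogeneous and vanishes at \<open>a\<close>, hence
  on the whole preimage of the line through \<open>F a\<close>, so it is nilpotent modulo the ideal of that line.
  On the line, multiplication by \<open>H\<close> therefore has \<open>\<phi>\<close> as its only eigenvalue, and its trace is
  \<open>q\<^bsup>n+1\<^esup> \<phi>\<close>. In other words, one linear form \<open>L\<close> satisfies \<open>L(F a) = q\<^bsup>n+1\<^esup> H a\<close> for all
  completely ramified points at once.

  Suppose now that vectors representing completely ramified points are linearly dependent. A
  minimal dependent set of them has at most \<open>n + 2 \<le> q + 1\<close> elements. For any one of its elements \<open>w\<close>,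
  a product of \<open>q\<close> linear forms vanishes at the preimages of the others but not at that of \<open>w\<close>.
  Applying the corresponding \<open>L\<close> to the linear relation leaves the single term of \<open>w\<close>, which is not
  zero because \<open>q\<close> is invertible: a contradiction (\<open>independent_images\<close>).

  Conversely, forms of degree \<open>q\<close> without a common zero define an endomorphism of the required kind
  (\<open>endomorphism_pmap\<close>, \<open>sheaf_iso_pmap\<close>). The power map \<open>x\<^sub>i \<mapsto> x\<^sub>i\<^sup>q\<close> is completely ramified
  over the \<open>n + 1\<close> coordinate points and so attains the bound.
\<close>

(* In this theory $ selects a coordinate of a point of k^n, and smult scales a univariate polynomial. *)
no_notation vec_index (infixl "$" 100)
hide_const (open) Module.smult

section \<open>Polynomial functions\<close>

global_interpretation fs: vector_space "\<lambda>(c :: 'k :: field) (f :: 'a \<Rightarrow> 'k) x. c * f x"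
  by standard (auto simp: fun_eq_iff algebra_simps)

text \<open>  Over an infinite field a polynomial is determined by the function that it defines, and
  substitution, restriction to lines and homogeneous components are more direct for functions. So a
  polynomial in several variables is a function in the span of the monomials \<open>pmon \<alpha>\<close>, and a
  set of exponents selects a space of polynomials: total degree (\<open>wt\<close>) at most \<open>d\<close> for
  \<open>pol d\<close>, equal to \<open>d\<close> for \<open>form d\<close>.\<close>

definition pmon :: "('n :: finite \<Rightarrow> nat) \<Rightarrow> 'k :: field ^ 'n \<Rightarrow> 'k" where
  "pmon \<alpha> x = (\<Prod>i\<in>UNIV. x $ i ^ \<alpha> i)"

definition wt :: "('n :: finite \<Rightarrow> nat) \<Rightarrow> nat" where
  "wt \<alpha> = (\<Sum>i\<in>UNIV. \<alpha> i)"

definition pspan :: "('n :: finite \<Rightarrow> nat) set \<Rightarrow> ('k :: field ^ 'n \<Rightarrow> 'k) set" where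
  "pspan M = fs.span (pmon ` M)"

definition pol :: "nat \<Rightarrow> ('k :: field ^ 'n :: finite \<Rightarrow> 'k) set" where
  "pol d = pspan {\<alpha>. wt \<alpha> \<le> d}"

definition form :: "nat \<Rightarrow> ('k :: field ^ 'n :: finite \<Rightarrow> 'k) set" where
  "form d = pspan {\<alpha>. wt \<alpha> = d}"

lemma pspan_zero: "(\<lambda>x. 0) \<in> pspan M"
  using fs.span_zero[of "pmon ` M"] by (simp add: pspan_def zero_fun_def)

lemma pspan_add: "f \<in> pspan M \<Longrightarrow> g \<in> pspan M \<Longrightarrow> (\<lambda>x. f x + g x) \<in> pspan M"
  using fs.span_add[of f "pmon ` M" g] by (simp add: pspan_def plus_fun_def)

lemma pspan_scale: "f \<in> pspan M \<Longrightarrow> (\<lambda>x. c * f x) \<in> pspan M"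
  using fs.span_scale[of f "pmon ` M" c] by (simp add: pspan_def)

lemma pspan_uminus: "f \<in> pspan M \<Longrightarrow> (\<lambda>x. - f x) \<in> pspan M"
  using pspan_scale[of f M "-1"] by simp

lemma pspan_diff: "f \<in> pspan M \<Longrightarrow> g \<in> pspan M \<Longrightarrow> (\<lambda>x. f x - g x) \<in> pspan M"
  using pspan_add[OF _ pspan_uminus, of f M g] by simp

lemma pspan_sum: "(\<And>i. i \<in> I \<Longrightarrow> f i \<in> pspan M) \<Longrightarrow> (\<lambda>x. \<Sum>i\<in>I. f i x) \<in> pspan M"
  by (induction I rule: infinite_finite_induct) (auto intro: pspan_zero pspan_add)

lemma pspan_pmon: "\<alpha> \<in> M \<Longrightarrow> pmon \<alpha> \<in> pspan M"
  unfolding pspan_def by (intro fs.span_base) auto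

lemma pspan_mono: "M \<subseteq> M' \<Longrightarrow> pspan M \<subseteq> pspan M'"
  unfolding pspan_def by (intro fs.span_mono) auto

lemma pspan_induct [consumes 1, case_names zero add]:
  assumes "f \<in> pspan M" "P (\<lambda>x. 0)"
    "\<And>c \<alpha> g. \<alpha> \<in> M \<Longrightarrow> P g \<Longrightarrow> P (\<lambda>x. c * pmon \<alpha> x + g x)"
  shows "P f"
  using assms(1) unfolding pspan_def
proof (induction rule: fs.span_induct_alt)
  case base
  then show ?case using assms(2) by (simp add: zero_fun_def)
next
  case (step c x y)
  then show ?case using assms(3) by (auto simp: plus_fun_def)
qed

lemma pspan_mult:
  assumes "f \<in> pspan M" "g \<in> pspan M'" "\<And>\<alpha> \<beta>. \<alpha> \<in> M \<Longrightarrow> \<beta> \<in> M' \<Longrightarrow> (\<lambda>i. \<alpha> i + \<beta> i) \<in> M''"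
  shows "(\<lambda>x. f x * g x) \<in> pspan M''"
proof -
  have *: "(\<lambda>x. pmon \<alpha> x * g x) \<in> pspan M''" if "\<alpha> \<in> M" for \<alpha>
    using assms(2)
  proof (induction rule: pspan_induct)
    case (add c \<beta> g)
    have "pmon (\<lambda>i. \<alpha> i + \<beta> i) \<in> pspan M''"
      using assms(3) that add by (intro pspan_pmon) auto
    from pspan_add[OF pspan_scale[OF this, of c] add(2)] show ?case
      by (simp add: pmon_def power_add prod.distrib algebra_simps)
  qed (auto intro: pspan_zero)
  show ?thesis using assms(1)
  proof (induction rule: pspan_induct)
    case (add c \<alpha> h)
    from pspan_add[OF pspan_scale[OF *[OF add(1)], of c] add(2)] show ?case
      by (simp add: algebra_simps)
  qed (auto intro: pspan_zero)
qed

lemma wt_add: "wt (\<lambda>i. \<alpha> i + \<beta> i) = wt \<alpha> + wt \<beta>"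
  by (simp add: wt_def sum.distrib)

lemma pol_mult: "f \<in> pol d \<Longrightarrow> g \<in> pol e \<Longrightarrow> (\<lambda>x. f x * g x) \<in> pol (d + e)"
  unfolding pol_def by (rule pspan_mult) (auto simp: wt_add)

lemma form_mult: "f \<in> form d \<Longrightarrow> g \<in> form e \<Longrightarrow> (\<lambda>x. f x * g x) \<in> form (d + e)"
  unfolding form_def by (rule pspan_mult) (auto simp: wt_add)

lemma pol_mono: "d \<le> e \<Longrightarrow> f \<in> pol d \<Longrightarrow> f \<in> pol e"
  unfolding pol_def using pspan_mono[of "{\<alpha>. wt \<alpha> \<le> d}" "{\<alpha>. wt \<alpha> \<le> e}"] by force

lemma form_imp_pol: "f \<in> form d \<Longrightarrow> f \<in> pol d"
  unfolding pol_def form_def using pspan_mono[of "{\<alpha>. wt \<alpha> = d}" "{\<alpha>. wt \<alpha> \<le> d}"] by auto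

lemmas pol_zero [simp] = pspan_zero[of "{\<alpha>. wt \<alpha> \<le> d}" for d, folded pol_def]
lemmas pol_add = pspan_add[of _ "{\<alpha>. wt \<alpha> \<le> d}" for d, folded pol_def]
lemmas pol_scale = pspan_scale[of _ "{\<alpha>. wt \<alpha> \<le> d}" for d, folded pol_def]
lemmas pol_sum = pspan_sum[of _ _ "{\<alpha>. wt \<alpha> \<le> d}" for d, folded pol_def]
lemmas form_zero [simp] = pspan_zero[of "{\<alpha>. wt \<alpha> = d}" for d, folded form_def]
lemmas form_add = pspan_add[of _ "{\<alpha>. wt \<alpha> = d}" for d, folded form_def]
lemmas form_diff = pspan_diff[of _ "{\<alpha>. wt \<alpha> = d}" for d, folded form_def]
lemmas form_scale = pspan_scale[of _ "{\<alpha>. wt \<alpha> = d}" for d, folded form_def]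
lemmas form_sum = pspan_sum[of _ _ "{\<alpha>. wt \<alpha> = d}" for d, folded form_def]

lemma wt_eq_0_iff: "wt \<alpha> = 0 \<longleftrightarrow> \<alpha> = (\<lambda>_. 0)"
  by (auto simp: wt_def)

lemma pmon_0 [simp]: "pmon (\<lambda>_. 0) = (\<lambda>x. 1)"
  by (simp add: pmon_def fun_eq_iff)

lemma form_const: "(\<lambda>x. c) \<in> form 0"
  using form_scale[of "pmon (\<lambda>_. 0)" 0 c] pspan_pmon[of "\<lambda>_. 0" "{\<alpha>. wt \<alpha> = 0}"]
  by (simp add: form_def wt_eq_0_iff)

lemma pol_const [simp]: "(\<lambda>x. c) \<in> pol d"
  using pol_mono[OF _ form_imp_pol[OF form_const]] by blast

lemma pmon_form: "pmon \<alpha> \<in> form (wt \<alpha>)"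
  unfolding form_def by (rule pspan_pmon) auto

lemma pmon_unit: "pmon (\<lambda>i. if i = a then 1 else 0) = (\<lambda>x. x $ a)"
proof
  fix x :: "'a ^ 'b"
  have "(\<Prod>i\<in>UNIV. x $ i ^ (if i = a then 1 else 0)) = (\<Prod>i\<in>UNIV. if i = a then x $ a else 1)"
    by (rule prod.cong) auto
  then show "pmon (\<lambda>i. if i = a then 1 else 0) x = x $ a" by (simp add: pmon_def prod.delta)
qed

lemma coord_form: "(\<lambda>x. x $ a) \<in> form 1"
proof -
  have "wt (\<lambda>i. if i = a then 1 else 0) = 1" by (simp add: wt_def)
  then show ?thesis using pmon_form[of "\<lambda>i. if i = a then 1 else 0"] by (simp add: pmon_unit)
qed

lemma form_power: "f \<in> form d \<Longrightarrow> (\<lambda>x. f x ^ m) \<in> form (m * d)"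
  by (induction m) (auto intro: form_const form_mult)

lemma pol_power: "f \<in> pol d \<Longrightarrow> (\<lambda>x. f x ^ m) \<in> pol (m * d)"
  by (induction m) (auto intro: pol_mult)

lemma form_prod: "(\<And>i. i \<in> I \<Longrightarrow> f i \<in> form (e i)) \<Longrightarrow> (\<lambda>x. \<Prod>i\<in>I. f i x) \<in> form (\<Sum>i\<in>I. e i)"
  by (induction I rule: infinite_finite_induct) (auto intro: form_const form_mult)

lemma pol_prod: "(\<And>i. i \<in> I \<Longrightarrow> f i \<in> pol (e i)) \<Longrightarrow> (\<lambda>x. \<Prod>i\<in>I. f i x) \<in> pol (\<Sum>i\<in>I. e i)"
  by (induction I rule: infinite_finite_induct) (auto intro: pol_mult)

lemma form_comp:
  fixes F :: "'k :: field ^ 'm :: finite \<Rightarrow> 'k ^ 'n :: finite"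
  assumes "r \<in> form d" "\<And>i. (\<lambda>x. F x $ i) \<in> form q"
  shows "(\<lambda>x. r (F x)) \<in> form (q * d)"
  using assms(1) unfolding form_def[of d]
proof (induction rule: pspan_induct)
  case (add c \<alpha> g)
  have "(\<lambda>x. \<Prod>i\<in>UNIV. F x $ i ^ \<alpha> i) \<in> form (\<Sum>i\<in>UNIV. \<alpha> i * q)"
    by (intro form_prod form_power assms)
  moreover have "(\<Sum>i\<in>UNIV. \<alpha> i * q) = q * d" using add by (simp add: wt_def mult.commute flip: sum_distrib_left)
  ultimately show ?case using add by (auto intro!: form_add form_scale simp: pmon_def)
qed auto

lemma pol_comp:
  fixes F :: "'k :: field ^ 'm :: finite \<Rightarrow> 'k ^ 'n :: finite"
  assumes "r \<in> pol d" "\<And>i. (\<lambda>x. F x $ i) \<in> pol q"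
  shows "(\<lambda>x. r (F x)) \<in> pol (q * d)"
  using assms(1) unfolding pol_def[of d]
proof (induction rule: pspan_induct)
  case (add c \<alpha> g)
  have "(\<lambda>x. \<Prod>i\<in>UNIV. F x $ i ^ \<alpha> i) \<in> pol (\<Sum>i\<in>UNIV. \<alpha> i * q)"
    by (intro pol_prod pol_power assms)
  moreover have "(\<Sum>i\<in>UNIV. \<alpha> i * q) \<le> q * d" using add by (simp add: wt_def mult.commute flip: sum_distrib_left)
  ultimately show ?case using add by (auto intro!: pol_add pol_scale simp: pmon_def elim: pol_mono)
qed auto

lemma form_scaling: "f \<in> form d \<Longrightarrow> f (c *s x) = c ^ d * f x"
  unfolding form_def
proof (induction rule: pspan_induct)
  case (add e \<alpha> g)
  then show ?case
    by (simp add: pmon_def power_mult_distrib prod.distrib wt_def algebra_simps flip: power_sum)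
qed auto

lemma pol_components:
  assumes "f \<in> pol d"
  shows "\<exists>g. (\<forall>j. g j \<in> form j) \<and> (\<forall>x. f x = (\<Sum>j\<le>d. g j x))"
  using assms unfolding pol_def
proof (induction rule: pspan_induct)
  case zero
  then show ?case by (intro exI[of _ "\<lambda>_ _. 0"]) auto
next
  case (add c \<alpha> f)
  then obtain g where g: "\<forall>j. g j \<in> form j" "\<forall>x. f x = (\<Sum>j\<le>d. g j x)" by auto
  let ?h = "\<lambda>j x. (if j = wt \<alpha> then c * pmon \<alpha> x else 0) + g j x"
  have "(\<lambda>x. (if j = wt \<alpha> then c * pmon \<alpha> x else 0)) \<in> form j" for j
    by (cases "j = wt \<alpha>") (auto intro: form_scale pmon_form)
  then have "\<forall>j. ?h j \<in> form j" using g by (auto intro!: form_add)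
  moreover have "\<forall>x. c * pmon \<alpha> x + f x = (\<Sum>j\<le>d. ?h j x)"
    using g add by (simp add: sum.distrib sum.delta)
  ultimately show ?case by (intro exI[of _ ?h]) auto
qed

text \<open>Restriction to a line gives a polynomial in the parameter. Statements about several
  variables are reduced to one variable in this way throughout.\<close>

lemma pol_line:
  fixes f :: "'k :: field ^ 'n :: finite \<Rightarrow> 'k"
  assumes "f \<in> pol d"
  shows "\<exists>P. degree P \<le> d \<and> (\<forall>s. f (y + s *s z) = poly P s)"
  using assms unfolding pol_def
proof (induction rule: pspan_induct)
  case zero
  then show ?case by (intro exI[of _ 0]) auto
next
  case (add c \<alpha> g)
  then obtain P where P: "degree P \<le> d" "\<forall>s. g (y + s *s z) = poly P s" by auto
  let ?Q = "\<Prod>i\<in>UNIV. [:y $ i, z $ i:] ^ \<alpha> i"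
  have "degree ?Q \<le> (\<Sum>i\<in>UNIV. \<alpha> i)"
  proof -
    have "degree ?Q \<le> (\<Sum>i\<in>UNIV. degree ([:y $ i, z $ i:] ^ \<alpha> i))"
      using degree_prod_sum_le[of UNIV "\<lambda>i. [:y $ i, z $ i:] ^ \<alpha> i"] by (simp add: o_def)
    also have "\<dots> \<le> (\<Sum>i\<in>UNIV. \<alpha> i)"
      by (intro sum_mono order.trans[OF degree_power_le]) (auto split: if_splits)
    finally show ?thesis .
  qed
  then have "degree (smult c ?Q + P) \<le> d"
    using P add by (intro degree_add_le order.trans[OF degree_smult_le]) (auto simp: wt_def)
  moreover have "c * pmon \<alpha> (y + s *s z) + g (y + s *s z) = poly (smult c ?Q + P) s" for s
    using P by (simp add: pmon_def poly_prod poly_power algebra_simps)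
  ultimately show ?case by (intro exI[of _ "smult c ?Q + P"]) auto
qed

lemma infinite_UNIV_alg_closed: "infinite (UNIV :: 'k :: alg_closed_field set)"
proof
  assume fin: "finite (UNIV :: 'k set)"
  let ?P = "(\<Prod>a\<in>(UNIV :: 'k set). [:-a, 1:]) + 1"
  have "degree (\<Prod>a\<in>(UNIV :: 'k set). [:-a, 1:]) = card (UNIV :: 'k set)"
    by (subst degree_prod_sum_eq) auto
  moreover have "card (UNIV :: 'k set) > 0" using fin by (simp add: card_gt_0_iff)
  ultimately have "degree ?P > 0" by (subst degree_add_eq_left) auto
  then obtain x where "poly ?P x = 0" using alg_closed_imp_poly_has_root by blast
  moreover have "poly (\<Prod>a\<in>(UNIV :: 'k set). [:-a, 1:]) x = 0"
    using fin by (auto simp: poly_prod)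
  ultimately show False by simp
qed

lemma poly_eq_if_eq_infinite:
  fixes P Q :: "'k :: idom poly"
  assumes "infinite S" "\<And>s. s \<in> S \<Longrightarrow> poly P s = poly Q s"
  shows "P = Q"
proof (rule ccontr)
  assume "P \<noteq> Q"
  then have "finite {s. poly (P - Q) s = 0}" by (intro poly_roots_finite) auto
  moreover have "S \<subseteq> {s. poly (P - Q) s = 0}" using assms by auto
  ultimately show False using assms finite_subset by blast
qed

lemma poly_eqI_alg_closed:
  fixes P Q :: "'k :: alg_closed_field poly"
  assumes "\<And>s. poly P s = poly Q s" shows "P = Q"
  using poly_eq_if_eq_infinite[OF infinite_UNIV_alg_closed] assms by blast

text \<open>On the line through \<open>y\<close> and \<open>z\<close> both functions restrict to nonzero polynomials in one
  variable, whose product is not zero.\<close>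

lemma pol_nonzero_mult:
  fixes f g :: "'k :: alg_closed_field ^ 'n :: finite \<Rightarrow> 'k"
  assumes "f \<in> pol d" "g \<in> pol e" "f y \<noteq> 0" "g z \<noteq> 0"
  shows "\<exists>x. f x \<noteq> 0 \<and> g x \<noteq> 0"
proof -
  obtain P where P: "\<And>s. f (y + s *s (z - y)) = poly P s" using pol_line[OF assms(1), of y "z - y"] by blast
  obtain Q where Q: "\<And>s. g (y + s *s (z - y)) = poly Q s" using pol_line[OF assms(2), of y "z - y"] by blast
  have "P \<noteq> 0" using P[of 0] assms by auto
  moreover have "Q \<noteq> 0" using Q[of 1] assms by auto
  ultimately have "P * Q \<noteq> 0" by simp
  then obtain s where "poly (P * Q) s \<noteq> 0" using poly_eqI_alg_closed[of "P * Q" 0] by auto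
  then show ?thesis using P Q by (metis mult_eq_0_iff poly_mult)
qed

lemma pol_mult_eq_0:
  fixes f g :: "'k :: alg_closed_field ^ 'n :: finite \<Rightarrow> 'k"
  assumes "f \<in> pol d" "g \<in> pol e" "\<And>x. f x * g x = 0" "f y \<noteq> 0"
  shows "g z = 0"
  using pol_nonzero_mult[OF assms(1,2)] assms(3,4) by force

section \<open>The Nullstellensatz\<close>

text \<open>The index set \<open>A\<close> consists of the coordinates that may occur; the Nullstellensatz is
  proved by induction on it. For \<open>A = UNIV\<close> this is the ring \<open>S\<close> of all polynomial functions.\<close>

definition polA :: "'n set \<Rightarrow> ('k :: field ^ 'n :: finite \<Rightarrow> 'k) set" where
  "polA A = pspan {\<alpha>. \<forall>i. i \<notin> A \<longrightarrow> \<alpha> i = 0}"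

lemmas polA_zero = pspan_zero[of "{\<alpha>. \<forall>i. i \<notin> A \<longrightarrow> \<alpha> i = 0}" for A, folded polA_def]
lemmas polA_add = pspan_add[of _ "{\<alpha>. \<forall>i. i \<notin> A \<longrightarrow> \<alpha> i = 0}" for A, folded polA_def]
lemmas polA_diff = pspan_diff[of _ "{\<alpha>. \<forall>i. i \<notin> A \<longrightarrow> \<alpha> i = 0}" for A, folded polA_def]
lemmas polA_uminus = pspan_uminus[of _ "{\<alpha>. \<forall>i. i \<notin> A \<longrightarrow> \<alpha> i = 0}" for A, folded polA_def]
lemmas polA_scale = pspan_scale[of _ "{\<alpha>. \<forall>i. i \<notin> A \<longrightarrow> \<alpha> i = 0}" for A, folded polA_def]
lemmas polA_sum = pspan_sum[of _ _ "{\<alpha>. \<forall>i. i \<notin> A \<longrightarrow> \<alpha> i = 0}" for A, folded polA_def]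

lemma polA_mult: "f \<in> polA A \<Longrightarrow> g \<in> polA A \<Longrightarrow> (\<lambda>x. f x * g x) \<in> polA A"
  unfolding polA_def by (rule pspan_mult) auto

lemma polA_const: "(\<lambda>x. c) \<in> polA A"
  using pspan_scale[OF pspan_pmon[of "\<lambda>_. 0"], of "{\<alpha>. \<forall>i. i \<notin> A \<longrightarrow> \<alpha> i = 0}" c]
  by (simp add: polA_def)

lemma polA_coord: "a \<in> A \<Longrightarrow> (\<lambda>x. x $ a) \<in> polA A"
  unfolding polA_def pmon_unit[symmetric] by (rule pspan_pmon) auto

lemma polA_power: "f \<in> polA A \<Longrightarrow> (\<lambda>x. f x ^ m) \<in> polA A"
  by (induction m) (auto intro: polA_mult polA_const)

lemma polA_prod: "(\<And>i. i \<in> I \<Longrightarrow> f i \<in> polA A) \<Longrightarrow> (\<lambda>x. \<Prod>i\<in>I. f i x) \<in> polA A"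
  by (induction I rule: infinite_finite_induct) (auto intro: polA_const polA_mult)

lemma polA_mono: "A \<subseteq> B \<Longrightarrow> f \<in> polA A \<Longrightarrow> f \<in> polA B"
  unfolding polA_def
  using pspan_mono[of "{\<alpha>. \<forall>i. i \<notin> A \<longrightarrow> \<alpha> i = 0}" "{\<alpha>. \<forall>i. i \<notin> B \<longrightarrow> \<alpha> i = 0}"] by blast

lemma polA_UNIV_iff: "f \<in> polA UNIV \<longleftrightarrow> (\<exists>d. f \<in> pol d)"
proof
  assume "f \<in> polA UNIV"
  then show "\<exists>d. f \<in> pol d" unfolding polA_def
  proof (induction rule: pspan_induct)
    case zero
    show ?case by auto
  next
    case (add c \<alpha> g)
    then obtain d where "g \<in> pol d" by auto
    then have "(\<lambda>x. c * pmon \<alpha> x + g x) \<in> pol (max d (wt \<alpha>))"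
      using pol_mono[OF _ form_imp_pol[OF pmon_form], of \<alpha> "max d (wt \<alpha>)"]
      by (intro pol_add pol_scale) (auto elim: pol_mono[rotated])
    then show ?case by blast
  qed
next
  show "\<exists>d. f \<in> pol d \<Longrightarrow> f \<in> polA UNIV"
    unfolding pol_def polA_def using pspan_mono[of _ UNIV] by auto
qed

lemma polA_comp:
  fixes F :: "'k :: field ^ 'm :: finite \<Rightarrow> 'k ^ 'n :: finite"
  assumes "f \<in> polA A" "\<And>i. i \<in> A \<Longrightarrow> (\<lambda>x. F x $ i) \<in> polA B"
  shows "(\<lambda>x. f (F x)) \<in> polA B"
  using assms(1) unfolding polA_def[of A]
proof (induction rule: pspan_induct)
  case zero
  then show ?case by (rule polA_const)
next
  case (add c \<alpha> g)
  have "(\<lambda>x. F x $ i ^ \<alpha> i) \<in> polA B" for i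
    using add assms(2) by (cases "i \<in> A") (auto intro: polA_power polA_const)
  then have "(\<lambda>x. \<Prod>i\<in>UNIV. F x $ i ^ \<alpha> i) \<in> polA B"
    by (intro polA_prod)
  then show ?case using add by (auto intro!: polA_add polA_scale simp: pmon_def)
qed

lemma polA_cong:
  assumes "f \<in> polA A" "\<And>i. i \<in> A \<Longrightarrow> x $ i = y $ i"
  shows "f x = f y"
  using assms(1) unfolding polA_def
proof (induction rule: pspan_induct)
  case (add c \<alpha> g)
  have "x $ i ^ \<alpha> i = y $ i ^ \<alpha> i" for i
    using add assms(2) by (cases "i \<in> A") auto
  then show ?case using add by (simp add: pmon_def)
qed auto

text \<open>A polynomial in the variables \<open>insert a A\<close> is viewed as a polynomial in the variable \<open>a\<close>
  over the ring \<open>polA A\<close>.\<close>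

lemma polA_insert_expand:
  assumes "f \<in> polA (insert a A)"
  shows "\<exists>h D. (\<forall>i. h i \<in> polA A) \<and> (\<forall>x. f x = (\<Sum>i\<le>D. h i x * x $ a ^ i))"
  using assms unfolding polA_def[of "insert a A"]
proof (induction rule: pspan_induct)
  case zero
  show ?case by (intro exI[of _ "\<lambda>_ _. 0"] exI[of _ 0]) (auto intro: polA_zero)
next
  case (add c \<alpha> f)
  then obtain h D where h: "\<forall>i. h i \<in> polA A" "\<forall>x. f x = (\<Sum>i\<le>D. h i x * x $ a ^ i)" by auto
  define E where "E = max D (\<alpha> a)"
  define h' where "h' = (\<lambda>i. if i \<le> D then h i else (\<lambda>x. 0))"
  define \<beta> where "\<beta> = \<alpha>(a := 0)"
  define h'' where "h'' = (\<lambda>i x. (if i = \<alpha> a then c * pmon \<beta> x else 0) + h' i x)"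
  have \<beta>: "pmon \<beta> \<in> polA A"
    unfolding polA_def using add by (intro pspan_pmon) (auto simp: \<beta>_def)
  have "(\<lambda>x. if i = \<alpha> a then c * pmon \<beta> x else 0) \<in> polA A" for i
    using \<beta> by (cases "i = \<alpha> a") (auto intro: polA_scale polA_zero)
  then have "\<forall>i. h'' i \<in> polA A"
    using h by (auto intro!: polA_add polA_zero simp: h''_def h'_def)
  moreover have "c * pmon \<alpha> x + f x = (\<Sum>i\<le>E. h'' i x * x $ a ^ i)" for x
  proof -
    have "(\<Sum>i\<le>E. h' i x * x $ a ^ i) = f x"
      unfolding h(2)[rule_format] by (rule sum.mono_neutral_cong_right) (auto simp: h'_def E_def)
    moreover have "pmon \<alpha> x = pmon \<beta> x * x $ a ^ \<alpha> a"
      by (simp add: pmon_def \<beta>_def prod.remove[of UNIV a])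
    moreover have "(\<Sum>i\<le>E. (if i = \<alpha> a then c * pmon \<beta> x else 0) * x $ a ^ i) = c * pmon \<beta> x * x $ a ^ \<alpha> a"
      by (subst sum.mono_neutral_cong_right[of _ "{\<alpha> a}"]) (auto simp: E_def)
    ultimately show ?thesis by (simp add: h''_def distrib_right sum.distrib mult.assoc)
  qed
  ultimately show ?case by blast
qed

definition pideal :: "'n set \<Rightarrow> ('k :: field ^ 'n :: finite \<Rightarrow> 'k) set \<Rightarrow> bool" where
  "pideal A I \<longleftrightarrow> I \<subseteq> polA A \<and> (\<lambda>x. 0) \<in> I \<and> (\<forall>f\<in>I. \<forall>g\<in>I. (\<lambda>x. f x + g x) \<in> I) \<and>
     (\<forall>f\<in>I. \<forall>h\<in>polA A. (\<lambda>x. h x * f x) \<in> I)"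

lemma pideal_sub: "pideal A I \<Longrightarrow> f \<in> I \<Longrightarrow> f \<in> polA A"
  and pideal_zero: "pideal A I \<Longrightarrow> (\<lambda>x. 0) \<in> I"
  and pideal_add: "pideal A I \<Longrightarrow> f \<in> I \<Longrightarrow> g \<in> I \<Longrightarrow> (\<lambda>x. f x + g x) \<in> I"
  and pideal_mult: "pideal A I \<Longrightarrow> f \<in> I \<Longrightarrow> h \<in> polA A \<Longrightarrow> (\<lambda>x. h x * f x) \<in> I"
  by (auto simp: pideal_def)

lemma pideal_sum: "pideal A I \<Longrightarrow> (\<And>i. i \<in> S \<Longrightarrow> f i \<in> I) \<Longrightarrow> (\<lambda>x. \<Sum>i\<in>S. f i x) \<in> I"
  by (induction S rule: infinite_finite_induct) (auto intro: pideal_zero pideal_add)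

lemma pideal_uminus: "pideal A I \<Longrightarrow> f \<in> I \<Longrightarrow> (\<lambda>x. - f x) \<in> I"
  using pideal_mult[of A I f "\<lambda>x. -1"] by (simp add: polA_const)

text \<open>  Nakayama's lemma at the point \<open>x0\<close>, by eliminating one generator at a time. Modulo \<open>I\<close> the \<open>v i\<close>
  satisfy a linear system whose matrix is diagonal and invertible at \<open>x0\<close>, so a function that does
  not vanish at \<open>x0\<close> annihilates all of them. The diagonal entries \<open>u i\<close> are arbitrary rather than
  \<open>1\<close> because an elimination step multiplies them by the pivot \<open>w\<close>.\<close>

lemma nakayama_elimination:
  fixes e :: nat
  assumes I: "pideal B I" and AB: "A \<subseteq> B"
    and "\<And>i. i < e \<Longrightarrow> u i \<in> polA A \<and> u i x0 \<noteq> 0"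
    and "\<And>i j. i < e \<Longrightarrow> j < e \<Longrightarrow> c i j \<in> polA A \<and> c i j x0 = 0"
    and "\<And>i. i < e \<Longrightarrow> (\<lambda>x. u i x * v i x - (\<Sum>j<e. c i j x * v j x)) \<in> I"
  shows "\<exists>h\<in>polA A. h x0 \<noteq> 0 \<and> (\<forall>i<e. (\<lambda>x. h x * v i x) \<in> I)"
  using assms(3-5)
proof (induction e arbitrary: u c)
  case 0
  show ?case by (intro bexI[of _ "\<lambda>x. 1"]) (auto intro: polA_const)
next
  case (Suc e)
  have sub: "h \<in> polA B" if "h \<in> polA A" for h using that AB polA_mono by blast
  define w where "w = (\<lambda>x. u e x - c e e x)"
  have w: "w \<in> polA A" "w x0 \<noteq> 0" using Suc.prems(1,2) by (auto simp: w_def intro: polA_diff)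
  have rel: "(\<lambda>x. w x * v e x - (\<Sum>j<e. c e j x * v j x)) \<in> I"
    using Suc.prems(3)[of e] by (simp add: w_def algebra_simps)
  have "\<exists>h\<in>polA A. h x0 \<noteq> 0 \<and> (\<forall>i<e. (\<lambda>x. h x * v i x) \<in> I)"
  proof (rule Suc.IH[of "\<lambda>i x. w x * u i x" "\<lambda>i j x. w x * c i j x + c i e x * c e j x"])
    fix i assume i: "i < e"
    have "(\<lambda>x. w x * (u i x * v i x - (\<Sum>j<Suc e. c i j x * v j x))
        + c i e x * (w x * v e x - (\<Sum>j<e. c e j x * v j x))) \<in> I"
      using i Suc.prems w rel by (intro pideal_add[OF I] pideal_mult[OF I] sub) auto
    also have "(\<lambda>x. w x * (u i x * v i x - (\<Sum>j<Suc e. c i j x * v j x))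
        + c i e x * (w x * v e x - (\<Sum>j<e. c e j x * v j x))) =
        (\<lambda>x. w x * u i x * v i x - (\<Sum>j<e. (w x * c i j x + c i e x * c e j x) * v j x))"
      by (auto simp: fun_eq_iff algebra_simps sum.distrib sum_distrib_left)
    finally show "(\<lambda>x. w x * u i x * v i x - (\<Sum>j<e. (w x * c i j x + c i e x * c e j x) * v j x)) \<in> I" .
  qed (use Suc.prems w in \<open>auto intro!: polA_mult polA_add\<close>)
  then obtain h where h: "h \<in> polA A" "h x0 \<noteq> 0" "\<And>i. i < e \<Longrightarrow> (\<lambda>x. h x * v i x) \<in> I" by blast
  have "(\<lambda>x. h x * (w x * v e x - (\<Sum>j<e. c e j x * v j x)) + (\<Sum>j<e. c e j x * (h x * v j x))) \<in> I"
    using Suc.prems(2) h rel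
    by (intro pideal_add[OF I pideal_mult[OF I rel] pideal_sum[OF I pideal_mult[OF I]]] sub) auto
  also have "(\<lambda>x. h x * (w x * v e x - (\<Sum>j<e. c e j x * v j x)) + (\<Sum>j<e. c e j x * (h x * v j x))) =
     (\<lambda>x. (h x * w x) * v e x)"
    by (auto simp: fun_eq_iff algebra_simps sum_distrib_left)
  finally have last: "(\<lambda>x. (h x * w x) * v e x) \<in> I" .
  have "(\<lambda>x. (h x * w x) * v i x) \<in> I" if "i < Suc e" for i
  proof (cases "i = e")
    case False
    then have "(\<lambda>x. w x * (h x * v i x)) \<in> I"
      using pideal_mult[OF I h(3)[of i] sub[OF w(1)]] that by simp
    then show ?thesis by (simp add: mult_ac)
  qed (use last in auto)
  then show ?case using h w by (intro bexI[of _ "\<lambda>x. h x * w x"]) (auto intro: polA_mult)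
qed

text \<open>The linear substitution \<open>x\<^sub>i \<mapsto> x\<^sub>i + c\<^sub>i x\<^sub>a\<close> for \<open>i \<noteq> a\<close> and \<open>x\<^sub>a \<mapsto> c\<^sub>a x\<^sub>a\<close>. It is
  used with \<open>c\<^sub>a = 1\<close>, where it is invertible, to make a polynomial monic in \<open>x\<^sub>a\<close>.\<close>

definition shear :: "'n \<Rightarrow> 'k :: field ^ 'n \<Rightarrow> 'k ^ 'n :: finite \<Rightarrow> 'k ^ 'n" where
  "shear a c x = (\<chi> i. (if i = a then 0 else x $ i) + x $ a * c $ i)"

lemma shear_inverse:
  "c $ a = 1 \<Longrightarrow> shear a c (shear a (\<chi> i. if i = a then 1 else - c $ i) x) = x"
  "c $ a = 1 \<Longrightarrow> shear a (\<chi> i. if i = a then 1 else - c $ i) (shear a c x) = x"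
  by (auto simp: shear_def Finite_Cartesian_Product.vec_eq_iff)

lemma polA_shear:
  assumes "f \<in> polA (insert a A)"
  shows "(\<lambda>x. f (shear a c x)) \<in> polA (insert a A)"
proof (rule polA_comp[OF assms])
  fix i assume "i \<in> insert a A"
  then have "(\<lambda>x. (if i = a then 0 else x $ i) + c $ i * x $ a) \<in> polA (insert a A)"
    by (cases "i = a") (auto intro!: polA_add polA_scale polA_coord polA_zero)
  then show "(\<lambda>x. shear a c x $ i) \<in> polA (insert a A)"
    by (simp add: shear_def mult.commute)
qed

lemma coeff_linear: "coeff [:u, v:] j = (if j = 0 then u else if j = 1 then v else 0)"
  by (auto simp: coeff_pCons split: nat.split)

text \<open>A polynomial in one further variable over \<open>polA A\<close> whose coefficient at \<open>d\<close>, the largest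
  possible degree, is the constant \<open>\<kappa>\<close>. The value \<open>\<kappa> = 0\<close> is included, so that terms of smaller degree can be
  added.\<close>

definition leads :: "'n set \<Rightarrow> nat \<Rightarrow> 'k :: field \<Rightarrow> ('k ^ 'n :: finite \<Rightarrow> 'k poly) \<Rightarrow> bool" where
  "leads A d \<kappa> p \<longleftrightarrow> (\<forall>x. degree (p x) \<le> d \<and> coeff (p x) d = \<kappa>) \<and> (\<forall>i. (\<lambda>x. coeff (p x) i) \<in> polA A)"

lemma leads_mult:
  assumes p: "leads A d \<kappa> p" and q: "leads A e \<kappa>' q"
  shows "leads A (d + e) (\<kappa> * \<kappa>') (\<lambda>x. p x * q x)"
proof -
  have "coeff (p x * q x) (d + e) = \<kappa> * \<kappa>'" for x
  proof -
    have "coeff (p x * q x) (d + e) = (\<Sum>i\<in>{d}. coeff (p x) i * coeff (q x) (d + e - i))"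
      unfolding coeff_mult
    proof (rule sum.mono_neutral_right)
      show "\<forall>i\<in>{..d + e} - {d}. coeff (p x) i * coeff (q x) (d + e - i) = 0"
      proof
        fix i assume i: "i \<in> {..d + e} - {d}"
        have "degree (p x) \<le> d" "degree (q x) \<le> e" using p q by (auto simp: leads_def)
        then show "coeff (p x) i * coeff (q x) (d + e - i) = 0"
          using i by (cases "i < d") (auto simp: coeff_eq_0)
      qed
    qed auto
    then show ?thesis using p q by (simp add: leads_def)
  qed
  moreover have "degree (p x * q x) \<le> d + e" for x
    using p q degree_mult_le[of "p x" "q x"] unfolding leads_def by (meson add_mono order.trans)
  moreover have "(\<lambda>x. coeff (p x * q x) i) \<in> polA A" for i
    unfolding coeff_mult using p q by (intro polA_sum polA_mult) (auto simp: leads_def)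
  ultimately show ?thesis by (simp add: leads_def)
qed

lemma leads_power:
  assumes "leads A d \<kappa> p" shows "leads A (m * d) (\<kappa> ^ m) (\<lambda>x. p x ^ m)"
proof (induction m)
  case 0
  show ?case by (auto simp: leads_def coeff_1 intro: polA_const)
next
  case (Suc m)
  show ?case using leads_mult[OF assms Suc] by simp
qed

lemma leads_prod:
  assumes "\<And>i. i \<in> S \<Longrightarrow> leads A (d i) (\<kappa> i) (p i)"
  shows "leads A (sum d S) (prod \<kappa> S) (\<lambda>x. \<Prod>i\<in>S. p i x)"
  using assms
proof (induction S rule: infinite_finite_induct)
  case (insert i S)
  then show ?case using leads_mult[of A "d i" "\<kappa> i" "p i"] by simp
qed (auto simp: leads_def coeff_1 intro: polA_const)

lemma leads_weaken: "leads A d \<kappa> p \<Longrightarrow> d < e \<Longrightarrow> leads A e 0 p"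
  unfolding leads_def by (auto simp: coeff_eq_0 intro: order.trans less_imp_le)
    (metis coeff_eq_0 le_less_trans)

text \<open>  The form \<open>T\<close> is the part of degree \<open>d\<close> of \<open>f\<close>. After the shear, a monomial of degree \<open>d\<close>
  contributes its value at \<open>c\<close> to the coefficient of \<open>x\<^sub>a\<^sup>d\<close>, and a monomial of smaller degree
  contributes nothing to it.\<close>

lemma shear_leading:
  assumes "f \<in> pspan {\<alpha>. (\<forall>i. i \<notin> insert a A \<longrightarrow> \<alpha> i = 0) \<and> wt \<alpha> \<le> d}" and "a \<notin> A"
  shows "\<exists>T. T \<in> form d \<and> (\<lambda>x. f x - T x) \<in> pspan {\<alpha>. (\<forall>i. i \<notin> insert a A \<longrightarrow> \<alpha> i = 0) \<and> wt \<alpha> < d} \<and>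
    (\<forall>c. c $ a = 1 \<longrightarrow> (\<exists>p. leads A d (T c) p \<and> (\<forall>x. f (shear a c x) = poly (p x) (x $ a))))"
  using assms(1)
proof (induction rule: pspan_induct)
  case zero
  show ?case
    by (intro exI[of _ "\<lambda>_. 0"] conjI) (auto intro!: pspan_zero exI[of _ "\<lambda>_. 0"] simp: leads_def polA_zero)
next
  case (add e \<alpha> f)
  let ?S = "{\<alpha>. (\<forall>i. i \<notin> insert a A \<longrightarrow> \<alpha> i = 0) \<and> wt \<alpha> < d}"
  obtain T where T: "T \<in> form d" "(\<lambda>x. f x - T x) \<in> pspan ?S"
     "\<And>c. c $ a = 1 \<Longrightarrow> (\<exists>p. leads A d (T c) p \<and> (\<forall>x. f (shear a c x) = poly (p x) (x $ a)))"
    using add by auto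
  define T' where "T' = (\<lambda>x. (if wt \<alpha> = d then e * pmon \<alpha> x else 0) + T x)"
  have "T' \<in> form d" using T pmon_form[of \<alpha>] unfolding T'_def
    by (intro form_add) (cases "wt \<alpha> = d"; auto intro!: form_scale)+
  moreover have "(\<lambda>x. e * pmon \<alpha> x + f x - T' x) \<in> pspan ?S"
  proof (cases "wt \<alpha> = d")
    case False
    then have "pmon \<alpha> \<in> pspan ?S" using add by (intro pspan_pmon) auto
    from pspan_add[OF pspan_scale[OF this, of e] T(2)] False show ?thesis
      by (simp add: T'_def algebra_simps)
  qed (use T in \<open>simp add: T'_def\<close>)
  moreover have "\<exists>p. leads A d (T' c) p \<and> (\<forall>x. e * pmon \<alpha> (shear a c x) + f (shear a c x) = poly (p x) (x $ a))"
    if c: "c $ a = 1" for c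
  proof -
    obtain p where p: "leads A d (T c) p" "\<forall>x. f (shear a c x) = poly (p x) (x $ a)" using T c by blast
    define l where "l = (\<lambda>i x. [:(if i = a then 0 else x $ i), c $ i:] ^ \<alpha> i)"
    have l: "leads A (\<alpha> i) (c $ i ^ \<alpha> i) (l i)" for i
    proof (cases "i \<in> insert a A")
      case True
      have "(\<lambda>x. coeff [:(if i = a then 0 else x $ i), c $ i:] j) \<in> polA A" for j
        using True by (cases "i = a"; cases "j = 0"; cases "j = 1")
          (auto simp: coeff_linear polA_const polA_coord)
      then have "leads A 1 (c $ i) (\<lambda>x. [:(if i = a then 0 else x $ i), c $ i:])"
        by (auto simp: leads_def coeff_linear)
      from leads_power[OF this, of "\<alpha> i"] show ?thesis by (simp add: l_def)
    next
      case False
      then show ?thesis using add by (auto simp: l_def leads_def coeff_1 intro: polA_const)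
    qed
    define r where "r = (\<lambda>x. \<Prod>i\<in>UNIV. l i x)"
    have r: "leads A (wt \<alpha>) (pmon \<alpha> c) r"
      unfolding r_def wt_def pmon_def by (intro leads_prod l)
    have r_eval: "pmon \<alpha> (shear a c x) = poly (r x) (x $ a)" for x
      by (simp add: r_def l_def pmon_def shear_def poly_prod poly_power)
    define \<kappa> where "\<kappa> = (if wt \<alpha> = d then pmon \<alpha> c else 0)"
    have r': "leads A d \<kappa> r"
      using r leads_weaken[OF r, of d] add by (auto simp: \<kappa>_def)
    have "leads A d (T' c) (\<lambda>x. Polynomial.smult e (r x) + p x)"
      using r' p(1) unfolding leads_def T'_def \<kappa>_def
      by (auto intro!: degree_add_le order.trans[OF degree_smult_le] polA_add polA_scale)
    then show ?thesis using p(2) r_eval by (intro exI[of _ "\<lambda>x. Polynomial.smult e (r x) + p x"]) auto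
  qed
  ultimately show ?case by (intro exI[of _ T']) auto
qed

text \<open>The leading form of \<open>g\<close> is not zero, so it has a nonzero value at some \<open>c\<close> with
  \<open>c\<^sub>a \<noteq> 0\<close>; by homogeneity \<open>c\<^sub>a = 1\<close> can be arranged.\<close>

lemma exists_monic_shear:
  fixes g :: "'k :: alg_closed_field ^ 'n :: finite \<Rightarrow> 'k"
  assumes g: "g \<in> polA (insert a A)" "g y \<noteq> 0" and aA: "a \<notin> A"
  shows "\<exists>c d \<kappa> p. c $ a = 1 \<and> \<kappa> \<noteq> 0 \<and> leads A d \<kappa> p \<and> (\<forall>x. g (shear a c x) = poly (p x) (x $ a))"
proof -
  define S where "S = (\<lambda>d. {\<alpha> :: 'n \<Rightarrow> nat. (\<forall>i. i \<notin> insert a A \<longrightarrow> \<alpha> i = 0) \<and> wt \<alpha> \<le> d})"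
  have "\<exists>d. g \<in> pspan (S d)"
    using g(1) unfolding polA_def
  proof (induction rule: pspan_induct)
    case zero
    show ?case by (auto intro: pspan_zero)
  next
    case (add e \<alpha> f)
    then obtain d where "f \<in> pspan (S d)" by auto
    moreover have "pspan (S d) \<subseteq> pspan (S (max d (wt \<alpha>)))" by (rule pspan_mono) (auto simp: S_def)
    ultimately have "(\<lambda>x. e * pmon \<alpha> x + f x) \<in> pspan (S (max d (wt \<alpha>)))"
      using add by (intro pspan_add pspan_scale pspan_pmon) (auto simp: S_def)
    then show ?case by blast
  qed
  \<comment> \<open>minimality of the degree is what makes the leading form nonzero\<close>
  define d where "d = (LEAST d. g \<in> pspan (S d))"
  have d: "g \<in> pspan (S d)" unfolding d_def by (rule LeastI_ex) fact
  have dmin: "g \<notin> pspan (S e)" if "e < d" for e using that not_less_Least unfolding d_def by blast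
  obtain T where T: "T \<in> form d" "(\<lambda>x. g x - T x) \<in> pspan {\<alpha>. (\<forall>i. i \<notin> insert a A \<longrightarrow> \<alpha> i = 0) \<and> wt \<alpha> < d}"
    and lead: "\<And>c. c $ a = 1 \<Longrightarrow> (\<exists>p. leads A d (T c) p \<and> (\<forall>x. g (shear a c x) = poly (p x) (x $ a)))"
    using shear_leading[OF d[unfolded S_def] aA] by blast
  have "\<exists>z. T z \<noteq> 0"
  proof (rule ccontr)
    assume "\<nexists>z. T z \<noteq> 0"
    then have *: "g \<in> pspan {\<alpha>. (\<forall>i. i \<notin> insert a A \<longrightarrow> \<alpha> i = 0) \<and> wt \<alpha> < d}" using T by simp
    show False
    proof (cases d)
      case 0
      then have "g = 0" using * by (simp add: pspan_def)
      then show False using g by simp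
    next
      case (Suc e)
      then show False using * dmin[of e] by (simp add: S_def less_Suc_eq_le)
    qed
  qed
  then obtain z where "T z \<noteq> 0" by blast
  moreover have "(\<lambda>x. x $ a) \<in> pol 1" by (intro form_imp_pol coord_form)
  moreover have "(axis a 1 :: 'k ^ 'n) $ a \<noteq> 0" by simp
  ultimately obtain w where w: "T w \<noteq> 0" "w $ a \<noteq> 0"
    using pol_nonzero_mult[OF form_imp_pol[OF T(1)], of "\<lambda>x. x $ a" 1] by blast
  let ?c = "inverse (w $ a) *s w"
  have "?c $ a = 1" using w by simp
  moreover have "T ?c \<noteq> 0" using w by (simp add: form_scaling[OF T(1)])
  ultimately show ?thesis using lead by blast
qed

text \<open>Modulo an ideal that contains an element monic of degree \<open>d\<close> in \<open>x\<^sub>a\<close>, every polynomial is a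
  combination over \<open>polA A\<close> of the powers of \<open>x\<^sub>a\<close> below \<open>d\<close>: the quotient is a finite module.\<close>

lemma powers_reduce_mod_monic:
  fixes I :: "('k :: field ^ 'n :: finite \<Rightarrow> 'k) set"
  assumes I: "pideal (insert a A) I" and hA: "\<And>i. h i \<in> polA A"
    and monic: "(\<lambda>x. (\<Sum>i<d. h i x * x $ a ^ i) + x $ a ^ d) \<in> I"
  shows "\<exists>C. (\<forall>j. C j \<in> polA A) \<and> (\<lambda>x. x $ a ^ k - (\<Sum>j<d. C j x * x $ a ^ j)) \<in> I"
proof (induction k rule: less_induct)
  case (less k)
  have sub: "h \<in> polA (insert a A)" if "h \<in> polA A" for h using that polA_mono by blast
  show ?case
  proof (cases "k < d")
    case True
    have "(\<Sum>j<d. (if j = k then 1 else 0) * x $ a ^ j) = x $ a ^ k" for x :: "'k ^ 'n"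
      using True by (subst sum.mono_neutral_cong_right[of _ "{k}"]) auto
    then show ?thesis using pideal_zero[OF I]
      by (intro exI[of _ "\<lambda>j x. if j = k then 1 else 0"]) (auto intro: polA_const)
  next
    case False
    define l where "l = k - d"
    have k: "k = d + l" using False by (simp add: l_def)
    have "\<forall>i\<in>{..<d}. \<exists>C. (\<forall>j. C j \<in> polA A) \<and> (\<lambda>x. x $ a ^ (i + l) - (\<Sum>j<d. C j x * x $ a ^ j)) \<in> I"
      using less k by auto
    from bchoice[OF this] obtain C where C: "\<And>i j. i < d \<Longrightarrow> C i j \<in> polA A"
      "\<And>i. i < d \<Longrightarrow> (\<lambda>x. x $ a ^ (i + l) - (\<Sum>j<d. C i j x * x $ a ^ j)) \<in> I"
      by (auto simp: Ball_def)
    define C' where "C' = (\<lambda>j x. - (\<Sum>i<d. h i x * C i j x))"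
    have C'A: "C' j \<in> polA A" for j
      unfolding C'_def by (intro polA_uminus polA_sum polA_mult hA C) auto
    have "(\<lambda>x. x $ a ^ l * ((\<Sum>i<d. h i x * x $ a ^ i) + x $ a ^ d) + - (\<Sum>i<d. h i x * (x $ a ^ (i + l) - (\<Sum>j<d. C i j x * x $ a ^ j)))) \<in> I"
      by (intro pideal_add[OF I] pideal_uminus[OF I] pideal_sum[OF I] pideal_mult[OF I] monic C sub hA polA_power polA_coord) auto
    also have "(\<lambda>x. x $ a ^ l * ((\<Sum>i<d. h i x * x $ a ^ i) + x $ a ^ d) + - (\<Sum>i<d. h i x * (x $ a ^ (i + l) - (\<Sum>j<d. C i j x * x $ a ^ j))))
      = (\<lambda>x. x $ a ^ k - (\<Sum>j<d. C' j x * x $ a ^ j))"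
    proof
      fix x :: "'k ^ 'n"
      have "(\<Sum>j<d. C' j x * x $ a ^ j) = - (\<Sum>i<d. h i x * (\<Sum>j<d. C i j x * x $ a ^ j))"
        unfolding C'_def by (simp add: sum_distrib_left sum_distrib_right sum_negf mult_ac, subst sum.swap, simp)
      then show "x $ a ^ l * ((\<Sum>i<d. h i x * x $ a ^ i) + x $ a ^ d) + - (\<Sum>i<d. h i x * (x $ a ^ (i + l) - (\<Sum>j<d. C i j x * x $ a ^ j))) = x $ a ^ k - (\<Sum>j<d. C' j x * x $ a ^ j)"
        by (simp add: k power_add algebra_simps sum_distrib_left sum.distrib sum_subtractf)
    qed
    finally show ?thesis using C'A by blast
  qed
qed

text \<open>  A zero \<open>x0\<close> of the contraction of \<open>I\<close> to the variables \<open>A\<close> lifts to a zero of \<open>I\<close>. On the line over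
  \<open>x0\<close> in the direction \<open>a\<close> the ideal \<open>I\<close> restricts to a principal ideal of \<open>k[s]\<close>. If its
  generator had no root, some \<open>f \<in> I\<close> would restrict to \<open>1\<close> on the line; then multiplication by \<open>1 - f\<close> on
  the finite module of the quotient would have coefficients vanishing at \<open>x0\<close>, and Nakayama's lemma
  would give an element of \<open>I\<close> in \<open>polA A\<close> that does not vanish at \<open>x0\<close>.\<close>

lemma zero_lifts_over_monic:
  fixes I :: "('k :: alg_closed_field ^ 'n :: finite \<Rightarrow> 'k) set"
  assumes I: "pideal (insert a A) I" and aA: "a \<notin> A" and hA: "\<And>i. h i \<in> polA A"
    and monic: "(\<lambda>x. (\<Sum>i<d. h i x * x $ a ^ i) + x $ a ^ d) \<in> I" and one: "(\<lambda>x. 1) \<notin> I"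
    and x0: "\<And>f. f \<in> I \<Longrightarrow> f \<in> polA A \<Longrightarrow> f x0 = 0"
  shows "\<exists>s. \<forall>f\<in>I. f (\<chi> i. if i = a then s else x0 $ i) = 0"
proof -
  have sub: "h \<in> polA (insert a A)" if "h \<in> polA A" for h using that polA_mono by blast
  define ev where "ev = (\<lambda>s. \<chi> i. if i = a then s else x0 $ i)"
  have ev_A: "h (ev s) = h x0" if "h \<in> polA A" for h s
    by (rule polA_cong[OF that]) (use aA in \<open>auto simp: ev_def\<close>)
  have ev_a: "ev s $ a = s" for s by (simp add: ev_def)
  have "\<forall>k. \<exists>C. (\<forall>j. C j \<in> polA A) \<and> (\<lambda>x. x $ a ^ k - (\<Sum>j<d. C j x * x $ a ^ j)) \<in> I"
    using powers_reduce_mod_monic[OF I hA monic] by blast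
  from choice[OF this] obtain C where C: "\<And>k j. C k j \<in> polA A"
        "\<And>k. (\<lambda>x. x $ a ^ k - (\<Sum>j<d. C k j x * x $ a ^ j)) \<in> I" by auto
  have no_unit: False if f: "f \<in> I" "\<And>s. f (ev s) = 1" for f
  proof -
    obtain u D where u: "\<And>i. u i \<in> polA A" "\<And>x. f x = (\<Sum>i\<le>D. u i x * x $ a ^ i)"
      using polA_insert_expand[OF pideal_sub[OF I f(1)]] by blast
    define w where "w = (\<lambda>k x. u k x - (if k = 0 then 1 else 0))"
    have wA: "w k \<in> polA A" for k unfolding w_def by (intro polA_diff u polA_const)
    have "w k x0 = 0" if "k \<le> D" for k
    proof -
      let ?P = "\<Sum>i\<le>D. monom (u i x0) i"
      have "poly ?P s = poly 1 s" for s
        using f(2)[of s] by (simp add: u(2) ev_A[OF u(1)] ev_a poly_sum poly_monom)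
      then have "?P = 1" by (rule poly_eqI_alg_closed)
      then have "coeff ?P k = coeff 1 k" by simp
      then show ?thesis using that by (simp add: coeff_sum w_def coeff_1 sum.delta)
    qed
    \<comment> \<open>the matrix of multiplication by \<open>1 - f\<close> on the powers of \<open>x\<^sub>a\<close>\<close>
    define cc where "cc = (\<lambda>i j x. - (\<Sum>k\<le>D. w k x * C (k + i) j x))"
    have "\<exists>h\<in>polA A. h x0 \<noteq> 0 \<and> (\<forall>i<d. (\<lambda>x. h x * x $ a ^ i) \<in> I)"
    proof (rule nakayama_elimination[OF I, where u = "\<lambda>i x. 1" and c = cc])
      fix i assume i: "i < d"
      have "(\<lambda>x. x $ a ^ i * f x + - (\<Sum>k\<le>D. w k x * (x $ a ^ (k + i) - (\<Sum>j<d. C (k + i) j x * x $ a ^ j)))) \<in> I"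
        by (intro pideal_add[OF I] pideal_uminus[OF I] pideal_sum[OF I] pideal_mult[OF I] f C sub wA polA_power polA_coord) auto
      also have "(\<lambda>x. x $ a ^ i * f x + - (\<Sum>k\<le>D. w k x * (x $ a ^ (k + i) - (\<Sum>j<d. C (k + i) j x * x $ a ^ j))))
         = (\<lambda>x. 1 * x $ a ^ i - (\<Sum>j<d. cc i j x * x $ a ^ j))"
      proof
        fix x :: "'k ^ 'n"
        have "(\<Sum>j<d. cc i j x * x $ a ^ j) = - (\<Sum>k\<le>D. w k x * (\<Sum>j<d. C (k + i) j x * x $ a ^ j))"
          unfolding cc_def by (simp add: sum_distrib_left sum_distrib_right sum_negf mult_ac, subst sum.swap, simp)
        moreover have "f x = (\<Sum>k\<le>D. w k x * x $ a ^ k) + 1"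
        proof -
          have "(\<Sum>k\<le>D. (if k = 0 then 1 else 0) * x $ a ^ k) = 1"
            by (subst sum.mono_neutral_cong_right[of _ "{0}"]) auto
          then show ?thesis by (simp add: u(2) w_def left_diff_distrib sum_subtractf)
        qed
        ultimately show "x $ a ^ i * f x + - (\<Sum>k\<le>D. w k x * (x $ a ^ (k + i) - (\<Sum>j<d. C (k + i) j x * x $ a ^ j))) = 1 * x $ a ^ i - (\<Sum>j<d. cc i j x * x $ a ^ j)"
          by (simp add: power_add algebra_simps sum_distrib_left sum.distrib sum_subtractf)
      qed
      finally show "(\<lambda>x. 1 * x $ a ^ i - (\<Sum>j<d. cc i j x * x $ a ^ j)) \<in> I" .
    next
      fix i j
      show "cc i j \<in> polA A \<and> cc i j x0 = 0"
        using \<open>\<And>k. k \<le> D \<Longrightarrow> w k x0 = 0\<close>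
        by (auto simp: cc_def intro!: polA_uminus polA_sum polA_mult wA C)
    qed (auto intro: polA_const)
    then obtain h where h: "h \<in> polA A" "h x0 \<noteq> 0" "\<And>i. i < d \<Longrightarrow> (\<lambda>x. h x * x $ a ^ i) \<in> I" by blast
    show False
    proof (cases "d = 0")
      case True
      then show False using monic one by simp
    next
      case False
      then show False using h(3)[of 0] x0[of h] h by simp
    qed
  qed
  have "\<exists>s. \<forall>f\<in>I. f (ev s) = 0"
  proof (rule ccontr)
    assume "\<nexists>s. \<forall>f\<in>I. f (ev s) = 0"
    then have nz: "\<And>s. \<exists>f\<in>I. f (ev s) \<noteq> 0" by blast
    \<comment> \<open>the restriction of \<open>I\<close> to the line, an ideal of \<open>k[s]\<close>\<close>
    define P where "P = {q. \<exists>f\<in>I. \<forall>s. f (ev s) = poly q s}"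
    have polyrep: "\<exists>q\<in>P. \<forall>s. f (ev s) = poly q s" if f: "f \<in> I" for f
    proof -
      obtain u D where u: "\<And>i. u i \<in> polA A" "\<And>x. f x = (\<Sum>i\<le>D. u i x * x $ a ^ i)"
        using polA_insert_expand[OF pideal_sub[OF I f]] by blast
      have "\<forall>s. f (ev s) = poly (\<Sum>i\<le>D. monom (u i x0) i) s"
        by (simp add: u(2) ev_A[OF u(1)] ev_a poly_sum poly_monom)
      then show ?thesis using f by (auto simp: P_def)
    qed
    have P_comb: "r - t * q \<in> P" if rq: "r \<in> P" "q \<in> P" for r t q
    proof -
      obtain f1 f2 where f: "f1 \<in> I" "\<forall>s. f1 (ev s) = poly r s" "f2 \<in> I" "\<forall>s. f2 (ev s) = poly q s"
        using rq by (auto simp: P_def)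
      have "(\<lambda>x. poly t (x $ a)) \<in> polA (insert a A)"
        unfolding poly_altdef by (intro polA_sum polA_mult polA_const polA_power polA_coord) auto
      then have "(\<lambda>x. f1 x + - (poly t (x $ a) * f2 x)) \<in> I"
        by (intro pideal_add[OF I] pideal_uminus[OF I] pideal_mult[OF I] f)
      moreover have "\<forall>s. f1 (ev s) + - (poly t (ev s $ a) * f2 (ev s)) = poly (r - t * q) s"
        using f by (simp add: ev_a)
      ultimately show ?thesis unfolding P_def
        by (intro CollectI bexI[of _ "\<lambda>x. f1 x + - (poly t (x $ a) * f2 x)"])
    qed
    have "\<exists>q. q \<in> P \<and> q \<noteq> 0"
      using nz[of 0] polyrep by (metis poly_0)
    then obtain q where q: "q \<in> P" "q \<noteq> 0" and qmin: "\<And>r. r \<in> P \<Longrightarrow> r \<noteq> 0 \<Longrightarrow> degree q \<le> degree r"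
      using arg_min_nat_lemma[of "\<lambda>q. q \<in> P \<and> q \<noteq> 0" _ degree] by blast
    have deg0: "degree q = 0"
    proof (rule ccontr)
      assume "degree q \<noteq> 0"
      then obtain s0 where s0: "poly q s0 = 0" using alg_closed_imp_poly_has_root by blast
      obtain f r where f: "f \<in> I" "f (ev s0) \<noteq> 0" "r \<in> P" "\<forall>s. f (ev s) = poly r s"
        using nz[of s0] polyrep by blast
      have "r mod q = r - (r div q) * q" by (simp add: minus_div_mult_eq_mod)
      then have "r mod q \<in> P" using P_comb f q by simp
      then have "r mod q = 0" using qmin[of "r mod q"] degree_mod_less[OF q(2), of r] by (metis not_le)
      then have "q dvd r" by auto
      then show False using s0 f by (auto elim!: dvdE)
    qed
    then obtain e where e: "q = [:e:]" "e \<noteq> 0" using q by (metis degree_eq_zeroE pCons_0_0)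
    obtain f where f: "f \<in> I" "\<forall>s. f (ev s) = poly q s" using q by (auto simp: P_def)
    have "(\<lambda>x. inverse e * f x) \<in> I" by (intro pideal_mult[OF I f(1)] polA_const)
    then show False using no_unit[of "\<lambda>x. inverse e * f x"] f e by simp
  qed
  then show ?thesis unfolding ev_def .
qed

text \<open>Induction on the set of variables: after a shear the ideal contains an element that is monic
  in the new variable, its contraction to the other variables is again a proper ideal, and a zero of
  the contraction lifts.\<close>

theorem weak_nullstellensatz:
  fixes I :: "('k :: alg_closed_field ^ 'n :: finite \<Rightarrow> 'k) set"
  assumes "pideal A I" "(\<lambda>x. 1) \<notin> I"
  shows "\<exists>x. \<forall>f\<in>I. f x = 0"
proof -
  have "finite A" by simp
  then show ?thesis using assms
  proof (induction A arbitrary: I rule: finite_induct)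
    case empty
    have "f 0 = 0" if f: "f \<in> I" for f
    proof (rule ccontr)
      assume nz: "f 0 \<noteq> 0"
      have "f \<in> polA {}" using f empty pideal_sub by blast
      then have "f x = f 0" for x using polA_cong by blast
      then have "(\<lambda>x. inverse (f 0) * f x) = (\<lambda>x. 1)" using nz by (metis left_inverse)
      moreover have "(\<lambda>x. inverse (f 0) * f x) \<in> I" by (intro pideal_mult[OF empty(1) f] polA_const)
      ultimately show False using empty(2) by simp
    qed
    then show ?case by blast
  next
    case (insert a A I)
    show ?case
    proof (cases "\<exists>g\<in>I. \<exists>y. g y \<noteq> 0")
      case False
      then show ?thesis by blast
    next
      case True
      then obtain g y where g: "g \<in> I" "g y \<noteq> 0" by blast
      have I: "pideal (insert a A) I" by fact
      obtain c d \<kappa> p where c: "c $ a = 1" and \<kappa>: "\<kappa> \<noteq> 0" and p: "leads A d \<kappa> p"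
        and gp: "\<And>x. g (shear a c x) = poly (p x) (x $ a)"
        using exists_monic_shear[OF pideal_sub[OF I g(1)] g(2) insert(2)] by blast
      define c' where "c' = (\<chi> i. if i = a then 1 else - c $ i)"
      define I' where "I' = {\<lambda>x. f (shear a c x) | f. f \<in> I}"
      have sub: "h \<in> polA (insert a A)" if "h \<in> polA A" for h using that polA_mono by blast
      have I': "pideal (insert a A) I'" unfolding pideal_def
      proof (intro conjI ballI subsetI)
        fix f assume "f \<in> I'"
        then obtain f1 where "f = (\<lambda>x. f1 (shear a c x))" "f1 \<in> I" by (auto simp: I'_def)
        then show "f \<in> polA (insert a A)" using polA_shear[OF pideal_sub[OF I]] by simp
      next
        show "(\<lambda>x. 0) \<in> I'" using pideal_zero[OF I] by (force simp: I'_def)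
      next
        fix f g assume "f \<in> I'" "g \<in> I'"
        then obtain f1 g1 where "f = (\<lambda>x. f1 (shear a c x))" "g = (\<lambda>x. g1 (shear a c x))" "f1 \<in> I" "g1 \<in> I"
          by (auto simp: I'_def)
        then show "(\<lambda>x. f x + g x) \<in> I'"
          unfolding I'_def using pideal_add[OF I, of f1 g1] by (auto intro!: exI[of _ "\<lambda>x. f1 x + g1 x"])
      next
        fix f h :: "'k ^ 'n \<Rightarrow> 'k" assume "f \<in> I'" and h: "h \<in> polA (insert a A)"
        then obtain f1 where f1: "f = (\<lambda>x. f1 (shear a c x))" "f1 \<in> I" by (auto simp: I'_def)
        have "(\<lambda>x. h (shear a c' x) * f1 x) \<in> I"
          by (intro pideal_mult[OF I f1(2)] polA_shear h)
        then show "(\<lambda>x. h x * f x) \<in> I'"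
          unfolding I'_def f1(1) using shear_inverse(2)[OF c, folded c'_def]
          by (auto intro!: exI[of _ "\<lambda>x. h (shear a c' x) * f1 x"])
      qed
      have one: "(\<lambda>x. 1) \<notin> I'"
      proof
        assume "(\<lambda>x. 1) \<in> I'"
        then obtain f where f: "f \<in> I" "\<And>x. f (shear a c x) = 1" by (auto simp: I'_def fun_eq_iff)
        have "f x = 1" for x using f(2)[of "shear a c' x"] shear_inverse(1)[OF c, folded c'_def] by simp
        then have "f = (\<lambda>x. 1)" by blast
        then show False using f(1) insert.prems(2) by simp
      qed
      have "\<exists>x. \<forall>f\<in>I' \<inter> polA A. f x = 0"
      proof (rule insert.IH)
        show "pideal A (I' \<inter> polA A)"
          using I' unfolding pideal_def
          by (intro conjI ballI) (simp_all add: polA_zero polA_add polA_mult sub)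
      qed (use one in auto)
      then obtain x0 where x0: "\<And>f. f \<in> I' \<Longrightarrow> f \<in> polA A \<Longrightarrow> f x0 = 0" by blast
      define h where "h = (\<lambda>i x. inverse \<kappa> * coeff (p x) i)"
      have hA: "h i \<in> polA A" for i using p by (auto simp: h_def leads_def intro!: polA_scale)
      have monic: "(\<lambda>x. (\<Sum>i<d. h i x * x $ a ^ i) + x $ a ^ d) \<in> I'"
      proof -
        have "(\<lambda>x. inverse \<kappa> * g (shear a c x)) \<in> I'"
          by (intro pideal_mult[OF I'] polA_const) (use g in \<open>auto simp: I'_def\<close>)
        moreover have "inverse \<kappa> * g (shear a c x) = (\<Sum>i<d. h i x * x $ a ^ i) + x $ a ^ d" for x
        proof -
          have "poly (p x) (x $ a) = (\<Sum>i\<le>d. coeff (p x) i * x $ a ^ i)"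
            unfolding poly_altdef using p
            by (intro sum.mono_neutral_left) (auto simp: leads_def coeff_eq_0 not_le)
          also have "\<dots> = (\<Sum>i<d. coeff (p x) i * x $ a ^ i) + \<kappa> * x $ a ^ d"
            using p by (simp add: leads_def lessThan_Suc_atMost[symmetric])
          finally show ?thesis using \<kappa>
            by (simp add: gp h_def distrib_left sum_distrib_left mult.assoc[symmetric])
        qed
        ultimately show ?thesis by simp
      qed
      from zero_lifts_over_monic[OF I' insert(2) hA monic one x0]
      obtain s where s: "\<forall>f\<in>I'. f (\<chi> i. if i = a then s else x0 $ i) = 0" by (rule exE)
      have "f (shear a c (\<chi> i. if i = a then s else x0 $ i)) = 0" if "f \<in> I" for f
      proof -
        have "(\<lambda>x. f (shear a c x)) \<in> I'" using that unfolding I'_def by blast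
        from bspec[OF s this] show ?thesis .
      qed
      then show ?thesis by blast
    qed
  qed
qed

section \<open>The homogeneous Nullstellensatz\<close>

definition ray :: "('k :: alg_closed_field ^ 'n :: finite \<Rightarrow> 'k) \<Rightarrow> 'k ^ 'n \<Rightarrow> 'k poly" where
  "ray f x = (THE P. \<forall>s. poly P s = f (s *s x))"

lemma rayI: "(\<And>s. poly P s = f (s *s x)) \<Longrightarrow> ray f x = P"
  unfolding ray_def by (rule the_equality) (auto intro!: poly_eqI_alg_closed)

lemma poly_ray: "f \<in> pol d \<Longrightarrow> poly (ray f x) s = f (s *s x)"
proof -
  assume "f \<in> pol d"
  then obtain P where P: "\<forall>s. f (0 + s *s x) = poly P s" using pol_line by blast
  then have "ray f x = P" by (intro rayI) simp
  then show ?thesis using P by simp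
qed

text \<open>The homogeneous components of \<open>f\<close> are read off on the lines through the origin, as the
  coefficients of the polynomial \<open>s \<mapsto> f (s x)\<close>. Defined in this way they are unique and
  additive without choosing an expansion into monomials.\<close>

definition hpart :: "nat \<Rightarrow> ('k :: alg_closed_field ^ 'n :: finite \<Rightarrow> 'k) \<Rightarrow> 'k ^ 'n \<Rightarrow> 'k" where
  "hpart i f x = coeff (ray f x) i"

lemma hpart_components:
  assumes "\<And>j. g j \<in> form j" "\<And>x. f x = (\<Sum>j\<le>d. g j x)"
  shows "hpart i f = (if i \<le> d then g i else (\<lambda>x. 0))"
proof
  fix x
  have "ray f x = (\<Sum>j\<le>d. monom (g j x) j)"
    by (rule rayI) (simp add: assms(2) poly_sum poly_monom form_scaling[OF assms(1)] mult.commute)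
  then show "hpart i f x = (if i \<le> d then g i else (\<lambda>x. 0)) x"
    by (simp add: hpart_def coeff_sum sum.delta)
qed

lemma hpart_form: "f \<in> pol d \<Longrightarrow> hpart i f \<in> form i"
  and hpart_sum: "f \<in> pol d \<Longrightarrow> f x = (\<Sum>j\<le>d. hpart j f x)"
  and hpart_above: "f \<in> pol d \<Longrightarrow> d < i \<Longrightarrow> hpart i f = (\<lambda>x. 0)"
proof -
  assume "f \<in> pol d"
  then obtain g where g: "\<And>j. g j \<in> form j" "\<And>x. f x = (\<Sum>j\<le>d. g j x)"
    using pol_components by blast
  show "hpart i f \<in> form i" "f x = (\<Sum>j\<le>d. hpart j f x)" "d < i \<Longrightarrow> hpart i f = (\<lambda>x. 0)"
    using g by (simp_all add: hpart_components[OF g])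
qed

lemma hpart_add: "f \<in> pol d \<Longrightarrow> g \<in> pol e \<Longrightarrow> hpart i (\<lambda>x. f x + g x) x = hpart i f x + hpart i g x"
  unfolding hpart_def by (subst rayI[where P = "ray f x + ray g x"]) (auto simp: poly_ray)

lemma hpart_const: "hpart i (\<lambda>x. c) x = (if i = 0 then c else 0)"
  unfolding hpart_def by (subst rayI[where P = "[:c:]"]) (auto simp: coeff_pCons split: nat.split)

lemma hpart_sum_fun:
  assumes "\<And>j. j \<in> J \<Longrightarrow> f j \<in> pol (d j)"
  shows "hpart i (\<lambda>x. \<Sum>j\<in>J. f j x) x = (\<Sum>j\<in>J. hpart i (f j) x)"
  unfolding hpart_def
  by (subst rayI[where P = "\<Sum>j\<in>J. ray (f j) x"])
    (auto simp: poly_ray[OF assms] poly_sum coeff_sum intro!: sum.cong)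

lemma hpart_form_mult:
  assumes "G \<in> form q" "f \<in> pol d"
  shows "hpart i (\<lambda>x. G x * f x) x = (if i < q then 0 else G x * hpart (i - q) f x)"
proof -
  have "ray (\<lambda>x. G x * f x) x = monom (G x) q * ray f x"
    by (rule rayI) (simp add: poly_monom poly_ray[OF assms(2)] form_scaling[OF assms(1)] mult_ac)
  then show ?thesis by (auto simp: hpart_def coeff_monom_mult)
qed

text \<open>  The functions \<open>G j\<close> and \<open>1 - H\<close> have no common zero, so they generate the unit ideal:
  \<open>1 = \<Sum> G\<^sub>j K\<^sub>j + (1 - H) L\<close>. By comparing components of degree \<open>m e\<close>, the component of \<open>L\<close> there is
  \<open>H\<^sup>m\<close> up to multiples of the \<open>G\<^sub>j\<close>, for every \<open>m\<close>. Since \<open>L\<close> is a polynomial, this component is zero for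
  large \<open>m\<close>. Homogeneity thus replaces the extra variable of Rabinowitsch's trick.\<close>

theorem homogeneous_nullstellensatz:
  fixes G :: "'b \<Rightarrow> 'k :: alg_closed_field ^ 'n :: finite \<Rightarrow> 'k"
  assumes J: "finite J" and G: "\<And>j. j \<in> J \<Longrightarrow> G j \<in> form q" and q: "q \<ge> 1"
    and H: "H \<in> form e" and e: "e \<ge> 1"
    and zeros: "\<And>x. (\<And>j. j \<in> J \<Longrightarrow> G j x = 0) \<Longrightarrow> H x = 0"
  shows "\<exists>m K. q \<le> m * e \<and> (\<forall>j\<in>J. K j \<in> form (m * e - q)) \<and> (\<forall>x. H x ^ m = (\<Sum>j\<in>J. G j x * K j x))"
proof -
  define I where "I = {\<lambda>x. (\<Sum>j\<in>J. G j x * K j x) + (1 - H x) * L x | K L. (\<forall>j. K j \<in> polA UNIV) \<and> L \<in> polA UNIV}"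
  have GA: "G j \<in> polA UNIV" if "j \<in> J" for j using G[OF that] form_imp_pol polA_UNIV_iff by blast
  have HA: "H \<in> polA UNIV" using H form_imp_pol polA_UNIV_iff by blast
  have I: "pideal UNIV I" unfolding pideal_def
  proof (intro conjI ballI subsetI)
    fix f assume "f \<in> I"
    then show "f \<in> polA UNIV"
      unfolding I_def using GA HA by (auto intro!: polA_add polA_mult polA_sum polA_diff polA_const)
  next
    show "(\<lambda>x. 0) \<in> I" unfolding I_def
      by (rule CollectI, rule exI[of _ "\<lambda>_ _. 0"], rule exI[of _ "\<lambda>_. 0"]) (auto intro: polA_zero)
  next
    fix f g assume "f \<in> I" "g \<in> I"
    then obtain K L K' L' where 1: "f = (\<lambda>x. (\<Sum>j\<in>J. G j x * K j x) + (1 - H x) * L x)"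
      "\<forall>j. K j \<in> polA UNIV" "L \<in> polA UNIV"
      and 2: "g = (\<lambda>x. (\<Sum>j\<in>J. G j x * K' j x) + (1 - H x) * L' x)"
      "\<forall>j. K' j \<in> polA UNIV" "L' \<in> polA UNIV" by (auto simp: I_def)
    show "(\<lambda>x. f x + g x) \<in> I" unfolding I_def 1(1) 2(1)
      by (rule CollectI, rule exI[of _ "\<lambda>j x. K j x + K' j x"], rule exI[of _ "\<lambda>x. L x + L' x"])
        (use 1(2,3) 2(2,3) in \<open>auto intro!: polA_add simp: fun_eq_iff algebra_simps sum.distrib\<close>)
  next
    fix f h :: "'k ^ 'n \<Rightarrow> 'k" assume "f \<in> I" and h: "h \<in> polA UNIV"
    then obtain K L where 1: "f = (\<lambda>x. (\<Sum>j\<in>J. G j x * K j x) + (1 - H x) * L x)"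
      "\<forall>j. K j \<in> polA UNIV" "L \<in> polA UNIV" by (auto simp: I_def)
    show "(\<lambda>x. h x * f x) \<in> I" unfolding I_def 1(1)
      by (rule CollectI, rule exI[of _ "\<lambda>j x. h x * K j x"], rule exI[of _ "\<lambda>x. h x * L x"])
        (use 1(2,3) h in \<open>auto intro!: polA_mult simp: fun_eq_iff algebra_simps sum_distrib_left\<close>)
  qed
  have "(\<lambda>x. 1) \<in> I"
  proof (rule ccontr)
    assume "(\<lambda>x. 1) \<notin> I"
    from weak_nullstellensatz[OF I this] obtain x where x: "\<And>f. f \<in> I \<Longrightarrow> f x = 0" by auto
    have "G j x = 0" if "j \<in> J" for j
    proof -
      have "G j \<in> I" unfolding I_def
        by (rule CollectI, rule exI[of _ "\<lambda>i x. if i = j then 1 else 0"], rule exI[of _ "\<lambda>_. 0"])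
          (use that J in \<open>auto simp: polA_const if_distrib cong: if_cong\<close>)
      then show ?thesis using x by blast
    qed
    then have "H x = 0" using zeros by blast
    moreover have "(\<lambda>x. 1 - H x) \<in> I" unfolding I_def
      by (rule CollectI, rule exI[of _ "\<lambda>i x. 0"], rule exI[of _ "\<lambda>_. 1"]) (auto simp: polA_const)
    ultimately show False using x[of "\<lambda>x. 1 - H x"] by simp
  qed
  then obtain K L where KL: "\<And>j. K j \<in> polA UNIV" "L \<in> polA UNIV"
    and one: "(\<lambda>x. 1) = (\<lambda>x. (\<Sum>j\<in>J. G j x * K j x) + (1 - H x) * L x)" by (auto simp: I_def)
  have "\<forall>j. \<exists>d. K j \<in> pol d" using KL(1) polA_UNIV_iff by blast
  from choice[OF this] obtain dK where dK: "\<And>j. K j \<in> pol (dK j)" by blast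
  obtain l where l: "L \<in> pol l" using KL(2) polA_UNIV_iff by blast
  \<comment> \<open>the component of degree \<open>i\<close> of the identity \<open>1 + H L = \<Sum> G\<^sub>j K\<^sub>j + L\<close>\<close>
  have comp: "(if i = 0 then 1 else 0) + (if i < e then 0 else H x * hpart (i - e) L x) =
     (\<Sum>j\<in>J. (if i < q then 0 else G j x * hpart (i - q) (K j) x)) + hpart i L x" for i x
  proof -
    have "1 + H x * L x = (\<Sum>j\<in>J. G j x * K j x) + L x" for x
      using fun_cong[OF one, of x] by (simp add: algebra_simps)
    then have "hpart i (\<lambda>x. 1 + H x * L x) x = hpart i (\<lambda>x. (\<Sum>j\<in>J. G j x * K j x) + L x) x" by simp
    also have "hpart i (\<lambda>x. 1 + H x * L x) x = (if i = 0 then 1 else 0) + (if i < e then 0 else H x * hpart (i - e) L x)"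
      by (subst hpart_add[OF pol_const[of 1 0] pol_mult[OF form_imp_pol[OF H] l]])
        (simp add: hpart_const hpart_form_mult[OF H l])
    also have "hpart i (\<lambda>x. (\<Sum>j\<in>J. G j x * K j x) + L x) x = hpart i (\<lambda>x. \<Sum>j\<in>J. G j x * K j x) x + hpart i L x"
    proof (rule hpart_add[OF _ l])
      have "(\<lambda>x. \<Sum>j\<in>J. G j x * K j x) \<in> polA UNIV" by (intro polA_sum polA_mult GA KL)
      then show "(\<lambda>x. \<Sum>j\<in>J. G j x * K j x) \<in> pol (SOME d. (\<lambda>x. \<Sum>j\<in>J. G j x * K j x) \<in> pol d)"
        unfolding polA_UNIV_iff by (rule someI_ex)
    qed
    also have "hpart i (\<lambda>x. \<Sum>j\<in>J. G j x * K j x) x = (\<Sum>j\<in>J. (if i < q then 0 else G j x * hpart (i - q) (K j) x))"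
      by (subst hpart_sum_fun[where d = "\<lambda>j. q + dK j"])
        (auto intro!: pol_mult[OF form_imp_pol[OF G] dK] sum.cong simp: hpart_form_mult[OF G dK])
    finally show ?thesis .
  qed
  \<comment> \<open>\<open>m * e - q\<close> is truncated, so for \<open>m * e < q\<close> the cofactors have to be zero\<close>
  have "\<exists>K. (\<forall>j\<in>J. K j \<in> form (m * e - q) \<and> (m * e < q \<longrightarrow> K j = (\<lambda>x. 0))) \<and>
     (\<forall>x. hpart (m * e) L x = H x ^ m - (\<Sum>j\<in>J. G j x * K j x))" for m
  proof (induction m)
    case 0
    have "hpart 0 L x = 1" for x using comp[of 0 x] q e by simp
    then show ?case by (intro exI[of _ "\<lambda>_ _. 0"]) simp
  next
    case (Suc m)
    then obtain M where M: "\<And>j. j \<in> J \<Longrightarrow> M j \<in> form (m * e - q)"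
      "\<And>j. j \<in> J \<Longrightarrow> m * e < q \<Longrightarrow> M j = (\<lambda>x. 0)"
      "\<And>x. hpart (m * e) L x = H x ^ m - (\<Sum>j\<in>J. G j x * M j x)" by blast
    define i where "i = Suc m * e"
    have i: "i > 0" "i \<ge> e" "i - e = m * e" using e by (auto simp: i_def)
    define M' where "M' = (\<lambda>j x. H x * M j x + (if i < q then 0 else hpart (i - q) (K j) x))"
    have "hpart i L x = H x ^ Suc m - (\<Sum>j\<in>J. G j x * M' j x)" for x
    proof -
      have "hpart i L x = H x * hpart (m * e) L x - (\<Sum>j\<in>J. (if i < q then 0 else G j x * hpart (i - q) (K j) x))"
        using comp[of i x] i by (simp add: algebra_simps)
      also have "\<dots> = H x ^ Suc m - (\<Sum>j\<in>J. G j x * M' j x)"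
      proof -
        have "(\<Sum>j\<in>J. (if i < q then 0 else G j x * hpart (i - q) (K j) x)) =
          (\<Sum>j\<in>J. G j x * (if i < q then 0 else hpart (i - q) (K j) x))" by (rule sum.cong) auto
        then show ?thesis
          unfolding M(3) M'_def by (simp add: algebra_simps sum_distrib_left sum.distrib)
      qed
      finally show ?thesis .
    qed
    moreover have "M' j \<in> form (i - q) \<and> (i < q \<longrightarrow> M' j = (\<lambda>x. 0))" if j: "j \<in> J" for j
    proof -
      have "(\<lambda>x. H x * M j x) \<in> form (i - q) \<and> (i < q \<longrightarrow> (\<lambda>x. H x * M j x) = (\<lambda>x. 0))"
      proof (cases "m * e < q")
        case False
        then have "e + (m * e - q) = i - q" "\<not> i < q" by (auto simp: i_def)
        then show ?thesis using form_mult[OF H M(1)[OF j]] by simp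
      qed (use M(2)[OF j] in simp)
      moreover have "(\<lambda>x. if i < q then 0 else hpart (i - q) (K j) x) \<in> form (i - q)"
        by (cases "i < q") (auto intro: hpart_form[OF dK])
      ultimately show ?thesis
        unfolding M'_def by (auto intro!: form_add simp: fun_eq_iff)
    qed
    ultimately show ?case unfolding i_def by blast
  qed
  moreover define m where "m = l + q + 1"
  ultimately obtain M where M: "\<forall>j\<in>J. M j \<in> form (m * e - q)"
     "\<forall>x. hpart (m * e) L x = H x ^ m - (\<Sum>j\<in>J. G j x * M j x)" by blast
  have "m * e \<ge> m * 1" using e by (intro mult_left_mono) auto
  then have "m * e > l" "q \<le> m * e" by (auto simp: m_def)
  then have "hpart (m * e) L = (\<lambda>x. 0)" using hpart_above[OF l] by blast
  then have "\<forall>x. H x ^ m = (\<Sum>j\<in>J. G j x * M j x)" using M(2) by simp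
  then show ?thesis using M(1) \<open>q \<le> m * e\<close> by blast
qed

section \<open>Finiteness\<close>

lemma finite_wt: "finite {\<alpha> :: 'n :: finite \<Rightarrow> nat. wt \<alpha> \<le> d}"
proof (rule finite_subset)
  show "{\<alpha> :: 'n \<Rightarrow> nat. wt \<alpha> \<le> d} \<subseteq> (\<Pi>\<^sub>E i\<in>UNIV. {..d})"
  proof (rule subsetI, unfold mem_Collect_eq)
    fix \<alpha> :: "'n \<Rightarrow> nat" assume "wt \<alpha> \<le> d"
    then have "\<alpha> i \<le> d" for i using member_le_sum[of i UNIV \<alpha>] by (simp add: wt_def)
    then show "\<alpha> \<in> (\<Pi>\<^sub>E i\<in>UNIV. {..d})" by auto
  qed
qed (auto intro: finite_PiE)

lemma finite_wt_less: "finite {\<alpha> :: 'n :: finite \<Rightarrow> nat. wt \<alpha> < d}"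
  by (rule finite_subset[OF _ finite_wt[of d]]) auto

lemma pspan_coeffs:
  assumes "f \<in> pspan M" "finite M"
  shows "\<exists>c. \<forall>x. f x = (\<Sum>\<alpha>\<in>M. c \<alpha> * pmon \<alpha> x)"
  using assms(1)
proof (induction rule: pspan_induct)
  case zero
  show ?case by (intro exI[of _ "\<lambda>_. 0"]) auto
next
  case (add e \<alpha> g)
  then obtain c where "\<forall>x. g x = (\<Sum>\<alpha>\<in>M. c \<alpha> * pmon \<alpha> x)" by blast
  moreover have "(\<Sum>\<beta>\<in>M. (if \<beta> = \<alpha> then e else 0) * pmon \<beta> x) = e * pmon \<alpha> x" for x
    using add assms(2) by (simp add: if_distrib[of "\<lambda>u. u * _"] sum.delta cong: if_cong)
  ultimately show ?case
    by (intro exI[of _ "\<lambda>\<beta>. (if \<beta> = \<alpha> then e else 0) + c \<beta>"]) (simp add: distrib_right sum.distrib)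
qed

text \<open>A power of every coordinate lies in the ideal generated by the \<open>F\<^sub>i\<close>, and a monomial of
  large degree is divisible by one of these powers.\<close>

lemma forms_in_ideal:
  fixes F :: "'k :: alg_closed_field ^ 'n :: finite \<Rightarrow> 'k ^ 'n"
  assumes F: "\<And>i. (\<lambda>x. F x $ i) \<in> form q" and q: "q \<ge> 1" and nz: "\<And>x. F x = 0 \<Longrightarrow> x = 0"
  shows "\<exists>D0\<ge>q. \<forall>D\<ge>D0. \<forall>f\<in>form D. \<exists>K. (\<forall>i. K i \<in> form (D - q)) \<and> (\<forall>x. f x = (\<Sum>i\<in>UNIV. F x $ i * K i x))"
proof -
  have zeros: "x $ a = 0" if "\<And>j. j \<in> UNIV \<Longrightarrow> F x $ j = 0" for x a
  proof -
    have "F x = 0" using that by (simp add: Finite_Cartesian_Product.vec_eq_iff)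
    then show ?thesis using nz[of x] by simp
  qed
  have "\<exists>m K. q \<le> m * 1 \<and> (\<forall>j\<in>UNIV. K j \<in> form (m * 1 - q)) \<and> (\<forall>x. (x $ a) ^ m = (\<Sum>j\<in>UNIV. F x $ j * K j x))" for a
    by (rule homogeneous_nullstellensatz[OF _ F q coord_form]) (simp, simp, rule zeros, simp)
  then have "\<forall>a. \<exists>mK. q \<le> fst mK \<and> (\<forall>j. snd mK j \<in> form (fst mK - q)) \<and>
      (\<forall>x. (x $ a) ^ fst mK = (\<Sum>j\<in>UNIV. F x $ j * snd mK j x))"
    by (simp only: mult_1_right split_paired_Ex fst_conv snd_conv) simp
  from choice[OF this] obtain mK where mK': "\<And>a. q \<le> fst (mK a)" "\<And>a j. snd (mK a) j \<in> form (fst (mK a) - q)"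
    "\<And>a x. (x $ a) ^ fst (mK a) = (\<Sum>j\<in>UNIV. F x $ j * snd (mK a) j x)" by auto
  define m K where "m = fst \<circ> mK" and "K = snd \<circ> mK"
  have mK: "\<And>a. q \<le> m a" "\<And>a j. K a j \<in> form (m a - q)"
    "\<And>a x. (x $ a) ^ m a = (\<Sum>j\<in>UNIV. F x $ j * K a j x)" using mK' by (simp_all add: m_def K_def)
  define D0 where "D0 = sum m UNIV"
  have "q \<le> D0" unfolding D0_def using mK(1)[of undefined] member_le_sum[of undefined UNIV m] by simp
  moreover have "\<exists>L. (\<forall>i. L i \<in> form (D - q)) \<and> (\<forall>x. f x = (\<Sum>i\<in>UNIV. F x $ i * L i x))"
    if D: "D \<ge> D0" and f: "f \<in> form D" for D f
    using f unfolding form_def[of D]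
  proof (induction rule: pspan_induct)
    case zero
    show ?case by (intro exI[of _ "\<lambda>_ _. 0"]) auto
  next
    case (add c \<alpha> g)
    then obtain L where L: "\<forall>i. L i \<in> form (D - q)" "\<forall>x. g x = (\<Sum>i\<in>UNIV. F x $ i * L i x)" by blast
    have "\<exists>a. m a \<le> \<alpha> a"
    proof (rule ccontr)
      assume "\<nexists>a. m a \<le> \<alpha> a"
      then have "wt \<alpha> < D0" unfolding wt_def D0_def by (intro sum_strict_mono) (auto simp: not_le)
      then show False using add D by simp
    qed
    then obtain a where a: "m a \<le> \<alpha> a" by blast
    define \<beta> where "\<beta> = \<alpha>(a := \<alpha> a - m a)"
    have pm: "pmon \<alpha> x = (x $ a) ^ m a * pmon \<beta> x" for x
      using a by (simp add: pmon_def \<beta>_def prod.remove[of UNIV a] mult.assoc[symmetric] flip: power_add)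
    have wt: "wt \<beta> = D - m a"
    proof -
      have "wt \<alpha> = \<alpha> a + (\<Sum>i\<in>UNIV-{a}. \<alpha> i)" unfolding wt_def by (rule sum.remove) auto
      moreover have "wt \<beta> = \<beta> a + (\<Sum>i\<in>UNIV-{a}. \<beta> i)" unfolding wt_def by (rule sum.remove) auto
      moreover have "(\<Sum>i\<in>UNIV-{a}. \<beta> i) = (\<Sum>i\<in>UNIV-{a}. \<alpha> i)" by (rule sum.cong) (auto simp: \<beta>_def)
      ultimately show ?thesis using a add by (simp add: \<beta>_def)
    qed
    have "m a \<le> D" using D member_le_sum[of a UNIV m] unfolding D0_def by simp
    define L' where "L' = (\<lambda>i x. c * (K a i x * pmon \<beta> x) + L i x)"
    have "(\<lambda>x. K a i x * pmon \<beta> x) \<in> form (D - q)" for i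
    proof -
      have "(m a - q) + wt \<beta> = D - q" using mK(1)[of a] wt \<open>m a \<le> D\<close> by simp
      then show ?thesis using form_mult[OF mK(2)[of a i] pmon_form[of \<beta>]] by simp
    qed
    then have "\<forall>i. L' i \<in> form (D - q)" unfolding L'_def using L by (intro allI form_add form_scale) auto
    moreover have "c * pmon \<alpha> x + g x = (\<Sum>i\<in>UNIV. F x $ i * L' i x)" for x
      using L by (simp add: pm mK(3) L'_def algebra_simps sum.distrib sum_distrib_left sum_distrib_right)
    ultimately show ?case by blast
  qed
  ultimately show ?thesis by blast
qed

text \<open>  The monomials of degree below \<open>D0\<close> generate \<open>S\<close> over \<open>R\<close>: a form of larger degree is a
  combination of the \<open>F\<^sub>i\<close> whose coefficients have smaller degree. The bound \<open>D div q\<close> for the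
  coefficients is kept because the dimension counts depend on it.\<close>

theorem finite_over_subring:
  fixes F :: "'k :: alg_closed_field ^ 'n :: finite \<Rightarrow> 'k ^ 'n"
  assumes F: "\<And>i. (\<lambda>x. F x $ i) \<in> form q" and q: "q \<ge> 1" and nz: "\<And>x. F x = 0 \<Longrightarrow> x = 0"
  shows "\<exists>D0. \<forall>D. \<forall>f\<in>pol D. \<exists>r. (\<forall>\<beta>. r \<beta> \<in> pol (D div q)) \<and>
     (\<forall>x. f x = (\<Sum>\<beta> | wt \<beta> < D0. r \<beta> (F x) * pmon \<beta> x))"
proof -
  obtain D0 where D0: "D0 \<ge> q" "\<And>D f. D \<ge> D0 \<Longrightarrow> f \<in> form D \<Longrightarrow>
     \<exists>K. (\<forall>i. K i \<in> form (D - q)) \<and> (\<forall>x. f x = (\<Sum>i\<in>UNIV. F x $ i * K i x))"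
    using forms_in_ideal[OF F q nz] by metis
  define E where "E = {\<beta> :: 'n \<Rightarrow> nat. wt \<beta> < D0}"
  have E: "finite E" unfolding E_def by (rule finite_wt_less)
  have gen: "\<exists>r. (\<forall>\<beta>. r \<beta> \<in> pol (D div q)) \<and> (\<forall>x. f x = (\<Sum>\<beta>\<in>E. r \<beta> (F x) * pmon \<beta> x))"
    if "f \<in> form D" for f D
    using that
  proof (induction D arbitrary: f rule: less_induct)
    case (less D)
    show ?case
    proof (cases "D < D0")
      case True
      have "f \<in> pspan E"
        using less(2) True pspan_mono[of "{\<alpha>. wt \<alpha> = D}" E] unfolding form_def E_def by auto
      then obtain c where c: "\<forall>x. f x = (\<Sum>\<alpha>\<in>E. c \<alpha> * pmon \<alpha> x)" using pspan_coeffs E by blast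
      show ?thesis by (rule exI[of _ "\<lambda>\<beta> x. c \<beta>"]) (use c in auto)
    next
      case False
      then obtain K where K: "\<And>i. K i \<in> form (D - q)" "\<And>x. f x = (\<Sum>i\<in>UNIV. F x $ i * K i x)"
        using D0(2)[of D f] less(2) by force
      have "D - q < D" using q D0(1) False by auto
      then have "\<forall>i. \<exists>r. (\<forall>\<beta>. r \<beta> \<in> pol ((D - q) div q)) \<and> (\<forall>x. K i x = (\<Sum>\<beta>\<in>E. r \<beta> (F x) * pmon \<beta> x))"
        using less(1) K(1) by blast
      from choice[OF this] obtain r where r: "\<And>i \<beta>. r i \<beta> \<in> pol ((D - q) div q)"
        "\<And>i x. K i x = (\<Sum>\<beta>\<in>E. r i \<beta> (F x) * pmon \<beta> x)" by auto
      define r' where "r' = (\<lambda>\<beta> y. \<Sum>i\<in>UNIV. y $ i * r i \<beta> y)"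
      have dq: "1 + (D - q) div q = D div q"
        using q D0(1) False by (simp add: le_div_geq)
      have "r' \<beta> \<in> pol (D div q)" for \<beta>
        unfolding r'_def dq[symmetric] by (intro pol_sum pol_mult form_imp_pol coord_form r)
      moreover have "f x = (\<Sum>\<beta>\<in>E. r' \<beta> (F x) * pmon \<beta> x)" for x
        unfolding r'_def by (simp add: K(2) r(2) sum_distrib_left sum_distrib_right mult.assoc)
          (rule sum.swap)
      ultimately show ?thesis by blast
    qed
  qed
  have "\<exists>r. (\<forall>\<beta>. r \<beta> \<in> pol (D div q)) \<and> (\<forall>x. f x = (\<Sum>\<beta>\<in>E. r \<beta> (F x) * pmon \<beta> x))"
    if f: "f \<in> pol D" for f D
  proof -
    have "\<forall>j. \<exists>r. (\<forall>\<beta>. r \<beta> \<in> pol (j div q)) \<and> (\<forall>x. hpart j f x = (\<Sum>\<beta>\<in>E. r \<beta> (F x) * pmon \<beta> x))"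
      using gen[OF hpart_form[OF f]] by blast
    from choice[OF this] obtain r where r: "\<And>j \<beta>. r j \<beta> \<in> pol (j div q)"
       "\<And>j x. hpart j f x = (\<Sum>\<beta>\<in>E. r j \<beta> (F x) * pmon \<beta> x)" by auto
    have "(\<lambda>x. \<Sum>j\<le>D. r j \<beta> x) \<in> pol (D div q)" for \<beta>
      by (intro pol_sum pol_mono[OF _ r(1)] div_le_mono) auto
    moreover have "f x = (\<Sum>\<beta>\<in>E. (\<Sum>j\<le>D. r j \<beta> (F x)) * pmon \<beta> x)" for x
      unfolding hpart_sum[OF f, of x] r(2) sum_distrib_right by (rule sum.swap)
    ultimately show ?thesis by (intro exI[of _ "\<lambda>\<beta> x. \<Sum>j\<le>D. r j \<beta> x"]) blast
  qed
  then show ?thesis unfolding E_def by blast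
qed

section \<open>Counting monomials\<close>

lemma pmon_independent:
  fixes c :: "('n :: finite \<Rightarrow> nat) \<Rightarrow> 'k :: alg_closed_field"
  assumes "finite M" "\<And>x :: 'k ^ 'n. (\<Sum>\<alpha>\<in>M. c \<alpha> * pmon \<alpha> x) = 0" "\<alpha> \<in> M"
  shows "c \<alpha> = 0"
proof -
  have "\<forall>\<alpha>\<in>M. c \<alpha> = 0" if "finite A" "finite M" "\<And>\<alpha> i. \<alpha> \<in> M \<Longrightarrow> i \<notin> A \<Longrightarrow> \<alpha> i = 0"
      "\<And>x :: 'k ^ 'n. (\<Sum>\<alpha>\<in>M. c \<alpha> * pmon \<alpha> x) = 0"
    for A and M :: "('n \<Rightarrow> nat) set" and c :: "('n \<Rightarrow> nat) \<Rightarrow> 'k"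
    using that
  proof (induction A arbitrary: M c rule: finite_induct)
    case empty
    then have "M \<subseteq> {\<lambda>_. 0}" by auto
    then consider "M = {}" | "M = {\<lambda>_. 0}" by blast
    then show ?case using empty(3)[of 0] by cases auto
  next
    case (insert a A)
    show ?case
    proof
      fix \<alpha> assume \<alpha>: "\<alpha> \<in> M"
      define k where "k = \<alpha> a"
      define S where "S = {\<beta> \<in> M. \<beta> a = k}"
      have inj: "inj_on (\<lambda>\<beta>. \<beta>(a := 0)) S"
        by (auto simp: inj_on_def S_def fun_eq_iff fun_upd_def) metis
      have "\<forall>\<beta>\<in>(\<lambda>\<beta>. \<beta>(a := 0)) ` S. c (\<beta>(a := k)) = 0"
      proof (rule insert.IH)
        fix x :: "'k ^ 'n"
        define P where "P = (\<Sum>\<beta>\<in>M. monom (c \<beta> * pmon (\<beta>(a := 0)) x) (\<beta> a))"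
        have "poly P s = poly 0 s" for s
        proof -
          define y where "y = (\<chi> i. if i = a then s else x $ i)"
          have "pmon \<beta> y = pmon (\<beta>(a := 0)) x * s ^ \<beta> a" for \<beta>
          proof -
            have "(\<Prod>i\<in>UNIV-{a}. y $ i ^ \<beta> i) = (\<Prod>i\<in>UNIV-{a}. x $ i ^ (\<beta>(a := 0)) i)"
              by (rule prod.cong) (auto simp: y_def)
            then show ?thesis
              by (simp add: pmon_def prod.remove[of UNIV a] y_def)
          qed
          then show ?thesis using insert.prems(3)[of y]
            by (simp add: P_def poly_sum poly_monom mult.assoc)
        qed
        then have "coeff P k = 0" using poly_eqI_alg_closed[of P 0] by simp
        moreover have "coeff P k = (\<Sum>\<beta>\<in>S. c \<beta> * pmon (\<beta>(a := 0)) x)"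
          unfolding P_def coeff_sum S_def using insert.prems(1)
          by (simp add: sum.inter_filter)
        moreover have "(\<Sum>\<beta>\<in>(\<lambda>\<beta>. \<beta>(a := 0)) ` S. c (\<beta>(a := k)) * pmon \<beta> x) = (\<Sum>\<beta>\<in>S. c \<beta> * pmon (\<beta>(a := 0)) x)"
          by (subst sum.reindex[OF inj]) (auto simp: S_def intro!: sum.cong)
        ultimately show "(\<Sum>\<beta>\<in>(\<lambda>\<beta>. \<beta>(a := 0)) ` S. c (\<beta>(a := k)) * pmon \<beta> x) = 0" by simp
      next
        show "finite ((\<lambda>\<beta>. \<beta>(a := 0)) ` S)" using insert.prems(1) by (simp add: S_def)
      next
        fix \<beta> i assume "\<beta> \<in> (\<lambda>\<beta>. \<beta>(a := 0)) ` S" and i: "i \<notin> A"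
        then obtain \<gamma> where \<gamma>: "\<gamma> \<in> M" "\<beta> = \<gamma>(a := 0)" by (auto simp: S_def)
        show "\<beta> i = 0"
        proof (cases "i = a")
          case False
          then have "\<gamma> i = 0" using i by (intro insert.prems(2)[OF \<gamma>(1)]) simp
          then show ?thesis using False by (simp add: \<gamma>(2))
        qed (simp add: \<gamma>(2))
      qed
      moreover have "\<alpha> \<in> S" using \<alpha> by (simp add: S_def k_def)
      ultimately have "c ((\<alpha>(a := 0))(a := k)) = 0" by blast
      then show "c \<alpha> = 0" by (simp add: k_def)
    qed
  qed
  from this[of UNIV M c] show ?thesis using assms by auto
qed

text \<open>The exponent of \<open>a\<close> is recorded as \<open>d - k\<close>, where \<open>k\<close> bounds the total degree in the other
  variables, so that the recursion is the hockey-stick identity.\<close>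

lemma card_wt_le:
  fixes A :: "'n :: finite set"
  shows "card {\<alpha> :: 'n \<Rightarrow> nat. (\<forall>i. i \<notin> A \<longrightarrow> \<alpha> i = 0) \<and> wt \<alpha> \<le> d} = (d + card A) choose card A"
proof -
  have "finite A" by simp
  then show ?thesis
  proof (induction A arbitrary: d rule: finite_induct)
    case empty
    have "{\<alpha> :: 'n \<Rightarrow> nat. (\<forall>i. i \<notin> {} \<longrightarrow> \<alpha> i = 0) \<and> wt \<alpha> \<le> d} = {\<lambda>_. 0}" by (auto simp: wt_def)
    then show ?case by simp
  next
    case (insert a A)
    let ?S = "\<lambda>A d. {\<alpha> :: 'n \<Rightarrow> nat. (\<forall>i. i \<notin> A \<longrightarrow> \<alpha> i = 0) \<and> wt \<alpha> \<le> d}"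
    have wt_upd: "wt (\<alpha>(a := k)) + \<alpha> a = wt \<alpha> + k" for \<alpha> :: "'n \<Rightarrow> nat" and k
    proof -
      have "wt \<alpha> = \<alpha> a + (\<Sum>i\<in>UNIV-{a}. \<alpha> i)" for \<alpha> :: "'n \<Rightarrow> nat" unfolding wt_def by (rule sum.remove) auto
      from this[of \<alpha>] this[of "\<alpha>(a := k)"] show ?thesis
        by (simp add: sum.cong[of "UNIV-{a}" "UNIV-{a}" "\<alpha>(a := k)" \<alpha>])
    qed
    have fin: "finite (?S A d)" for d by (rule finite_subset[OF _ finite_wt[of d]]) auto
    have "bij_betw (\<lambda>(k, \<beta>). \<beta>(a := d - k)) (SIGMA k:{..d}. ?S A k) (?S (insert a A) d)"
    proof (rule bij_betwI[where g = "\<lambda>\<alpha>. (d - \<alpha> a, \<alpha>(a := 0))"])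
      show "(\<lambda>(k, \<beta>). \<beta>(a := d - k)) \<in> (SIGMA k:{..d}. ?S A k) \<rightarrow> ?S (insert a A) d"
      proof (clarsimp)
        fix k and \<beta> :: "'n \<Rightarrow> nat" assume "k \<le> d" "\<forall>i. i \<notin> A \<longrightarrow> \<beta> i = 0" "wt \<beta> \<le> k"
        then show "wt (\<beta>(a := d - k)) \<le> d" using wt_upd[of \<beta> "d - k"] insert(2) by auto
      qed
      show "(\<lambda>\<alpha>. (d - \<alpha> a, \<alpha>(a := 0))) \<in> ?S (insert a A) d \<rightarrow> (SIGMA k:{..d}. ?S A k)"
      proof (clarsimp)
        fix \<alpha> :: "'n \<Rightarrow> nat" assume "wt \<alpha> \<le> d"
        then show "wt (\<alpha>(a := 0)) \<le> d - \<alpha> a" using wt_upd[of \<alpha> 0] by auto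
      qed
      fix x assume "x \<in> (SIGMA k:{..d}. ?S A k)"
      then show "(\<lambda>\<alpha>. (d - \<alpha> a, \<alpha>(a := 0))) ((\<lambda>(k, \<beta>). \<beta>(a := d - k)) x) = x"
        using insert(2) by (auto simp: fun_eq_iff)
    next
      fix \<alpha> assume "\<alpha> \<in> ?S (insert a A) d"
      then have "\<alpha> a \<le> d" using wt_upd[of \<alpha> 0] by auto
      then show "(\<lambda>(k, \<beta>). \<beta>(a := d - k)) (d - \<alpha> a, \<alpha>(a := 0)) = \<alpha>" by (auto simp: fun_eq_iff)
    qed
    then have "card (?S (insert a A) d) = card (SIGMA k:{..d}. ?S A k)" by (simp add: bij_betw_same_card)
    also have "\<dots> = (\<Sum>k\<le>d. card (?S A k))" using fin by (intro card_SigmaI) auto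
    also have "\<dots> = (\<Sum>k\<le>d. (card A + k) choose card A)" by (simp add: insert.IH add.commute)
    also have "\<dots> = (card A + d + 1) choose (card A + 1)" by (rule choose_rising_sum(1))
    also have "\<dots> = (d + card (insert a A)) choose card (insert a A)" using insert by (simp add: add.commute)
    finally show ?case .
  qed
qed

text \<open>The dimension of \<open>pol d\<close>; the dummy argument carries the number of variables.\<close>

definition count_wt :: "'n :: finite itself \<Rightarrow> nat \<Rightarrow> nat" where
  "count_wt _ d = card {\<alpha> :: 'n \<Rightarrow> nat. wt \<alpha> \<le> d}"

lemma count_wt_eq: "count_wt TYPE('n :: finite) d = (d + CARD('n)) choose CARD('n)"
  using card_wt_le[of "UNIV :: 'n set" d] by (simp add: count_wt_def)

lemma count_wt_pos: "count_wt TYPE('n :: finite) d > 0"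
  by (simp add: count_wt_eq)

lemma count_wt_mono: "d \<le> e \<Longrightarrow> count_wt TYPE('n :: finite) d \<le> count_wt TYPE('n) e"
  unfolding count_wt_def by (intro card_mono finite_wt) auto

text \<open>The dimension is a polynomial in \<open>d\<close> of degree \<open>CARD('n)\<close>, so shifts of the argument do not
  affect the limit and the factor \<open>q\<close> enters with the power \<open>CARD('n)\<close>. The three lemmas after
  this one turn inequalities between dimensions into bounds for ranks.\<close>

lemma count_wt_ratio:
  "(\<lambda>d. real (count_wt TYPE('n :: finite) (q * d + c)) / real (count_wt TYPE('n) (d + c'))) \<longlonglongrightarrow> real q ^ CARD('n)"
proof -
  let ?N = "CARD('n)"
  have poch: "real (count_wt TYPE('n) d) = (\<Prod>i<?N. real d + 1 + real i) / fact ?N" for d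
    unfolding count_wt_eq binomial_gbinomial gbinomial_pochhammer'
    by (simp add: pochhammer_prod atLeast0LessThan add_ac)
  have factor: "(\<lambda>d. (real (q * d + c) + 1 + real i) / (real (d + c') + 1 + real i)) \<longlonglongrightarrow> real q" for i
  proof -
    have "(\<lambda>d. real q + (real c + 1 + real i - real q * (real c' + 1 + real i)) / ((real c' + 1 + real i) + real d)) \<longlonglongrightarrow> real q + 0"
    proof (intro tendsto_add tendsto_const tendsto_divide_0[OF tendsto_const] filterlim_at_top_imp_at_infinity)
      show "filterlim (\<lambda>d. (real c' + 1 + real i) + real d) at_top sequentially"
        by (rule filterlim_tendsto_add_at_top[OF tendsto_const filterlim_real_sequentially])
    qed
    moreover have "real q + (real c + 1 + real i - real q * (real c' + 1 + real i)) / ((real c' + 1 + real i) + real d)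
        = (real (q * d + c) + 1 + real i) / (real (d + c') + 1 + real i)" for d
    proof -
      have "(real c' + 1 + real i) + real d \<noteq> 0" by linarith
      then show ?thesis by (simp add: field_simps)
    qed
    ultimately show ?thesis by simp
  qed
  have "(\<lambda>d. \<Prod>i<?N. (real (q * d + c) + 1 + real i) / (real (d + c') + 1 + real i)) \<longlonglongrightarrow> (\<Prod>i<?N. real q)"
    by (intro tendsto_prod factor)
  moreover have "(\<Prod>i<?N. (real (q * d + c) + 1 + real i) / (real (d + c') + 1 + real i)) =
     real (count_wt TYPE('n) (q * d + c)) / real (count_wt TYPE('n) (d + c'))" for d
    unfolding poch by (simp add: prod_dividef)
  ultimately show ?thesis by simp
qed

lemma count_upper:
  assumes "\<And>d. m * count_wt TYPE('n :: finite) d \<le> count_wt TYPE('n) (q * d + c)"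
  shows "m \<le> q ^ CARD('n)"
proof -
  have "real m \<le> real (count_wt TYPE('n) (q * d + c)) / real (count_wt TYPE('n) (d + 0))" for d
    using assms[of d] count_wt_pos[of d, where 'n = 'n]
    by (simp add: pos_le_divide_eq flip: of_nat_mult)
  then have "real m \<le> real q ^ CARD('n)" by (intro Lim_bounded2[OF count_wt_ratio[of q c 0, where 'n = 'n]]) auto
  then show ?thesis by (simp flip: of_nat_power)
qed

lemma count_lower:
  assumes "\<And>d. count_wt TYPE('n :: finite) (q * d) \<le> m * count_wt TYPE('n) (d + c)"
  shows "q ^ CARD('n) \<le> m"
proof -
  have "real m \<ge> real (count_wt TYPE('n) (q * d + 0)) / real (count_wt TYPE('n) (d + c))" for d
    using assms[of d] count_wt_pos[of "d + c", where 'n = 'n]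
    by (simp add: pos_divide_le_eq flip: of_nat_mult)
  then have "real m \<ge> real q ^ CARD('n)" by (intro Lim_bounded[OF count_wt_ratio[of q 0 c, where 'n = 'n]]) auto
  then show ?thesis by (simp flip: of_nat_power)
qed

lemma count_defect:
  assumes "\<And>d. count_wt TYPE('n :: finite) (d + e) \<le> m * (count_wt TYPE('n) (d + e) - count_wt TYPE('n) d)"
  shows False
proof -
  let ?r = "\<lambda>d. real (count_wt TYPE('n) (1 * d + 0)) / real (count_wt TYPE('n) (d + e))"
  have "(\<lambda>d. real m * (1 - ?r d)) \<longlonglongrightarrow> real m * (1 - real 1 ^ CARD('n))"
    by (intro tendsto_intros count_wt_ratio)
  then have lim: "(\<lambda>d. real m * (1 - ?r d)) \<longlonglongrightarrow> 0" by simp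
  have "1 \<le> real m * (1 - ?r d)" for d
  proof -
    have pos: "real (count_wt TYPE('n) (d + e)) > 0" using count_wt_pos by simp
    have "real (count_wt TYPE('n) (d + e)) \<le> real m * (real (count_wt TYPE('n) (d + e)) - real (count_wt TYPE('n) d))"
      using assms[of d] count_wt_mono[of d "d + e", where 'n = 'n] by (simp flip: of_nat_mult of_nat_diff)
    then show ?thesis using pos by (simp add: field_simps)
  qed
  then have "1 \<le> (0 :: real)" by (intro Lim_bounded2[OF lim]) auto
  then show False by simp
qed

section \<open>The rank over the subring generated by the forms\<close>

lemma sum_fun_apply: "(\<Sum>i\<in>I. f i) x = (\<Sum>i\<in>I. f i x)"
  for f :: "'i \<Rightarrow> 'a \<Rightarrow> 'b :: comm_monoid_add"
  by (induction I rule: infinite_finite_induct) auto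

text \<open>Independence is assumed for the indexed family, so that it also shows that no member
  occurs twice and the family can be counted by its indices.\<close>

lemma family_card_le:
  fixes g :: "'i \<Rightarrow> 'a \<Rightarrow> 'k :: field"
  assumes "finite K" "finite M" "\<And>k. k \<in> K \<Longrightarrow> g k \<in> fs.span (h ` M)"
    and ind: "\<And>c k. (\<And>x. (\<Sum>k\<in>K. c k * g k x) = 0) \<Longrightarrow> k \<in> K \<Longrightarrow> c k = 0"
  shows "card K \<le> card M" "inj_on g K" "fs.independent (g ` K)"
proof -
  show inj: "inj_on g K"
  proof (rule inj_onI, rule ccontr)
    fix k l assume kl: "k \<in> K" "l \<in> K" "g k = g l" "k \<noteq> l"
    have "(\<Sum>i\<in>K. ((if i = k then 1 else 0) - (if i = l then 1 else 0)) * g i x) = 0" for x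
      using kl assms(1) by (simp add: left_diff_distrib sum_subtractf if_distrib[of "\<lambda>u. u * _"] sum.delta cong: if_cong)
    from ind[OF this kl(1)] show False using kl by simp
  qed
  show indep: "fs.independent (g ` K)"
    unfolding fs.independent_explicit_finite_subsets
  proof (intro allI impI ballI)
    fix S u v assume S: "S \<subseteq> g ` K" "finite S" "(\<Sum>v\<in>S. (\<lambda>x. u v * v x)) = 0" "v \<in> S"
    define c where "c = (\<lambda>k. if g k \<in> S then u (g k) else 0)"
    have "(\<Sum>k\<in>K. c k * g k x) = 0" for x
    proof -
      have "(\<Sum>k\<in>K. c k * g k x) = (\<Sum>w\<in>g ` K. (if w \<in> S then u w else 0) * w x)"
        by (subst sum.reindex[OF inj]) (auto simp: c_def)
      also have "\<dots> = (\<Sum>w\<in>S. u w * w x)"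
        using S assms(1) by (intro sum.mono_neutral_cong_right) auto
      also have "\<dots> = 0" using fun_cong[OF S(3), of x] by (simp add: sum_fun_apply)
      finally show ?thesis .
    qed
    moreover obtain k where "k \<in> K" "v = g k" using S by blast
    ultimately show "u v = 0" using ind[of c k] S by (simp add: c_def)
  qed
  have "card K = card (g ` K)" using inj by (simp add: card_image)
  also have "\<dots> \<le> card (h ` M)"
    using fs.independent_span_bound[of "h ` M" "g ` K"] assms indep by auto
  also have "\<dots> \<le> card M" using assms(2) by (rule card_image_le)
  finally show "card K \<le> card M" .
qed

lemma pol_finite_bound:
  assumes "finite S" "\<And>s. s \<in> S \<Longrightarrow> f s \<in> polA UNIV"
  shows "\<exists>d. \<forall>s\<in>S. f s \<in> pol d"
  using assms
proof (induction S rule: finite_induct)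
  case (insert s S)
  then obtain d where d: "\<forall>s\<in>S. f s \<in> pol d" by auto
  obtain e where e: "f s \<in> pol e" using insert.prems[of s] polA_UNIV_iff[of "f s"] by auto
  have "\<forall>t\<in>insert s S. f t \<in> pol (max d e)" using d e by (auto intro: pol_mono[of d "max d e"] pol_mono[of e "max d e"])
  then show ?case by blast
qed auto

lemma polA_nonzero_prod:
  fixes f :: "'i \<Rightarrow> 'k :: alg_closed_field ^ 'n :: finite \<Rightarrow> 'k"
  assumes "finite S" "\<And>s. s \<in> S \<Longrightarrow> f s \<in> polA UNIV" "\<And>s. s \<in> S \<Longrightarrow> \<exists>y. f s y \<noteq> 0"
  shows "\<exists>y. (\<Prod>s\<in>S. f s y) \<noteq> 0"
  using assms
proof (induction S rule: finite_induct)
  case (insert s S)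
  then obtain y where y: "(\<Prod>s\<in>S. f s y) \<noteq> 0" by auto
  obtain z where z: "f s z \<noteq> 0" using insert.prems by auto
  obtain e where e: "f s \<in> pol e" using insert.prems(1)[of s] polA_UNIV_iff[of "f s"] by auto
  have "(\<lambda>x. \<Prod>s\<in>S. f s x) \<in> polA UNIV" using insert.prems by (intro polA_prod) auto
  then obtain d where "(\<lambda>x. \<Prod>s\<in>S. f s x) \<in> pol d" unfolding polA_UNIV_iff by blast
  from pol_nonzero_mult[OF this e y z] show ?case using insert by auto
qed auto

text \<open>  The coordinate map of an endomorphism of degree \<open>q\<close>. Below, \<open>R\<close> denotes the ring of
  the functions \<open>r \<circ> F\<close> with \<open>r\<close> polynomial; its elements are always given by such an \<open>r\<close>.\<close>

locale form_map =
  fixes F :: "'k :: alg_closed_field ^ 'n :: finite \<Rightarrow> 'k ^ 'n" and q :: nat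
  assumes F: "\<And>i. (\<lambda>x. F x $ i) \<in> form q" and q: "q \<ge> 1" and nz: "\<And>x. F x = 0 \<Longrightarrow> x = 0"
begin

lemma finite_generation: "\<exists>D0. \<forall>D. \<forall>f\<in>pol D. \<exists>r. (\<forall>\<beta>. r \<beta> \<in> pol (D div q)) \<and>
     (\<forall>x. f x = (\<Sum>\<beta> | wt \<beta> < D0. r \<beta> (F x) * pmon \<beta> x))"
  by (rule finite_over_subring[OF F q]) (rule nz)

text \<open>  If \<open>r \<circ> F = 0\<close>, then \<open>R\<close> is spanned by polynomials in the \<open>F\<^sub>i\<close> modulo multiples of \<open>r\<close>, and the
  dimension of these grows more slowly than that of all polynomials. But \<open>S\<close> is generated over \<open>R\<close>
  by finitely many monomials.\<close>

lemma alg_independent: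
  assumes r: "r \<in> polA UNIV" "r y \<noteq> 0"
  shows "\<exists>x. r (F x) \<noteq> 0"
proof (rule ccontr)
  assume "\<nexists>x. r (F x) \<noteq> 0"
  then have rF: "\<And>x. r (F x) = 0" by blast
  obtain e where e: "r \<in> pol e" using r polA_UNIV_iff by blast
  from finite_generation obtain D0 where D0': "\<forall>D. \<forall>f\<in>pol D. \<exists>r. (\<forall>\<beta>. r \<beta> \<in> pol (D div q)) \<and>
     (\<forall>x. f x = (\<Sum>\<beta> | wt \<beta> < D0. r \<beta> (F x) * pmon \<beta> x))" by (elim exE)
  note D0 = D0'[rule_format]
  define E where "E = {\<beta> :: 'n \<Rightarrow> nat. wt \<beta> < D0}"
  have E: "finite E" unfolding E_def by (rule finite_wt_less)
  have "count_wt TYPE('n) (d + e) \<le> card E * (count_wt TYPE('n) (d + e) - count_wt TYPE('n) d)" for d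
  proof -
    let ?K = "{\<beta> :: 'n \<Rightarrow> nat. wt \<beta> \<le> d}" and ?M = "{\<beta> :: 'n \<Rightarrow> nat. wt \<beta> \<le> d + e}"
    define g where "g = (\<lambda>\<beta> x. r x * pmon \<beta> x)"
    have g_pol: "g \<beta> \<in> pol (d + e)" if "\<beta> \<in> ?K" for \<beta>
      using that pol_mult[OF e form_imp_pol[OF pmon_form[of \<beta>]]]
      unfolding g_def by (auto elim!: pol_mono[rotated])
    have ind: "c \<beta> = 0" if c: "\<And>x. (\<Sum>\<beta>\<in>?K. c \<beta> * g \<beta> x) = 0" "\<beta> \<in> ?K" for c \<beta>
    proof (rule pmon_independent[OF finite_wt _ c(2)])
      fix x
      have "(\<lambda>x. \<Sum>\<alpha>\<in>?K. c \<alpha> * pmon \<alpha> x) \<in> pol d"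
        by (intro pol_sum pol_scale) (auto intro: pol_mono form_imp_pol pmon_form)
      moreover have "r x * (\<Sum>\<alpha>\<in>?K. c \<alpha> * pmon \<alpha> x) = 0" for x
        using c(1)[of x] by (simp add: g_def sum_distrib_left mult_ac)
      ultimately show "(\<Sum>\<alpha>\<in>?K. c \<alpha> * pmon \<alpha> x) = 0"
        using pol_mult_eq_0[OF e] r(2) by blast
    qed
    have g_span: "\<And>k. k \<in> ?K \<Longrightarrow> g k \<in> fs.span (pmon ` ?M)"
      using g_pol by (simp add: pol_def pspan_def)
    have fam2: "inj_on g ?K"
      by (rule family_card_le(2)[where M = ?M and h = pmon], rule finite_wt, rule finite_wt,
        rule g_span, assumption, rule ind)
    have fam3: "fs.independent (g ` ?K)"
      by (rule family_card_le(3)[where M = ?M and h = pmon], rule finite_wt, rule finite_wt,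
        rule g_span, assumption, rule ind)
    obtain Bs where Bs: "g ` ?K \<subseteq> Bs" "Bs \<subseteq> pol (d + e)" "fs.independent Bs" "pol (d + e) \<subseteq> fs.span Bs"
      by (rule fs.maximal_independent_subset_extend[OF _ fam3, where V = "pol (d + e)"]) (use g_pol in blast)
    have cBs: "finite Bs" "card Bs \<le> count_wt TYPE('n) (d + e)"
    proof -
      have "finite Bs \<and> card Bs \<le> card (pmon ` ?M :: ('k ^ 'n \<Rightarrow> 'k) set)"
        using Bs by (intro fs.independent_span_bound) (auto simp: finite_wt pol_def pspan_def)
      moreover have "card (pmon ` ?M :: ('k ^ 'n \<Rightarrow> 'k) set) \<le> count_wt TYPE('n) (d + e)"
        unfolding count_wt_def by (intro card_image_le finite_wt)
      ultimately show "finite Bs" "card Bs \<le> count_wt TYPE('n) (d + e)" by auto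
    qed
    \<comment> \<open>\<open>C\<close> completes the multiples of \<open>r\<close> to a basis of \<open>pol (d + e)\<close>; composition with \<open>F\<close> kills
      those multiples, so only \<open>C\<close> contributes to \<open>R\<close>\<close>
    define C where "C = Bs - g ` ?K"
    have "card C = card Bs - card (g ` ?K)" unfolding C_def using Bs cBs by (intro card_Diff_subset) (auto intro: finite_subset)
    also have "card (g ` ?K) = count_wt TYPE('n) d" using fam2 by (simp add: card_image count_wt_def)
    finally have cC: "card C \<le> count_wt TYPE('n) (d + e) - count_wt TYPE('n) d" using cBs by simp
    define h where "h = (\<lambda>(b, \<beta>) x. b (F x) * pmon \<beta> x :: 'k)"
    have inspan: "(\<lambda>x. t (F x) * pmon \<beta> x) \<in> fs.span (h ` (C \<times> E))" if t: "t \<in> fs.span Bs" and \<beta>: "\<beta> \<in> E" for t \<beta>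
      using t
    proof (induction rule: fs.span_induct_alt)
      case base
      show ?case using fs.span_zero[of "h ` (C \<times> E)"] by (simp add: zero_fun_def)
    next
      case (step c b t)
      have "(\<lambda>x. b (F x) * pmon \<beta> x) \<in> fs.span (h ` (C \<times> E))"
      proof (cases "b \<in> C")
        case True
        then have "h (b, \<beta>) \<in> fs.span (h ` (C \<times> E))" using \<beta> by (intro fs.span_base) auto
        then show ?thesis by (simp add: h_def)
      next
        case False
        then obtain \<gamma> where "b = g \<gamma>" using step(1) by (auto simp: C_def)
        then have "(\<lambda>x. b (F x) * pmon \<beta> x) = 0" by (simp add: g_def rF zero_fun_def)
        then show ?thesis using fs.span_zero by simp
      qed
      from fs.span_add[OF fs.span_scale[OF this, of c] step(2)] show ?case
        by (simp add: plus_fun_def algebra_simps)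
    qed
    have "card {\<alpha> :: 'n \<Rightarrow> nat. wt \<alpha> \<le> q * (d + e)} \<le> card (C \<times> E)"
    proof (rule family_card_le(1)[where g = "pmon :: _ \<Rightarrow> 'k ^ 'n \<Rightarrow> 'k" and h = h])
      fix \<alpha> :: "'n \<Rightarrow> nat" assume "\<alpha> \<in> {\<alpha>. wt \<alpha> \<le> q * (d + e)}"
      then have "(pmon \<alpha> :: 'k ^ 'n \<Rightarrow> 'k) \<in> pol (q * (d + e))" by (auto intro: pol_mono form_imp_pol pmon_form)
      from D0[OF this] obtain t where t: "\<And>\<beta>. t \<beta> \<in> pol (d + e)"
        "\<And>x. pmon \<alpha> x = (\<Sum>\<beta>\<in>E. t \<beta> (F x) * pmon \<beta> x)" using q unfolding E_def by auto
      have "(\<Sum>\<beta>\<in>E. (\<lambda>x. t \<beta> (F x) * pmon \<beta> x)) \<in> fs.span (h ` (C \<times> E))"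
        using Bs(4) t(1) by (intro fs.span_sum inspan) auto
      also have "(\<Sum>\<beta>\<in>E. (\<lambda>x. t \<beta> (F x) * pmon \<beta> x)) = pmon \<alpha>"
        by (auto simp: fun_eq_iff sum_fun_apply t(2))
      finally show "pmon \<alpha> \<in> fs.span (h ` (C \<times> E))" .
    next
      fix c and \<alpha> :: "'n \<Rightarrow> nat"
      assume "\<And>x. (\<Sum>\<alpha> | wt \<alpha> \<le> q * (d + e). c \<alpha> * pmon \<alpha> (x :: 'k ^ 'n)) = 0" "\<alpha> \<in> {\<alpha>. wt \<alpha> \<le> q * (d + e)}"
      then show "c \<alpha> = 0" using pmon_independent[OF finite_wt] by blast
    qed (use cBs E finite_wt in \<open>auto simp: C_def\<close>)
    also have "card (C \<times> E) = card E * card C" by (simp add: card_cartesian_product)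
    also have "\<dots> \<le> card E * (count_wt TYPE('n) (d + e) - count_wt TYPE('n) d)" using cC by simp
    finally have "count_wt TYPE('n) (q * (d + e)) \<le> card E * (count_wt TYPE('n) (d + e) - count_wt TYPE('n) d)"
      by (simp add: count_wt_def)
    moreover have "count_wt TYPE('n) (d + e) \<le> count_wt TYPE('n) (q * (d + e))" using q by (intro count_wt_mono) auto
    ultimately show ?thesis by linarith
  qed
  then show False by (rule count_defect)
qed

text \<open>Linear independence over \<open>R\<close> of the monomials with exponents in \<open>J\<close>. The coefficient
  \<open>r j \<circ> F\<close> may be replaced by \<open>r j\<close> in the conclusion by \<open>alg_independent\<close>.\<close>

definition R_independent :: "('n \<Rightarrow> nat) set \<Rightarrow> bool" where
  "R_independent J \<longleftrightarrow> (\<forall>r. (\<forall>j\<in>J. r j \<in> polA UNIV) \<and> (\<forall>x. (\<Sum>j\<in>J. r j (F x) * pmon j x) = 0) \<longrightarrow>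
     (\<forall>j\<in>J. \<forall>y. r j y = 0))"

text \<open>Products of the monomials in \<open>J\<close> with the monomials of degree at most \<open>d\<close> in the \<open>F\<^sub>i\<close> are
  linearly independent polynomials of degree at most \<open>q d + c\<close>.\<close>

lemma R_independent_card:
  assumes J: "finite J" "R_independent J"
  shows "card J \<le> q ^ CARD('n)"
proof -
  define c where "c = Max (insert 0 (wt ` J))"
  have c: "wt j \<le> c" if "j \<in> J" for j using that J by (auto simp: c_def)
  have "card J * count_wt TYPE('n) d \<le> count_wt TYPE('n) (q * d + c)" for d
  proof -
    let ?K = "J \<times> {\<beta> :: 'n \<Rightarrow> nat. wt \<beta> \<le> d}"
    have "card ?K \<le> card {\<alpha> :: 'n \<Rightarrow> nat. wt \<alpha> \<le> q * d + c}"
    proof (rule family_card_le(1)[where g = "\<lambda>k x. pmon (snd k) (F x) * pmon (fst k) x :: 'k" and h = pmon])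
      fix k assume "k \<in> ?K"
      then obtain j \<beta> where k: "k = (j, \<beta>)" "j \<in> J" "wt \<beta> \<le> d" by auto
      have "(\<lambda>x. pmon \<beta> (F x) * pmon j x) \<in> form (q * wt \<beta> + wt j)"
        by (intro form_mult form_comp[OF pmon_form F] pmon_form)
      moreover have "q * wt \<beta> + wt j \<le> q * d + c" using k c[of j] by (intro add_mono mult_left_mono) auto
      ultimately have "(\<lambda>x. pmon \<beta> (F x) * pmon j x) \<in> pol (q * d + c)"
        using pol_mono form_imp_pol by blast
      then show "(\<lambda>x. pmon (snd k) (F x) * pmon (fst k) x) \<in> fs.span (pmon ` {\<alpha>. wt \<alpha> \<le> q * d + c})"
        by (simp add: k pol_def pspan_def)
    next
      fix u k assume u: "\<And>x. (\<Sum>k\<in>?K. u k * (pmon (snd k) (F x) * pmon (fst k) x)) = 0" and k: "k \<in> ?K"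
      define r where "r = (\<lambda>j y. \<Sum>\<beta> | wt \<beta> \<le> d. u (j, \<beta>) * pmon \<beta> y)"
      have "r j \<in> polA UNIV" for j
        unfolding r_def by (intro polA_sum polA_scale) (auto simp: polA_def intro: pspan_pmon)
      moreover have "(\<Sum>j\<in>J. r j (F x) * pmon j x) = 0" for x
        using u[of x] by (simp add: r_def sum.cartesian_product' sum_distrib_right mult.assoc)
      ultimately have "\<forall>j\<in>J. \<forall>y. r j y = 0" using J(2) unfolding R_independent_def by blast
      then have r0: "r (fst k) y = 0" for y using k by auto
      have "u (fst k, snd k) = 0"
        by (rule pmon_independent[where M = "{\<beta>. wt \<beta> \<le> d}" and c = "\<lambda>\<beta>. u (fst k, \<beta>)"])
          (use r0 k in \<open>auto simp: r_def finite_wt\<close>)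
      then show "u k = 0" by simp
    qed (use J finite_wt in auto)
    then show ?thesis by (simp add: card_cartesian_product count_wt_def)
  qed
  then show ?thesis by (rule count_upper)
qed

text \<open>  The rank of \<open>S\<close> over \<open>R\<close> is \<open>q\<close> to the number of variables. A maximal \<open>R\<close>-independent set \<open>J\<close> of
  the generating monomials becomes a basis once a common denominator \<open>B\<close> of the expansions of the
  other generators is inverted. Multiplication by \<open>B \<circ> F\<close> embeds \<open>S\<close> into the free module on
  \<open>J\<close>, and comparing dimensions bounds \<open>card J\<close> from below. Only this localisation has to be free; the
  passage back to \<open>R\<close> is left to Gauss's lemma.\<close>

theorem exists_rank_basis:
  obtains J B where "finite J" "card J = q ^ CARD('n)" "R_independent J" "B \<in> polA UNIV" "\<exists>y. B y \<noteq> 0"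
    "\<And>f. f \<in> polA UNIV \<Longrightarrow> \<exists>r. (\<forall>j. r j \<in> polA UNIV) \<and> (\<forall>x. B (F x) * f x = (\<Sum>j\<in>J. r j (F x) * pmon j x))"
proof -
  from finite_generation obtain D0 where D0': "\<forall>D. \<forall>f\<in>pol D. \<exists>r. (\<forall>\<beta>. r \<beta> \<in> pol (D div q)) \<and>
     (\<forall>x. f x = (\<Sum>\<beta> | wt \<beta> < D0. r \<beta> (F x) * pmon \<beta> x))" by (elim exE)
  note D0 = D0'[rule_format]
  define E where "E = {\<beta> :: 'n \<Rightarrow> nat. wt \<beta> < D0}"
  have E: "finite E" unfolding E_def by (rule finite_wt_less)
  define Js where "Js = {J. J \<subseteq> E \<and> R_independent J}"
  have "finite Js" using E by (simp add: Js_def)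
  moreover have "{} \<in> Js" by (simp add: Js_def R_independent_def)
  then have "Js \<noteq> {}" by blast
  ultimately have "\<exists>J\<in>Js. \<forall>J'\<in>Js. J \<le> J' \<longrightarrow> J = J'" by (rule finite_has_maximal)
  then obtain J where JJs: "J \<in> Js" and JJmax: "\<forall>J'\<in>Js. J \<le> J' \<longrightarrow> J = J'" by (elim bexE)
  have J: "J \<subseteq> E" "R_independent J" using JJs by (simp_all add: Js_def)
  have Jmax: "J' = J" if "J' \<subseteq> E" "R_independent J'" "J \<subseteq> J'" for J'
    using JJmax that by (auto simp: Js_def)
  have finJ: "finite J" using J(1) E finite_subset by blast
  have "\<forall>\<beta>\<in>E. \<exists>t\<rho>. fst t\<rho> \<in> polA UNIV \<and> (\<exists>y. fst t\<rho> y \<noteq> 0) \<and> (\<forall>j. snd t\<rho> j \<in> polA UNIV) \<and>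
     (\<forall>x. fst t\<rho> (F x) * pmon \<beta> x = (\<Sum>j\<in>J. snd t\<rho> j (F x) * pmon j x))"
  proof
    fix \<beta> assume \<beta>: "\<beta> \<in> E"
    have "\<exists>t \<rho>. t \<in> polA UNIV \<and> (\<exists>y. t y \<noteq> 0) \<and> (\<forall>j. \<rho> j \<in> polA UNIV) \<and>
     (\<forall>x. t (F x) * pmon \<beta> x = (\<Sum>j\<in>J. \<rho> j (F x) * pmon j x))"
    proof (cases "\<beta> \<in> J")
      case True
      then show ?thesis using finJ
        by (intro exI[of _ "\<lambda>_. 1"] exI[of _ "\<lambda>j y. if j = \<beta> then 1 else 0"])
          (auto simp: polA_const if_distrib[of "\<lambda>u. u * _"] sum.delta cong: if_cong)
    next
      case False
      then have "\<not> R_independent (insert \<beta> J)" using Jmax[of "insert \<beta> J"] \<beta> J(1) by blast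
      then obtain r where r: "\<And>j. j \<in> insert \<beta> J \<Longrightarrow> r j \<in> polA UNIV"
         "\<And>x. (\<Sum>j\<in>insert \<beta> J. r j (F x) * pmon j x) = 0" "\<exists>j\<in>insert \<beta> J. \<exists>y. r j y \<noteq> 0"
        unfolding R_independent_def by blast
      have rel: "r \<beta> (F x) * pmon \<beta> x = (\<Sum>j\<in>J. - r j (F x) * pmon j x)" for x
        using r(2)[of x] False finJ by (simp add: sum_negf eq_neg_iff_add_eq_0)
      have "\<exists>y. r \<beta> y \<noteq> 0"
      proof (rule ccontr)
        assume "\<nexists>y. r \<beta> y \<noteq> 0"
        then have 0: "r \<beta> y = 0" for y by blast
        have "(\<Sum>j\<in>J. r j (F x) * pmon j x) = 0" for x using rel[of x] 0 by (simp add: sum_negf)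
        then have "\<forall>j\<in>J. \<forall>y. r j y = 0" using J(2) r(1) unfolding R_independent_def by blast
        then show False using 0 r(3) by blast
      qed
      moreover have "(\<lambda>y. if j \<in> J then - r j y else 0) \<in> polA UNIV" for j
        using r(1) by (cases "j \<in> J") (auto intro: polA_uminus polA_zero)
      moreover have "r \<beta> (F x) * pmon \<beta> x = (\<Sum>j\<in>J. (if j \<in> J then - r j (F x) else 0) * pmon j x)" for x
        unfolding rel by (rule sum.cong) auto
      ultimately show ?thesis using r(1)[of \<beta>]
        by (intro exI[of _ "r \<beta>"] exI[of _ "\<lambda>j y. if j \<in> J then - r j y else 0"]) auto
    qed
    then show "\<exists>t\<rho>. fst t\<rho> \<in> polA UNIV \<and> (\<exists>y. fst t\<rho> y \<noteq> 0) \<and> (\<forall>j. snd t\<rho> j \<in> polA UNIV) \<and>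
     (\<forall>x. fst t\<rho> (F x) * pmon \<beta> x = (\<Sum>j\<in>J. snd t\<rho> j (F x) * pmon j x))" by simp
  qed
  from bchoice[OF this] obtain t\<rho> where t\<rho>: "\<forall>\<beta>\<in>E. fst (t\<rho> \<beta>) \<in> polA UNIV \<and> (\<exists>y. fst (t\<rho> \<beta>) y \<noteq> 0) \<and> (\<forall>j. snd (t\<rho> \<beta>) j \<in> polA UNIV) \<and>
     (\<forall>x. fst (t\<rho> \<beta>) (F x) * pmon \<beta> x = (\<Sum>j\<in>J. snd (t\<rho> \<beta>) j (F x) * pmon j x))" by blast
  define t \<rho> where "t = (\<lambda>\<beta>. fst (t\<rho> \<beta>))" and "\<rho> = (\<lambda>\<beta>. snd (t\<rho> \<beta>))"
  have t: "\<And>\<beta>. \<beta> \<in> E \<Longrightarrow> t \<beta> \<in> polA UNIV" "\<And>\<beta>. \<beta> \<in> E \<Longrightarrow> \<exists>y. t \<beta> y \<noteq> 0"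
    and \<rho>: "\<And>\<beta> j. \<beta> \<in> E \<Longrightarrow> \<rho> \<beta> j \<in> polA UNIV"
    and t\<rho>': "\<And>\<beta> x. \<beta> \<in> E \<Longrightarrow> t \<beta> (F x) * pmon \<beta> x = (\<Sum>j\<in>J. \<rho> \<beta> j (F x) * pmon j x)"
    using t\<rho> unfolding t_def \<rho>_def by auto
  define B where "B = (\<lambda>y. \<Prod>\<beta>\<in>E. t \<beta> y)"
  have B: "B \<in> polA UNIV" unfolding B_def by (intro polA_prod t)
  have Bnz: "\<exists>y. B y \<noteq> 0" unfolding B_def using E t by (intro polA_nonzero_prod) auto
  define Q where "Q = (\<lambda>\<beta> j y. (\<Prod>\<gamma>\<in>E-{\<beta>}. t \<gamma> y) * \<rho> \<beta> j y)"
  have Q: "Q \<beta> j \<in> polA UNIV" if "\<beta> \<in> E" for \<beta> j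
    unfolding Q_def using that by (intro polA_mult polA_prod t \<rho>) auto
  have BQ: "B (F x) * pmon \<beta> x = (\<Sum>j\<in>J. Q \<beta> j (F x) * pmon j x)" if "\<beta> \<in> E" for \<beta> x
  proof -
    have "B (F x) = (\<Prod>\<gamma>\<in>E-{\<beta>}. t \<gamma> (F x)) * t \<beta> (F x)"
      unfolding B_def using prod.remove[OF E that, of "\<lambda>\<beta>. t \<beta> (F x)"] by (simp add: mult.commute)
    then show ?thesis using t\<rho>'[OF that, of x] by (simp add: Q_def sum_distrib_left mult.assoc)
  qed
  obtain c where c: "\<forall>s\<in>E \<times> J. (\<lambda>(\<beta>, j). Q \<beta> j) s \<in> pol c"
    using pol_finite_bound[of "E \<times> J" "\<lambda>(\<beta>, j). Q \<beta> j"] E finJ Q by auto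
  have gen: "\<exists>r. (\<forall>j\<in>J. r j \<in> pol (D div q + c)) \<and> (\<forall>j. r j \<in> polA UNIV) \<and> (\<forall>x. B (F x) * f x = (\<Sum>j\<in>J. r j (F x) * pmon j x))"
    if f: "f \<in> pol D" for f D
  proof -
    obtain r where r: "\<And>\<beta>. r \<beta> \<in> pol (D div q)" "\<And>x. f x = (\<Sum>\<beta>\<in>E. r \<beta> (F x) * pmon \<beta> x)"
      using D0[OF f] unfolding E_def by blast
    define r' where "r' = (\<lambda>j y. \<Sum>\<beta>\<in>E. r \<beta> y * Q \<beta> j y)"
    have rA: "r \<beta> \<in> polA UNIV" for \<beta> using r(1) polA_UNIV_iff by blast
    have "r' j \<in> pol (D div q + c)" if "j \<in> J" for j
      unfolding r'_def using c that by (intro pol_sum pol_mult r) auto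
    moreover have "r' j \<in> polA UNIV" for j
      unfolding r'_def by (intro polA_sum polA_mult rA Q)
    moreover have "B (F x) * f x = (\<Sum>j\<in>J. r' j (F x) * pmon j x)" for x
    proof -
      have "B (F x) * f x = (\<Sum>\<beta>\<in>E. r \<beta> (F x) * (B (F x) * pmon \<beta> x))"
        by (simp add: r(2) sum_distrib_left mult_ac)
      also have "\<dots> = (\<Sum>\<beta>\<in>E. \<Sum>j\<in>J. r \<beta> (F x) * Q \<beta> j (F x) * pmon j x)"
        by (rule sum.cong) (auto simp: BQ sum_distrib_left mult.assoc)
      also have "\<dots> = (\<Sum>j\<in>J. r' j (F x) * pmon j x)"
        unfolding r'_def sum_distrib_right by (rule sum.swap)
      finally show ?thesis .
    qed
    ultimately show ?thesis by blast
  qed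
  obtain e where e: "B \<in> pol e" using B polA_UNIV_iff by blast
  have BF: "(\<lambda>x. B (F x)) \<in> pol (q * e)" using pol_comp[OF e form_imp_pol[OF F]] .
  obtain x0 where x0: "B (F x0) \<noteq> 0" using alg_independent[OF B] Bnz by blast
  have "count_wt TYPE('n) (q * d) \<le> card J * count_wt TYPE('n) (d + c)" for d
  proof -
    define h where "h = (\<lambda>(j, \<beta>) x. pmon \<beta> (F x) * pmon j x :: 'k)"
    let ?M = "J \<times> {\<beta> :: 'n \<Rightarrow> nat. wt \<beta> \<le> d + c}"
    have "card {\<alpha> :: 'n \<Rightarrow> nat. wt \<alpha> \<le> q * d} \<le> card ?M"
    proof (rule family_card_le(1)[where g = "\<lambda>\<alpha> x. B (F x) * pmon \<alpha> x :: 'k" and h = h])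
      fix \<alpha> :: "'n \<Rightarrow> nat" assume "\<alpha> \<in> {\<alpha>. wt \<alpha> \<le> q * d}"
      then have "(pmon \<alpha> :: 'k ^ 'n \<Rightarrow> 'k) \<in> pol (q * d)" by (auto intro: pol_mono form_imp_pol pmon_form)
      from gen[OF this] obtain r where r: "\<And>j. j \<in> J \<Longrightarrow> r j \<in> pol (d + c)"
        "\<And>x. B (F x) * pmon \<alpha> x = (\<Sum>j\<in>J. r j (F x) * pmon j x)" using q by auto
      have "(\<lambda>x. t (F x) * pmon j x) \<in> fs.span (h ` ?M)" if "t \<in> pol (d + c)" "j \<in> J" for t j
        using that(1) unfolding pol_def
      proof (induction rule: pspan_induct)
        case zero
        show ?case using fs.span_zero[of "h ` ?M"] by (simp add: zero_fun_def)
      next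
        case (add c \<beta> t)
        have "h (j, \<beta>) \<in> fs.span (h ` ?M)" using add \<open>j \<in> J\<close> by (intro fs.span_base) auto
        from fs.span_add[OF fs.span_scale[OF this, of c] add(2)] show ?case
          by (simp add: h_def plus_fun_def algebra_simps)
      qed
      then have "(\<Sum>j\<in>J. (\<lambda>x. r j (F x) * pmon j x)) \<in> fs.span (h ` ?M)"
        using r(1) by (intro fs.span_sum) auto
      also have "(\<Sum>j\<in>J. (\<lambda>x. r j (F x) * pmon j x)) = (\<lambda>x. B (F x) * pmon \<alpha> x)"
        by (auto simp: fun_eq_iff sum_fun_apply r(2))
      finally show "(\<lambda>x. B (F x) * pmon \<alpha> x) \<in> fs.span (h ` ?M)" .
    next
      fix u and \<alpha> :: "'n \<Rightarrow> nat"
      assume u: "\<And>x. (\<Sum>\<alpha> | wt \<alpha> \<le> q * d. u \<alpha> * (B (F x) * pmon \<alpha> x)) = 0" and \<alpha>: "\<alpha> \<in> {\<alpha>. wt \<alpha> \<le> q * d}"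
      show "u \<alpha> = 0"
      proof (rule pmon_independent[OF finite_wt _ \<alpha>])
        fix x
        have "(\<lambda>x. \<Sum>\<alpha> | wt \<alpha> \<le> q * d. u \<alpha> * pmon \<alpha> x) \<in> pol (q * d)"
          by (intro pol_sum pol_scale) (auto intro: pol_mono form_imp_pol pmon_form)
        moreover have "B (F x) * (\<Sum>\<alpha> | wt \<alpha> \<le> q * d. u \<alpha> * pmon \<alpha> x) = 0" for x
          using u[of x] by (simp add: sum_distrib_left mult_ac)
        ultimately show "(\<Sum>\<alpha> | wt \<alpha> \<le> q * d. u \<alpha> * pmon \<alpha> x) = 0"
          using pol_mult_eq_0[OF BF] x0 by blast
      qed
    qed (use finJ finite_wt in auto)
    then show ?thesis by (simp add: card_cartesian_product count_wt_def)
  qed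
  then have "q ^ CARD('n) \<le> card J" by (rule count_lower)
  moreover have "card J \<le> q ^ CARD('n)" using R_independent_card[OF finJ J(2)] .
  ultimately have "card J = q ^ CARD('n)" by simp
  then show ?thesis
    by (rule that[OF finJ _ J(2) B Bnz]) (use gen polA_UNIV_iff in blast)
qed

end

section \<open>Divisibility of polynomial functions along lines\<close>

lemma polA_translate: "f \<in> polA UNIV \<Longrightarrow> (\<lambda>x. f (y + x)) \<in> polA UNIV"
  by (rule polA_comp[where A = UNIV], assumption, unfold vector_add_component)
    (intro polA_add polA_const polA_coord, simp)

lemma polA_line:
  fixes f :: "'k :: field ^ 'n :: finite \<Rightarrow> 'k"
  assumes "f \<in> polA UNIV" shows "\<exists>P. \<forall>s. f (y + s *s z) = poly P s"
proof -
  obtain d where "f \<in> pol d" using assms polA_UNIV_iff by blast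
  from pol_line[OF this, of y z] show ?thesis by blast
qed

lemma hpart_polA: "f \<in> polA UNIV \<Longrightarrow> hpart i f \<in> polA UNIV"
  using hpart_form form_imp_pol polA_UNIV_iff by blast

text \<open>  Divisibility of \<open>A\<close> by \<open>B\<close> can be tested on the lines through a point \<open>y0\<close> where \<open>B\<close> does not vanish.
  The coefficients of the quotient along the direction \<open>z\<close> are found recursively, dividing
  only by the constant \<open>B y0\<close>, hence they are polynomial in \<open>z\<close>; the quotient at \<open>y0 + z\<close> is their
  sum.\<close>

lemma pol_div:
  fixes A B :: "'k :: alg_closed_field ^ 'n :: finite \<Rightarrow> 'k"
  assumes A: "A \<in> polA UNIV" and B: "B \<in> polA UNIV" and nz: "B y0 \<noteq> 0"
    and dv: "\<And>z. \<exists>P. \<forall>s. A (y0 + s *s z) = B (y0 + s *s z) * poly P s"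
  shows "\<exists>C\<in>polA UNIV. \<forall>x. A x = B x * C x"
proof -
  define a b where "a = (\<lambda>x. A (y0 + x))" and "b = (\<lambda>x. B (y0 + x))"
  have aA: "a \<in> polA UNIV" and bA: "b \<in> polA UNIV"
    unfolding a_def b_def by (rule polA_translate, fact)+
  obtain d where d: "a \<in> pol d" using aA polA_UNIV_iff by blast
  obtain e where e: "b \<in> pol e" using bA polA_UNIV_iff by blast
  have "\<forall>z. \<exists>P. ray a z = ray b z * P"
  proof
    fix z
    obtain P where P: "\<forall>s. A (y0 + s *s z) = B (y0 + s *s z) * poly P s" using dv by blast
    have "ray a z = ray b z * P"
      by (rule poly_eqI_alg_closed, unfold poly_mult poly_ray[OF d] poly_ray[OF e])
        (simp add: a_def b_def P)
    then show "\<exists>P. ray a z = ray b z * P" by blast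
  qed
  from choice[OF this] obtain P where P: "\<And>z. ray a z = ray b z * P z" by blast
  have b0: "coeff (ray b z) 0 = B y0" for z
    using poly_ray[OF e, of z 0] by (simp add: poly_0_coeff_0 b_def)
  have coefP: "(\<lambda>z. coeff (P z) j) \<in> polA UNIV" for j
  proof (induction j rule: less_induct)
    case (less j)
    have "coeff (P z) j = inverse (B y0) * (hpart j a z - (\<Sum>i<j. hpart (j - i) b z * coeff (P z) i))" for z
    proof -
      have "hpart j a z = (\<Sum>i\<le>j. coeff (P z) i * coeff (ray b z) (j - i))"
        unfolding hpart_def P mult.commute[of "ray b z"] by (rule coeff_mult)
      also have "\<dots> = (\<Sum>i<j. hpart (j - i) b z * coeff (P z) i) + B y0 * coeff (P z) j"
        by (simp add: lessThan_Suc_atMost[symmetric] b0 hpart_def mult.commute)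
      finally show ?thesis using nz by (simp add: field_simps)
    qed
    moreover have "(\<lambda>z. inverse (B y0) * (hpart j a z - (\<Sum>i<j. hpart (j - i) b z * coeff (P z) i))) \<in> polA UNIV"
      using less by (intro polA_scale polA_diff polA_sum polA_mult hpart_polA aA bA) auto
    ultimately show ?case by simp
  qed
  have degP: "degree (P z) \<le> d" for z
  proof (cases "P z = 0")
    case False
    have "ray b z \<noteq> 0" using b0[of z] nz by auto
    then have "degree (P z) \<le> degree (ray a z)" using False by (simp add: P degree_mult_eq)
    also have "\<dots> \<le> d"
      using hpart_above[OF d] by (intro degree_le) (auto simp: hpart_def fun_eq_iff)
    finally show ?thesis .
  qed auto
  define C where "C = (\<lambda>x. \<Sum>j\<le>d. coeff (P (- y0 + x)) j)"
  have "(\<lambda>z. \<Sum>j\<le>d. coeff (P z) j) \<in> polA UNIV" by (intro polA_sum coefP)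
  then have "C \<in> polA UNIV" unfolding C_def by (rule polA_translate)
  moreover have "A x = B x * C x" for x
  proof -
    have "poly (P z) 1 = (\<Sum>j\<le>d. coeff (P z) j)" for z
      unfolding poly_altdef using degP[of z]
      by (intro sum.mono_neutral_cong_left) (auto simp: coeff_eq_0 not_le)
    then have "poly (ray a (- y0 + x)) 1 = poly (ray b (- y0 + x)) 1 * C x"
      by (simp add: P C_def)
    then show ?thesis unfolding poly_ray[OF d] poly_ray[OF e] by (simp add: a_def b_def)
  qed
  ultimately show ?thesis by blast
qed

section \<open>Bivariate polynomials\<close>

text \<open>Elements of \<open>k[s][T]\<close>, where \<open>s\<close> is the parameter of a line, are specialised to a value of
  the parameter.\<close>

definition ev :: "'k :: comm_ring_1 \<Rightarrow> 'k poly poly \<Rightarrow> 'k poly" where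
  "ev s = map_poly (\<lambda>p. poly p s)"

lemma coeff_ev [simp]: "coeff (ev s P) i = poly (coeff P i) s"
  by (simp add: ev_def coeff_map_poly)

lemma ev_mult: "ev s (P * Q) = ev s P * ev s Q"
  by (rule poly_eqI) (simp add: coeff_mult poly_sum)

lemma ev_add: "ev s (P + Q) = ev s P + ev s Q"
  by (rule poly_eqI) simp

lemma ev_smult: "ev s (Polynomial.smult b P) = Polynomial.smult (poly b s) (ev s P)"
  by (rule poly_eqI) simp

lemma ev_0 [simp]: "ev s 0 = 0" and ev_1 [simp]: "ev s 1 = 1"
  by (auto intro!: poly_eqI simp: coeff_1)

lemma ev_pCons: "ev s (pCons a P) = pCons (poly a s) (ev s P)"
  by (rule poly_eqI) (simp add: coeff_pCons split: nat.split)

lemma ev_power: "ev s (P ^ n) = ev s P ^ n"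
  by (induction n) (simp_all add: ev_mult)

lemma ev_pcompose: "ev s (pcompose P Q) = pcompose (ev s P) (ev s Q)"
  by (induction P) (simp_all add: pcompose_pCons ev_add ev_mult ev_pCons)

lemma degree_ev_le: "degree (ev s P) \<le> degree P"
  by (rule degree_le) (simp add: coeff_eq_0)

lemma ev_eq_0_imp_smult:
  fixes P :: "'k :: alg_closed_field poly poly"
  assumes "ev c P = 0"
  shows "\<exists>P1. P = Polynomial.smult [:-c, 1:] P1"
proof -
  have dv: "[:-c, 1:] dvd coeff P n" for n
  proof -
    have "poly (coeff P n) c = 0" using assms coeff_ev[of c P n] by simp
    then show ?thesis using poly_eq_0_iff_dvd by blast
  qed
  have "P = Polynomial.smult [:-c, 1:] (map_poly (\<lambda>p. p div [:-c, 1:]) P)"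
    by (rule poly_eqI) (simp only: coeff_smult coeff_map_poly div_0 dvd_mult_div_cancel[OF dv])
  then show ?thesis by blast
qed

text \<open>Gauss's lemma: the leading coefficient of a divisor of a monic polynomial can be cleared. At
  a root \<open>c\<close> of \<open>b\<close> one of \<open>P\<close> and \<open>Q\<close> specialises to zero, so the factor \<open>s - c\<close> cancels.\<close>

lemma gauss_monic:
  fixes P Q M :: "'k :: alg_closed_field poly poly"
  assumes "P * Q = Polynomial.smult b M" "lead_coeff M = 1" "b \<noteq> 0"
  shows "\<exists>P'. P = Polynomial.smult (lead_coeff P) P'"
  using assms
proof (induction "degree b" arbitrary: b P Q rule: less_induct)
  case less
  show ?case
  proof (cases "degree b = 0")
    case True
    then obtain u where u: "b = [:u:]" using degree_eq_zeroE by blast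
    have "u \<noteq> 0" using less.prems(3) u by auto
    have "lead_coeff P * lead_coeff Q = [:u:]"
      using arg_cong[OF less.prems(1), of lead_coeff] less.prems(2) by (simp add: lead_coeff_mult u)
    then have "lead_coeff P * Polynomial.smult (inverse u) (lead_coeff Q) = 1"
      using \<open>u \<noteq> 0\<close> by (simp add: one_pCons)
    then show ?thesis
      by (intro exI[of _ "Polynomial.smult (Polynomial.smult (inverse u) (lead_coeff Q)) P"])
        (simp only: smult_smult smult_1_left)
  next
    case False
    then obtain c where c: "poly b c = 0" using alg_closed_imp_poly_has_root by blast
    then have "[:-c, 1:] dvd b" using poly_eq_0_iff_dvd by blast
    then obtain b1 where b1: "b = [:-c, 1:] * b1" by (rule dvdE)
    have b1nz: "b1 \<noteq> 0" using less.prems(3) b1 by auto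
    have deg: "degree b1 < degree b" using b1nz unfolding b1 by (subst degree_mult_eq) auto
    have "ev c P * ev c Q = 0"
      using arg_cong[OF less.prems(1), of "ev c"] c by (simp add: ev_mult ev_smult)
    then consider "ev c P = 0" | "ev c Q = 0" by auto
    then show ?thesis
    proof cases
      case 1
      then obtain P1 where P1: "P = Polynomial.smult [:-c, 1:] P1" using ev_eq_0_imp_smult by blast
      have "Polynomial.smult [:-c, 1:] (P1 * Q) = Polynomial.smult [:-c, 1:] (Polynomial.smult b1 M)"
        using less.prems(1) by (simp add: P1 b1)
      then have "P1 * Q = Polynomial.smult b1 M" by (rule smult_cancel[rotated]) simp
      from less.hyps[OF deg this less.prems(2) b1nz] obtain P' where "P1 = Polynomial.smult (lead_coeff P1) P'" by blast
      then have "P = Polynomial.smult (lead_coeff P) P'" unfolding P1 lead_coeff_smult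
        by (metis smult_smult)
      then show ?thesis by blast
    next
      case 2
      then obtain Q1 where Q1: "Q = Polynomial.smult [:-c, 1:] Q1" using ev_eq_0_imp_smult by blast
      have "Polynomial.smult [:-c, 1:] (P * Q1) = Polynomial.smult [:-c, 1:] (Polynomial.smult b1 M)"
        using less.prems(1) by (simp add: Q1 b1)
      then have "P * Q1 = Polynomial.smult b1 M" by (rule smult_cancel[rotated]) simp
      from less.hyps[OF deg this less.prems(2) b1nz] show ?thesis .
    qed
  qed
qed

text \<open>Divide with remainder after multiplying by a power of the leading coefficient: the remainder
  specialises to zero at infinitely many parameters.\<close>

lemma pointwise_dvd_imp:
  fixes P G :: "'k :: alg_closed_field poly poly"
  assumes S: "infinite S" and P: "P \<noteq> 0" and nz: "\<And>s. s \<in> S \<Longrightarrow> poly (lead_coeff P) s \<noteq> 0"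
    and dv: "\<And>s. s \<in> S \<Longrightarrow> ev s P dvd ev s G"
  shows "\<exists>Q k. P * Q = Polynomial.smult (lead_coeff P ^ k) G"
proof -
  obtain Q R where QR: "pseudo_divmod G P = (Q, R)" by force
  define k where "k = Suc (degree G) - degree P"
  have eq: "Polynomial.smult (lead_coeff P ^ k) G = P * Q + R" and deg: "R = 0 \<or> degree R < degree P"
    using pseudo_divmod[OF P QR] by (auto simp: k_def)
  have "ev s R = 0" if "s \<in> S" for s
  proof (rule ccontr)
    assume nz': "ev s R \<noteq> 0"
    have "ev s R = Polynomial.smult (poly (lead_coeff P ^ k) s) (ev s G) - ev s P * ev s Q"
      using arg_cong[OF eq, of "ev s"] by (simp add: ev_add ev_mult ev_smult)
    then have "ev s P dvd ev s R" using dv[OF that] by (simp add: dvd_smult)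
    then have "degree (ev s P) \<le> degree (ev s R)" using nz' by (rule dvd_imp_degree_le)
    moreover have "degree P \<le> degree (ev s P)" using nz[OF that] by (intro le_degree) simp
    moreover have "degree (ev s R) \<le> degree R" by (rule degree_ev_le)
    moreover have "R \<noteq> 0" using nz' by auto
    ultimately show False using deg by linarith
  qed
  then have "poly (coeff R i) s = poly 0 s" if "s \<in> S" for s i
    using that coeff_ev[of s R i] by simp
  then have "coeff R i = 0" for i using poly_eq_if_eq_infinite[OF S] by blast
  then have "R = 0" by (intro poly_eqI) simp
  then show ?thesis using eq by (intro exI[of _ Q] exI[of _ k]) simp
qed

lemma roots_imp_dvd_power:
  fixes p g :: "'k :: alg_closed_field poly"
  assumes "p \<noteq> 0" "\<And>t. poly p t = 0 \<Longrightarrow> poly g t = 0"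
  shows "p dvd g ^ degree p"
proof -
  obtain A where A: "size A = degree p" "p = Polynomial.smult (lead_coeff p) (\<Prod>x\<in>#A. [:-x, 1:])"
    using alg_closed_imp_factorization[OF assms(1)] by blast
  have root: "[:-x, 1:] dvd g" if "x \<in># A" for x
  proof -
    have "poly p x = 0"
      by (subst A(2)) (use that in \<open>auto simp: poly_prod_mset prod_mset_zero_iff image_iff\<close>)
    then show ?thesis using assms(2) poly_eq_0_iff_dvd by blast
  qed
  have "(\<Prod>x\<in>#A. [:-x, 1:]) dvd g ^ size A"
    using root
  proof (induction A)
    case (add x A)
    then have "[:-x, 1:] * (\<Prod>x\<in>#A. [:-x, 1:]) dvd g * g ^ size A" by (intro mult_dvd_mono) auto
    then show ?case by (simp only: image_mset_add_mset prod_mset.add_mset size_add_mset power_Suc)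
  qed simp
  then have "Polynomial.smult (lead_coeff p) (\<Prod>x\<in>#A. [:-x, 1:]) dvd g ^ size A"
    by (rule smult_dvd) (use assms(1) in simp)
  then show ?thesis by (simp only: A(1) A(2)[symmetric])
qed

lemma monic_dvd_linear_power:
  fixes p :: "'k :: alg_closed_field poly"
  assumes "p dvd [:-h, 1:] ^ n" "lead_coeff p = 1"
  shows "p = [:-h, 1:] ^ degree p"
proof -
  have "p \<noteq> 0" using assms(2) by auto
  then obtain A where A: "size A = degree p" "p = Polynomial.smult (lead_coeff p) (\<Prod>x\<in>#A. [:-x, 1:])"
    using alg_closed_imp_factorization by blast
  have "x = h" if "x \<in># A" for x
  proof -
    have "poly p x = 0"
      by (subst A(2)) (use that in \<open>auto simp: poly_prod_mset prod_mset_zero_iff image_iff\<close>)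
    moreover obtain k where k: "[:-h, 1:] ^ n = p * k" using assms(1) by (rule dvdE)
    ultimately have "poly ([:-h, 1:] ^ n) x = 0" unfolding k by simp
    then show ?thesis by (simp add: poly_power)
  qed
  then have "A = replicate_mset (size A) h" by (intro set_mset_subset_singletonD) auto
  then have "(\<Prod>x\<in>#A. [:-x, 1:]) = [:-h, 1:] ^ size A"
    by (metis image_replicate_mset prod_mset_replicate_mset)
  then show ?thesis using A assms(2) by simp
qed

lemma coeff_linear_power_pred:
  "m \<ge> 1 \<Longrightarrow> coeff ([:-h, 1:] ^ m :: 'k :: comm_ring_1 poly) (m - 1) = - of_nat m * h"
proof (induction m rule: nat_induct_at_least)
  case (Suc m)
  obtain l where l: "m = Suc l" using Suc.hyps by (cases m) auto
  have "coeff ([:-h, 1:] ^ Suc m) m = - h * coeff ([:-h, 1:] ^ m) m + coeff ([:-h, 1:] ^ m) (m - 1)"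
    unfolding power_Suc mult_pCons_left by (simp add: l)
  also have "coeff ([:-h, 1:] ^ m) m = 1" by (rule coeff_linear_power)
  finally show ?case using Suc.IH by (simp add: algebra_simps)
qed simp

section \<open>The trace\<close>

lemma polA_coeff_char_poly:
  fixes M :: "nat \<Rightarrow> nat \<Rightarrow> 'k :: alg_closed_field ^ 'n :: finite \<Rightarrow> 'k"
  assumes "\<And>i j. M i j \<in> polA UNIV"
  shows "(\<lambda>y. coeff (char_poly (mat m m (\<lambda>(i, j). M i j y))) k) \<in> polA UNIV"
proof -
  define PF where "PF = (\<lambda>p :: 'k ^ 'n \<Rightarrow> 'k poly. \<forall>k. (\<lambda>y. coeff (p y) k) \<in> polA UNIV)"
  have PF_mult: "PF (\<lambda>y. p y * r y)" if "PF p" "PF r" for p r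
    using that unfolding PF_def coeff_mult by (intro allI polA_sum polA_mult) auto
  have PF_prod: "PF (\<lambda>y. \<Prod>i\<in>I. p i y)" if "\<And>i. i \<in> I \<Longrightarrow> PF (p i)" for I :: "nat set" and p
    using that
  proof (induction I rule: infinite_finite_induct)
    case (insert i I)
    then show ?case using PF_mult[of "p i" "\<lambda>y. \<Prod>i\<in>I. p i y"] by simp
  qed (simp_all add: PF_def polA_const)
  have PF_sum: "PF (\<lambda>y. \<Sum>i\<in>I. p i y)" if "\<And>i. i \<in> I \<Longrightarrow> PF (p i)" for I :: "(nat \<Rightarrow> nat) set" and p
    using that unfolding PF_def coeff_sum by (intro allI polA_sum) auto
  have PF_const: "PF (\<lambda>y. c)" for c by (simp add: PF_def polA_const)
  define N where "N = (\<lambda>i j y. (if i = j then [:0, 1:] else 0) + [:- M i j y:])"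
  have "(\<lambda>y. coeff [:- M i j y:] k) \<in> polA UNIV" for i j k
    by (cases k) (auto intro: polA_uminus assms polA_zero)
  then have PF_N: "PF (N i j)" for i j
    unfolding PF_def N_def coeff_add by (intro allI polA_add polA_const)
  have "char_poly (mat m m (\<lambda>(i, j). M i j y)) =
      (\<Sum>p | p permutes {0..<m}. signof p * (\<Prod>i = 0..<m. N i (p i) y))" for y
  proof -
    have "char_poly_matrix (mat m m (\<lambda>(i, j). M i j y)) \<in> carrier_mat m m"
      by (rule char_poly_matrix_closed) simp
    note det = det_def'[OF this]
    show ?thesis unfolding char_poly_def det
    proof (intro sum.cong refl arg_cong2[of _ _ _ _ "(*)"] prod.cong)
      fix p i assume "p \<in> {p. p permutes {0..<m}}" "i \<in> {0..<m}"
      then have "i < m" "p i < m" using permutes_in_image[of p "{0..<m}" i] by auto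
      then show "char_poly_matrix (mat m m (\<lambda>(i, j). M i j y)) $$ (i, p i) = N i (p i) y"
        by (simp add: char_poly_matrix_def N_def)
    qed
  qed
  moreover have "PF (\<lambda>y. \<Sum>p | p permutes {0..<m}. signof p * (\<Prod>i = 0..<m. N i (p i) y))"
    by (intro PF_sum PF_mult PF_prod PF_const PF_N)
  ultimately show ?thesis by (simp add: PF_def)
qed

lemma eigenvalue_mat_iff:
  fixes M :: "nat \<Rightarrow> nat \<Rightarrow> 'k :: field"
  shows "poly (char_poly (mat m m (\<lambda>(i, j). M i j))) \<mu> = 0 \<longleftrightarrow>
    (\<exists>v. (\<exists>i<m. v i \<noteq> 0) \<and> (\<forall>i<m. (\<Sum>j<m. M i j * v j) = \<mu> * v i))"
proof -
  let ?A = "mat m m (\<lambda>(i, j). M i j)"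
  have A: "?A \<in> carrier_mat m m" by simp
  have "poly (char_poly ?A) \<mu> = 0 \<longleftrightarrow> (\<exists>w. eigenvector ?A w \<mu>)"
    using eigenvalue_root_char_poly[OF A] by (simp add: eigenvalue_def)
  also have "\<dots> \<longleftrightarrow> (\<exists>v. eigenvector ?A (Matrix.vec m v) \<mu>)"
  proof
    assume "\<exists>w. eigenvector ?A w \<mu>"
    then obtain w where w: "eigenvector ?A w \<mu>" by blast
    then have "w = Matrix.vec m (vec_index w)" by (auto simp: eigenvector_def)
    then show "\<exists>v. eigenvector ?A (Matrix.vec m v) \<mu>" using w by metis
  qed blast
  also have "\<dots> \<longleftrightarrow> (\<exists>v. (\<exists>i<m. v i \<noteq> 0) \<and> (\<forall>i<m. (\<Sum>j<m. M i j * v j) = \<mu> * v i))"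
    by (auto simp: eigenvector_def Matrix.vec_eq_iff scalar_prod_def lessThan_atLeast0)
  finally show ?thesis .
qed

lemma ev_hom_char_poly:
  fixes M :: "nat \<Rightarrow> nat \<Rightarrow> 'k :: comm_ring_1 poly"
  shows "ev s (char_poly (mat m m (\<lambda>(i, j). M i j))) = char_poly (mat m m (\<lambda>(i, j). poly (M i j) s))"
proof -
  have h: "comm_ring_hom (\<lambda>p :: 'k poly. poly p s)" by unfold_locales auto
  have "char_poly (map_mat (\<lambda>p. poly p s) (mat m m (\<lambda>(i, j). M i j))) =
    map_poly (\<lambda>p. poly p s) (char_poly (mat m m (\<lambda>(i, j). M i j)))"
    by (rule comm_ring_hom.char_poly_hom[OF h mat_carrier])
  moreover have "map_mat (\<lambda>p. poly p s) (mat m m (\<lambda>(i, j). M i j)) = mat m m (\<lambda>(i, j). poly (M i j) s)"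
    by (rule eq_matI) auto
  ultimately show ?thesis by (simp add: ev_def)
qed

text \<open>  In the application, \<open>M\<close> is \<open>B\<close> times the matrix of multiplication by a function \<open>H\<close> on a basis, and \<open>D\<close> is a matrix of
  multiplication by \<open>(H - \<phi>)\<^sup>\<kappa>\<close> on generators. On a line through \<open>y0\<close>, the characteristic polynomial
  of \<open>H\<close> is \<open>P = cM(B T)\<close> up to the factor \<open>B\<^sup>m\<close>. At every parameter with \<open>B \<noteq> 0\<close> its roots are roots of
  \<open>cD((T - \<phi>)\<^sup>\<kappa>)\<close>, so \<open>P\<close> divides a power of this monic polynomial, and by Gauss's lemma
  \<open>P = B\<^sup>m \<psi>\<close> with \<open>\<psi>\<close> monic over \<open>k[s]\<close>. So the trace is polynomial along the line, and the
  divisibility holds for \<open>\<psi>\<close> also at the parameters where \<open>B\<close> vanishes.\<close>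

lemma line_division:
  fixes M D :: "nat \<Rightarrow> nat \<Rightarrow> 'k :: alg_closed_field ^ 'n :: finite \<Rightarrow> 'k" and m \<delta> :: nat
  defines "cM \<equiv> \<lambda>y. char_poly (mat m m (\<lambda>(i, j). M i j y))"
    and "cD \<equiv> \<lambda>y. char_poly (mat \<delta> \<delta> (\<lambda>(i, j). D i j y))"
  assumes m: "m \<ge> 1" and \<kappa>: "\<kappa> \<ge> 1"
    and M: "\<And>i j. M i j \<in> polA UNIV" and D: "\<And>i j. D i j \<in> polA UNIV"
    and B: "B \<in> polA UNIV" and \<phi>: "\<phi> \<in> polA UNIV" and nz: "B y0 \<noteq> 0"
    and transfer: "\<And>y \<mu>. B y \<noteq> 0 \<Longrightarrow> poly (cM y) \<mu> = 0 \<Longrightarrow> poly (cD y) ((\<mu> / B y - \<phi> y) ^ \<kappa>) = 0"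
  shows "\<exists>\<psi>. degree \<psi> = m \<and> lead_coeff \<psi> = 1 \<and>
    (\<forall>s. coeff (cM (y0 + s *s z)) (m - 1) = B (y0 + s *s z) * poly (coeff \<psi> (m - 1)) s) \<and>
    (\<forall>s. ev s \<psi> dvd pcompose (cD (y0 + s *s z)) ([:- \<phi> (y0 + s *s z), 1:] ^ \<kappa>) ^ m)"
proof -
  let ?y = "\<lambda>s. y0 + s *s z"
  have "\<forall>ij. \<exists>P. \<forall>s. M (fst ij) (snd ij) (?y s) = poly P s" using polA_line[OF M] by blast
  from choice[OF this] obtain Mh where Mh: "\<And>i j s. M i j (?y s) = poly (Mh (i, j)) s" by auto
  have "\<forall>ij. \<exists>P. \<forall>s. D (fst ij) (snd ij) (?y s) = poly P s" using polA_line[OF D] by blast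
  from choice[OF this] obtain Dh where Dh: "\<And>i j s. D i j (?y s) = poly (Dh (i, j)) s" by auto
  obtain Bh where Bh: "\<And>s. B (?y s) = poly Bh s" using polA_line[OF B, of y0 z] by blast
  obtain lh where lh: "\<And>s. \<phi> (?y s) = poly lh s" using polA_line[OF \<phi>, of y0 z] by blast
  have Bhnz: "Bh \<noteq> 0" using nz Bh[of 0] by auto
  define U where "U = char_poly (mat m m (\<lambda>(i, j). Mh (i, j)))"
  define V where "V = char_poly (mat \<delta> \<delta> (\<lambda>(i, j). Dh (i, j)))"
  have evU: "ev s U = cM (?y s)" for s unfolding U_def cM_def Mh by (rule ev_hom_char_poly)
  have evV: "ev s V = cD (?y s)" for s unfolding V_def cD_def Dh by (rule ev_hom_char_poly)
  have degU: "degree U = m" "lead_coeff U = 1" and degV: "degree V = \<delta>" "lead_coeff V = 1"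
    using degree_monic_char_poly[of "mat m m (\<lambda>(i, j). Mh (i, j))" m]
      degree_monic_char_poly[of "mat \<delta> \<delta> (\<lambda>(i, j). Dh (i, j))" \<delta>] by (auto simp: U_def V_def)
  define W where "W = [:- lh, 1:] ^ \<kappa>"
  have degW: "degree W = \<kappa>" "lead_coeff W = 1"
    unfolding W_def by (rule degree_linear_power, simp add: degree_linear_power coeff_linear_power)
  have evW: "ev s W = [:- \<phi> (?y s), 1:] ^ \<kappa>" for s by (simp add: W_def ev_power ev_pCons lh)
  define G where "G = pcompose V W ^ m"
  have "coeff V \<delta> = 1" "coeff W \<kappa> = 1" using degV degW by auto
  then have leadG: "lead_coeff G = 1"
    unfolding G_def lead_coeff_power using \<kappa> by (subst lead_coeff_comp) (simp_all add: degW degV)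
  have evG: "ev s G = pcompose (cD (?y s)) ([:- \<phi> (?y s), 1:] ^ \<kappa>) ^ m" for s
    by (simp add: G_def ev_power ev_pcompose evV evW)
  define P where "P = pcompose U [:0, Bh:]"
  have degP: "degree P = m" using Bhnz by (simp add: P_def degree_pcompose degU)
  have coeffP: "coeff P i = Bh ^ i * coeff U i" for i unfolding P_def by (rule coeff_pcompose_linear)
  have leadP: "lead_coeff P = Bh ^ m" using degU by (simp add: degP coeffP)
  have Pnz: "P \<noteq> 0" using leadP Bhnz by auto
  define S where "S = {s. poly Bh s \<noteq> 0}"
  have S: "infinite S"
  proof -
    have "finite {s. poly Bh s = 0}" using Bhnz by (rule poly_roots_finite)
    moreover have "S = UNIV - {s. poly Bh s = 0}" by (auto simp: S_def)
    ultimately show ?thesis using infinite_UNIV_alg_closed by (simp add: Diff_infinite_finite)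
  qed
  have evP: "ev s P = pcompose (cM (?y s)) [:0, B (?y s):]" for s
    by (simp add: P_def ev_pcompose evU ev_pCons Bh)
  have dvP: "ev s P dvd ev s G" if s: "s \<in> S" for s
  proof -
    have Bs: "B (?y s) \<noteq> 0" using s by (simp add: S_def Bh)
    have "degree (cM (?y s)) = m" using degree_monic_char_poly[of "mat m m (\<lambda>(i, j). M i j (?y s))" m] by (simp add: cM_def)
    then have deg: "degree (ev s P) = m" using Bs by (simp add: evP degree_pcompose)
    have "ev s P \<noteq> 0" using deg m by auto
    have "ev s P dvd pcompose (cD (?y s)) ([:- \<phi> (?y s), 1:] ^ \<kappa>) ^ degree (ev s P)"
    proof (rule roots_imp_dvd_power[OF \<open>ev s P \<noteq> 0\<close>])
      fix t assume "poly (ev s P) t = 0"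
      then have "poly (cM (?y s)) (t * B (?y s)) = 0" by (simp add: evP poly_pcompose)
      from transfer[OF Bs this] show "poly (pcompose (cD (?y s)) ([:- \<phi> (?y s), 1:] ^ \<kappa>)) t = 0"
        using Bs by (simp add: poly_pcompose poly_power)
    qed
    then show ?thesis by (simp add: evG deg)
  qed
  obtain Q k where Q: "P * Q = Polynomial.smult (lead_coeff P ^ k) G"
    using pointwise_dvd_imp[OF S Pnz _ dvP] by (auto simp: leadP S_def)
  have "lead_coeff P ^ k \<noteq> 0" using Pnz by simp
  from gauss_monic[OF Q leadG this] obtain \<psi> where \<psi>: "P = Polynomial.smult (Bh ^ m) \<psi>"
    unfolding leadP by blast
  have deg\<psi>: "degree \<psi> = m" using degP \<psi> Bhnz by simp
  have lead\<psi>: "lead_coeff \<psi> = 1"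
    using arg_cong[OF \<psi>, of lead_coeff] Bhnz unfolding leadP lead_coeff_smult by simp
  have \<psi>nz: "\<psi> \<noteq> 0" using lead\<psi> by auto
  have co: "coeff U (m - 1) = Bh * coeff \<psi> (m - 1)"
  proof -
    have "Bh ^ (m - 1) * coeff U (m - 1) = Bh ^ m * coeff \<psi> (m - 1)"
      using arg_cong[OF \<psi>, of "\<lambda>p. coeff p (m - 1)"] by (simp add: coeffP)
    also have "Bh ^ m = Bh ^ (m - 1) * Bh" using m by (cases m) auto
    finally show ?thesis using Bhnz by (simp add: mult.assoc)
  qed
  have "coeff (cM (?y s)) (m - 1) = B (?y s) * poly (coeff \<psi> (m - 1)) s" for s
    using arg_cong[OF co, of "\<lambda>p. poly p s"] by (simp add: Bh flip: evU)
  moreover have "ev s \<psi> dvd ev s G" for s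
  proof -
    have "ev s \<psi> dvd ev s G" if "s \<in> S" for s
      using dvP[OF that] that unfolding \<psi> ev_smult by (simp add: S_def smult_dvd_iff)
    with pointwise_dvd_imp[OF S \<psi>nz _ this] obtain Q k where "\<psi> * Q = Polynomial.smult (lead_coeff \<psi> ^ k) G"
      by (auto simp: lead\<psi>)
    then have "G = \<psi> * Q" by (simp add: lead\<psi>)
    then show ?thesis by (simp add: ev_mult)
  qed
  ultimately show ?thesis using deg\<psi> lead\<psi> evG by metis
qed

lemma char_poly_zero_mat: "char_poly (0\<^sub>m n n :: 'a :: field mat) = [:0, 1:] ^ n"
proof -
  have "upper_triangular (0\<^sub>m n n :: 'a mat)" by (auto simp: upper_triangular_def)
  from char_poly_upper_triangular[OF zero_carrier_mat this]
  have "char_poly (0\<^sub>m n n :: 'a mat) = (\<Prod>a\<leftarrow>diag_mat (0\<^sub>m n n :: 'a mat). [:- a, 1:])" .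
  also have "diag_mat (0\<^sub>m n n :: 'a mat) = replicate n 0"
    by (auto simp: diag_mat_def intro!: nth_equalityI)
  finally show ?thesis by (simp add: map_replicate prod_list_replicate)
qed

context form_map
begin

text \<open>  Here \<open>u\<close> becomes a basis of \<open>S\<close> after inverting \<open>B\<close>, and \<open>b\<close> generates \<open>S\<close> over \<open>R\<close>. The
  matrix \<open>E\<close>, which expresses \<open>B b\<close> by \<open>u\<close>, intertwines \<open>(M - \<phi> B)\<^sup>\<kappa>\<close> with \<open>B\<^sup>\<kappa> D\<close>. This is an identity
  of polynomial matrices, because \<open>u\<close> is independent, so it can be evaluated at \<open>y\<close>. Thus
  \<open>E\<close> maps an eigenvector of \<open>M\<close> at \<open>y\<close> to one of \<open>D\<close>, and the image is not zero since \<open>b\<close> generates \<open>u\<close>.\<close>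

lemma eigenvalue_transfer:
  fixes u b :: "nat \<Rightarrow> 'k ^ 'n \<Rightarrow> 'k"
  assumes ind: "\<And>r j y. (\<And>j. r j \<in> polA UNIV) \<Longrightarrow> (\<And>x. (\<Sum>j<m. r j (F x) * u j x) = 0) \<Longrightarrow> j < m \<Longrightarrow> r j y = 0"
    and gen: "\<And>i. i < m \<Longrightarrow> \<exists>r. (\<forall>l. r l \<in> polA UNIV) \<and> (\<forall>x. u i x = (\<Sum>l<\<delta>. r l (F x) * b l x))"
    and B: "B \<in> polA UNIV" and \<phi>: "\<phi> \<in> polA UNIV"
    and E: "\<And>l j. E l j \<in> polA UNIV" and E_eq: "\<And>l x. l < \<delta> \<Longrightarrow> B (F x) * b l x = (\<Sum>j<m. E l j (F x) * u j x)"
    and M: "\<And>l j. M l j \<in> polA UNIV" and M_eq: "\<And>i x. i < m \<Longrightarrow> B (F x) * (H x * u i x) = (\<Sum>j<m. M i j (F x) * u j x)"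
    and D: "\<And>l j. D l j \<in> polA UNIV"
    and D_eq: "\<And>l x. l < \<delta> \<Longrightarrow> (H x - \<phi> (F x)) ^ \<kappa> * b l x = (\<Sum>t<\<delta>. D l t (F x) * b t x)"
    and y: "B y \<noteq> 0" and \<mu>: "poly (char_poly (mat m m (\<lambda>(i, j). M i j y))) \<mu> = 0"
  shows "poly (char_poly (mat \<delta> \<delta> (\<lambda>(i, j). D i j y))) ((\<mu> / B y - \<phi> y) ^ \<kappa>) = 0"
proof -
  have ind': "r j y = r' j y" if "\<And>j. r j \<in> polA UNIV" "\<And>j. r' j \<in> polA UNIV"
     "\<And>x. (\<Sum>j<m. r j (F x) * u j x) = (\<Sum>j<m. r' j (F x) * u j x)" "j < m" for r r' j y
    using ind[of "\<lambda>j y. r j y - r' j y" j y] that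
    by (auto intro: polA_diff simp: left_diff_distrib sum_subtractf)
  obtain v where v: "\<exists>i<m. v i \<noteq> 0" "\<And>i. i < m \<Longrightarrow> (\<Sum>j<m. M i j y * v j) = \<mu> * v i"
    using \<mu> unfolding eigenvalue_mat_iff[of m "\<lambda>i j. M i j y"] by blast
  define M' where "M' = (\<lambda>i j y. M i j y - (if i = j then \<phi> y * B y else 0))"
  have M': "M' i j \<in> polA UNIV" for i j
    unfolding M'_def using M \<phi> B by (cases "i = j") (auto intro: polA_diff polA_mult polA_zero)
  have M'_sum: "(\<Sum>j<m. M' i j y * w j) = (\<Sum>j<m. M i j y * w j) - \<phi> y * B y * w i" if "i < m" for i y w
    using that by (simp add: M'_def left_diff_distrib sum_subtractf if_distrib[of "\<lambda>c. c * _"] sum.delta cong: if_cong)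
  \<comment> \<open>the powers of the matrix \<open>M' = M - \<phi> B\<close>, as polynomial functions\<close>
  define pw where "pw = rec_nat (\<lambda>i j (y :: 'k ^ 'n). if i = j then 1 else 0 :: 'k) (\<lambda>k p i j y. \<Sum>t<m. M' i t y * p t j y)"
  have pw_0: "pw 0 i j y = (if i = j then 1 else 0)" and pw_Suc: "pw (Suc k) i j y = (\<Sum>t<m. M' i t y * pw k t j y)" for k i j y
    by (simp_all add: pw_def)
  have pw_A: "pw k i j \<in> polA UNIV" for k i j
  proof (induction k arbitrary: i)
    case 0
    have "pw 0 i j = (\<lambda>y. if i = j then 1 else 0)" by (auto simp: pw_0)
    then show ?case by (simp add: polA_const)
  next
    case (Suc k)
    have "pw (Suc k) i j = (\<lambda>y. \<Sum>t<m. M' i t y * pw k t j y)" by (auto simp: pw_Suc)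
    then show ?case using Suc M' by (auto intro!: polA_sum polA_mult)
  qed
  have pw_u: "(B (F x) * (H x - \<phi> (F x))) ^ k * u i x = (\<Sum>j<m. pw k i j (F x) * u j x)" if "i < m" for i k x
    using that
  proof (induction k arbitrary: i)
    case 0
    then show ?case by (simp add: pw_0 if_distrib[of "\<lambda>c. c * _"] sum.delta cong: if_cong)
  next
    case (Suc k)
    have "B (F x) * (H x - \<phi> (F x)) * u i x = (\<Sum>t<m. M' i t (F x) * u t x)"
      unfolding M'_sum[OF Suc.prems] using M_eq[OF Suc.prems, of x] by (simp add: algebra_simps)
    note step = this
    have "(B (F x) * (H x - \<phi> (F x))) ^ Suc k * u i x =
        (B (F x) * (H x - \<phi> (F x))) ^ k * (B (F x) * (H x - \<phi> (F x)) * u i x)" by (simp add: mult_ac)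
    also have "\<dots> = (\<Sum>t<m. M' i t (F x) * ((B (F x) * (H x - \<phi> (F x))) ^ k * u t x))"
      unfolding step sum_distrib_left by (intro sum.cong refl) (simp add: mult_ac)
    finally have "(B (F x) * (H x - \<phi> (F x))) ^ Suc k * u i x =
        (\<Sum>t<m. M' i t (F x) * ((B (F x) * (H x - \<phi> (F x))) ^ k * u t x))" .
    also have "\<dots> = (\<Sum>t<m. M' i t (F x) * (\<Sum>j<m. pw k t j (F x) * u j x))"
      by (intro sum.cong refl) (simp add: Suc.IH)
    also have "\<dots> = (\<Sum>j<m. pw (Suc k) i j (F x) * u j x)"
      unfolding pw_Suc sum_distrib_left sum_distrib_right mult.assoc by (rule sum.swap)
    finally show ?case .
  qed
  have pw_v: "(\<Sum>j<m. pw k i j y * v j) = (\<mu> - \<phi> y * B y) ^ k * v i" if "i < m" for i k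
    using that
  proof (induction k arbitrary: i)
    case 0
    then show ?case by (simp add: pw_0 if_distrib[of "\<lambda>c. c * _"] sum.delta cong: if_cong)
  next
    case (Suc k)
    have "(\<Sum>j<m. pw (Suc k) i j y * v j) = (\<Sum>t<m. M' i t y * (\<Sum>j<m. pw k t j y * v j))"
      unfolding pw_Suc sum_distrib_left sum_distrib_right mult.assoc by (rule sum.swap)
    also have "\<dots> = (\<Sum>t<m. M' i t y * ((\<mu> - \<phi> y * B y) ^ k * v t))"
      by (intro sum.cong refl) (simp add: Suc.IH)
    also have "\<dots> = (\<mu> - \<phi> y * B y) ^ k * (\<Sum>t<m. M' i t y * v t)"
      by (simp add: sum_distrib_left mult_ac)
    also have "(\<Sum>t<m. M' i t y * v t) = (\<mu> - \<phi> y * B y) * v i"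
      unfolding M'_sum[OF Suc.prems] v(2)[OF Suc.prems] by (simp add: algebra_simps)
    finally show ?case by simp
  qed
  define w where "w = (\<lambda>l. \<Sum>j<m. E l j y * v j)"
  have intertwine: "(\<Sum>i<m. E l i y * pw \<kappa> i j y) = B y ^ \<kappa> * (\<Sum>t<\<delta>. D l t y * E t j y)" if l: "l < \<delta>" and j: "j < m" for l j
  proof (rule ind'[of "\<lambda>j y. \<Sum>i<m. E l i y * pw \<kappa> i j y" "\<lambda>j y. B y ^ \<kappa> * (\<Sum>t<\<delta>. D l t y * E t j y)", OF _ _ _ j])
    fix x
    have "(\<Sum>j<m. (\<Sum>i<m. E l i (F x) * pw \<kappa> i j (F x)) * u j x) =
        (\<Sum>i<m. E l i (F x) * (\<Sum>j<m. pw \<kappa> i j (F x) * u j x))"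
      unfolding sum_distrib_left sum_distrib_right mult.assoc by (rule sum.swap)
    also have "\<dots> = (\<Sum>i<m. E l i (F x) * ((B (F x) * (H x - \<phi> (F x))) ^ \<kappa> * u i x))"
      by (intro sum.cong refl) (simp add: pw_u)
    also have "\<dots> = (B (F x) * (H x - \<phi> (F x))) ^ \<kappa> * (B (F x) * b l x)"
      unfolding E_eq[OF l] by (simp add: sum_distrib_left mult_ac)
    also have "\<dots> = B (F x) ^ \<kappa> * (B (F x) * ((H x - \<phi> (F x)) ^ \<kappa> * b l x))"
      by (simp add: power_mult_distrib mult_ac)
    also have "\<dots> = B (F x) ^ \<kappa> * (\<Sum>t<\<delta>. D l t (F x) * (B (F x) * b t x))"
      unfolding D_eq[OF l] by (simp add: sum_distrib_left mult_ac)
    also have "\<dots> = B (F x) ^ \<kappa> * (\<Sum>t<\<delta>. D l t (F x) * (\<Sum>j<m. E t j (F x) * u j x))"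
      by (intro arg_cong2[of _ _ _ _ "(*)"] sum.cong refl) (simp add: E_eq)
    also have "(\<Sum>t<\<delta>. D l t (F x) * (\<Sum>j<m. E t j (F x) * u j x)) = (\<Sum>j<m. (\<Sum>t<\<delta>. D l t (F x) * E t j (F x)) * u j x)"
      unfolding sum_distrib_left sum_distrib_right mult.assoc by (rule sum.swap)
    also have "B (F x) ^ \<kappa> * (\<Sum>j<m. (\<Sum>t<\<delta>. D l t (F x) * E t j (F x)) * u j x) =
       (\<Sum>j<m. B (F x) ^ \<kappa> * (\<Sum>t<\<delta>. D l t (F x) * E t j (F x)) * u j x)"
      by (subst sum_distrib_left) (simp add: mult.assoc)
    finally show "(\<Sum>j<m. (\<Sum>i<m. E l i (F x) * pw \<kappa> i j (F x)) * u j x) =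
       (\<Sum>j<m. B (F x) ^ \<kappa> * (\<Sum>t<\<delta>. D l t (F x) * E t j (F x)) * u j x)" .
  qed (intro polA_sum polA_mult polA_power E pw_A B D)+
  have eig: "(\<Sum>t<\<delta>. D l t y * w t) = (\<mu> / B y - \<phi> y) ^ \<kappa> * w l" if l: "l < \<delta>" for l
  proof -
    have "B y ^ \<kappa> * (\<Sum>t<\<delta>. D l t y * w t) = (\<Sum>j<m. (B y ^ \<kappa> * (\<Sum>t<\<delta>. D l t y * E t j y)) * v j)"
      unfolding w_def sum_distrib_left sum_distrib_right mult.assoc by (rule sum.swap)
    also have "\<dots> = (\<Sum>j<m. (\<Sum>i<m. E l i y * pw \<kappa> i j y) * v j)"
      by (intro sum.cong refl) (simp add: intertwine[OF l])
    also have "\<dots> = (\<Sum>i<m. E l i y * (\<Sum>j<m. pw \<kappa> i j y * v j))"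
      unfolding sum_distrib_left sum_distrib_right mult.assoc by (rule sum.swap)
    also have "\<dots> = (\<Sum>i<m. E l i y * ((\<mu> - \<phi> y * B y) ^ \<kappa> * v i))"
      by (intro sum.cong refl) (simp add: pw_v)
    also have "\<dots> = (\<mu> - \<phi> y * B y) ^ \<kappa> * w l"
      by (simp add: w_def sum_distrib_left mult_ac)
    also have "(\<mu> - \<phi> y * B y) ^ \<kappa> = B y ^ \<kappa> * (\<mu> / B y - \<phi> y) ^ \<kappa>"
      using y by (simp flip: power_mult_distrib add: field_simps)
    finally show ?thesis using y by (simp add: mult.assoc)
  qed
  have "\<exists>l<\<delta>. w l \<noteq> 0"
  proof (rule ccontr)
    assume "\<not> (\<exists>l<\<delta>. w l \<noteq> 0)"
    then have w0: "w l = 0" if "l < \<delta>" for l using that by blast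
    obtain i where i: "i < m" "v i \<noteq> 0" using v(1) by blast
    obtain r where r: "\<And>l. r l \<in> polA UNIV" "\<And>x. u i x = (\<Sum>l<\<delta>. r l (F x) * b l x)" using gen[OF i(1)] by blast
    have rel: "(if j = i then B y else 0) = (\<Sum>l<\<delta>. r l y * E l j y)" if j: "j < m" for j
    proof (rule ind'[of "\<lambda>j y. if j = i then B y else 0" "\<lambda>j y. \<Sum>l<\<delta>. r l y * E l j y", OF _ _ _ j])
      fix x
      have "(\<Sum>j<m. (if j = i then B (F x) else 0) * u j x) = B (F x) * u i x"
        using i(1) by (simp add: if_distrib[of "\<lambda>c. c * _"] sum.delta cong: if_cong)
      also have "\<dots> = (\<Sum>l<\<delta>. r l (F x) * (B (F x) * b l x))" by (simp add: r(2) sum_distrib_left mult_ac)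
      also have "\<dots> = (\<Sum>l<\<delta>. r l (F x) * (\<Sum>j<m. E l j (F x) * u j x))"
        by (intro sum.cong refl) (simp add: E_eq)
      also have "\<dots> = (\<Sum>j<m. (\<Sum>l<\<delta>. r l (F x) * E l j (F x)) * u j x)"
        unfolding sum_distrib_left sum_distrib_right mult.assoc by (rule sum.swap)
      finally show "(\<Sum>j<m. (if j = i then B (F x) else 0) * u j x) = (\<Sum>j<m. (\<Sum>l<\<delta>. r l (F x) * E l j (F x)) * u j x)" .
    next
      show "(\<lambda>y. if j = i then B y else 0) \<in> polA UNIV" for j using B by (cases "j = i") (auto intro: polA_zero)
    qed (intro polA_sum polA_mult r E)
    have "B y * v i = (\<Sum>j<m. (if j = i then B y else 0) * v j)"
      using i(1) by (simp add: if_distrib[of "\<lambda>c. c * _"] sum.delta cong: if_cong)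
    also have "\<dots> = (\<Sum>j<m. (\<Sum>l<\<delta>. r l y * E l j y) * v j)" by (intro sum.cong refl) (simp add: rel)
    also have "\<dots> = (\<Sum>l<\<delta>. r l y * w l)"
      unfolding w_def sum_distrib_left sum_distrib_right mult.assoc by (rule sum.swap)
    also have "\<dots> = 0" using w0 by simp
    finally show False using y i(2) by simp
  qed
  then show ?thesis unfolding eigenvalue_mat_iff[of \<delta> "\<lambda>i j. D i j y"] using eig by blast
qed

end

lemma pcompose_power: "pcompose (p ^ n) r = pcompose p r ^ n" for p r :: "'a :: comm_ring_1 poly"
  by (induction n) (simp_all add: pcompose_mult pcompose_1)

context form_map
begin

lemma generation: "\<exists>D0. \<forall>f\<in>polA UNIV. \<exists>r. (\<forall>\<beta>. r \<beta> \<in> polA UNIV) \<and>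
     (\<forall>x. f x = (\<Sum>\<beta> | wt \<beta> < D0. r \<beta> (F x) * pmon \<beta> x))"
proof -
  from finite_generation obtain D0 where D0: "\<forall>D. \<forall>f\<in>pol D. \<exists>r. (\<forall>\<beta>. r \<beta> \<in> pol (D div q)) \<and>
     (\<forall>x. f x = (\<Sum>\<beta> | wt \<beta> < D0. r \<beta> (F x) * pmon \<beta> x))" by (elim exE)
  show ?thesis
  proof (rule exI, rule ballI)
    fix f :: "'k ^ 'n \<Rightarrow> 'k" assume "f \<in> polA UNIV"
    then obtain D where "f \<in> pol D" using polA_UNIV_iff by blast
    from D0[rule_format, OF this] show "\<exists>r. (\<forall>\<beta>. r \<beta> \<in> polA UNIV) \<and>
     (\<forall>x. f x = (\<Sum>\<beta> | wt \<beta> < D0. r \<beta> (F x) * pmon \<beta> x))"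
      using polA_UNIV_iff by blast
  qed
qed

lemma sum_reindex_lessThan:
  fixes g :: "'i \<Rightarrow> 'k"
  assumes "bij_betw h {..<m :: nat} J"
  shows "(\<Sum>j\<in>J. g j) = (\<Sum>i<m. g (h i))"
  using sum.reindex_bij_betw[OF assms, of g] by simp

text \<open>  The polynomial \<open>T\<close> is minus the trace of multiplication by \<open>H\<close>, the second coefficient of
  its characteristic polynomial. It is polynomial because it is so on lines: \<open>line_division\<close> applies with
  \<open>\<phi> = 0\<close> and \<open>\<kappa> = 1\<close>, where \<open>cD\<close> is an equation of integral dependence of \<open>H\<close> over \<open>R\<close>. The
  premise for \<open>y0\<close> says that \<open>(H - \<phi> \<circ> F)\<^sup>\<kappa>\<close> maps \<open>S\<close> into \<open>S\<close> times the ideal of \<open>y0\<close> in \<open>R\<close>.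
  Then \<open>D\<close> can be chosen with \<open>D = 0\<close> at \<open>y0\<close>, so \<open>\<psi>\<close> specialises to a monic polynomial with
  \<open>\<phi> y0\<close> as its only root.\<close>

lemma trace_exists:
  assumes H: "H \<in> polA UNIV"
    and gen: "\<forall>f\<in>polA UNIV. \<exists>r. (\<forall>\<beta>. r \<beta> \<in> polA UNIV) \<and>
     (\<forall>x. f x = (\<Sum>\<beta> | wt \<beta> < D0. r \<beta> (F x) * pmon \<beta> x))"
  shows "\<exists>T\<in>polA UNIV. \<forall>y0 \<kappa> \<phi>. \<kappa> \<ge> 1 \<and> \<phi> \<in> polA UNIV \<and>
    (\<forall>f\<in>polA UNIV. \<exists>D. (\<forall>\<beta>. D \<beta> \<in> polA UNIV \<and> D \<beta> y0 = 0) \<and>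
       (\<forall>x. (H x - \<phi> (F x)) ^ \<kappa> * f x = (\<Sum>\<beta> | wt \<beta> < D0. D \<beta> (F x) * pmon \<beta> x))) \<longrightarrow>
    T y0 = - of_nat (q ^ CARD('n)) * \<phi> y0"
proof -
  obtain J B where J: "finite J" "card J = q ^ CARD('n)" "R_independent J"
    and B: "B \<in> polA UNIV" "\<exists>y. B y \<noteq> 0"
    and JB: "\<And>f. f \<in> polA UNIV \<Longrightarrow> \<exists>r. (\<forall>j. r j \<in> polA UNIV) \<and> (\<forall>x. B (F x) * f x = (\<Sum>j\<in>J. r j (F x) * pmon j x))"
    by (rule exists_rank_basis) blast
  define m where "m = card J"
  have m: "m = q ^ CARD('n)" "m \<ge> 1" using J(2) q by (auto simp: m_def)
  define G where "G = {\<beta> :: 'n \<Rightarrow> nat. wt \<beta> < D0}"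
  have G: "finite G" unfolding G_def by (rule finite_wt_less)
  define \<delta> where "\<delta> = card G"
  obtain hJ where hJ: "bij_betw hJ {..<m} J"
    using ex_bij_betw_nat_finite[OF J(1)] unfolding m_def atLeast0LessThan by blast
  obtain hG where hG: "bij_betw hG {..<\<delta>} G"
    using ex_bij_betw_nat_finite[OF G] unfolding \<delta>_def atLeast0LessThan by blast
  define u b where "u = (\<lambda>i x. pmon (hJ i) x :: 'k)" and "b = (\<lambda>i x. pmon (hG i) x :: 'k)"
  have uA: "u i \<in> polA UNIV" and bA: "b i \<in> polA UNIV" for i
    unfolding u_def b_def polA_def by (auto intro: pspan_pmon)
  have genG: "\<exists>r. (\<forall>l. r l \<in> polA UNIV) \<and> (\<forall>x. f x = (\<Sum>l<\<delta>. r l (F x) * b l x))" if f: "f \<in> polA UNIV" for f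
  proof -
    obtain r where "\<And>\<beta>. r \<beta> \<in> polA UNIV" "\<And>x. f x = (\<Sum>\<beta>\<in>G. r \<beta> (F x) * pmon \<beta> x)"
      using bspec[OF gen f] unfolding G_def by blast
    then show ?thesis by (intro exI[of _ "\<lambda>l. r (hG l)"]) (simp add: sum_reindex_lessThan[OF hG] b_def)
  qed
  have genJ: "\<exists>r. (\<forall>l. r l \<in> polA UNIV) \<and> (\<forall>x. B (F x) * f x = (\<Sum>l<m. r l (F x) * u l x))" if f: "f \<in> polA UNIV" for f
  proof -
    obtain r where "\<And>\<beta>. r \<beta> \<in> polA UNIV" "\<And>x. B (F x) * f x = (\<Sum>\<beta>\<in>J. r \<beta> (F x) * pmon \<beta> x)"
      using JB[OF f] by blast
    then show ?thesis by (intro exI[of _ "\<lambda>l. r (hJ l)"]) (simp add: sum_reindex_lessThan[OF hJ] u_def)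
  qed
  have ind: "r j y = 0" if r: "\<And>j. r j \<in> polA UNIV" "\<And>x. (\<Sum>j<m. r j (F x) * u j x) = 0" "j < m" for r j y
  proof -
    define r' where "r' = (\<lambda>\<beta>. r (the_inv_into {..<m} hJ \<beta>))"
    have inv: "the_inv_into {..<m} hJ (hJ i) = i" if "i < m" for i
      using hJ that by (auto simp: bij_betw_def intro!: the_inv_into_f_f)
    have "(\<Sum>\<beta>\<in>J. r' \<beta> (F x) * pmon \<beta> x) = 0" for x
    proof -
      have "(\<Sum>\<beta>\<in>J. r' \<beta> (F x) * pmon \<beta> x) = (\<Sum>i<m. r' (hJ i) (F x) * pmon (hJ i) x)"
        by (rule sum_reindex_lessThan[OF hJ])
      also have "\<dots> = (\<Sum>i<m. r i (F x) * u i x)" by (intro sum.cong refl) (simp add: r'_def inv u_def)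
      finally show ?thesis using r(2) by simp
    qed
    moreover have "r' \<beta> \<in> polA UNIV" for \<beta> unfolding r'_def by (rule r(1))
    ultimately have "\<forall>\<beta>\<in>J. \<forall>y. r' \<beta> y = 0" using J(3) unfolding R_independent_def by blast
    moreover have "hJ j \<in> J" using hJ r(3) by (auto simp: bij_betw_def)
    ultimately have "r' (hJ j) y = 0" by blast
    then show ?thesis by (simp add: r'_def inv r(3))
  qed
  have "\<forall>l. \<exists>r. (\<forall>j. r j \<in> polA UNIV) \<and> (\<forall>x. B (F x) * b l x = (\<Sum>j<m. r j (F x) * u j x))"
    using genJ[OF bA] by blast
  from choice[OF this] obtain E where E: "\<And>l j. E l j \<in> polA UNIV"
    "\<And>l x. B (F x) * b l x = (\<Sum>j<m. E l j (F x) * u j x)" by auto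
  have "\<forall>i. \<exists>r. (\<forall>j. r j \<in> polA UNIV) \<and> (\<forall>x. B (F x) * (H x * u i x) = (\<Sum>j<m. r j (F x) * u j x))"
    using genJ[OF polA_mult[OF H uA]] by blast
  from choice[OF this] obtain M where M: "\<And>i j. M i j \<in> polA UNIV"
    "\<And>i x. B (F x) * (H x * u i x) = (\<Sum>j<m. M i j (F x) * u j x)" by auto
  define cM where "cM = (\<lambda>y. char_poly (mat m m (\<lambda>(i, j). M i j y)))"
  define A where "A = (\<lambda>y. coeff (cM y) (m - 1))"
  have A: "A \<in> polA UNIV" unfolding A_def cM_def by (rule polA_coeff_char_poly) (rule M)
  obtain y1 where y1: "B y1 \<noteq> 0" using B(2) by blast
  have line: "\<exists>\<psi>. degree \<psi> = m \<and> lead_coeff \<psi> = 1 \<and>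
      (\<forall>s. A (y1 + s *s z) = B (y1 + s *s z) * poly (coeff \<psi> (m - 1)) s) \<and>
      (\<forall>s. ev s \<psi> dvd pcompose (char_poly (mat \<delta> \<delta> (\<lambda>(i, j). D i j (y1 + s *s z)))) ([:- \<phi> (y1 + s *s z), 1:] ^ \<kappa>) ^ m)"
    if \<kappa>: "\<kappa> \<ge> 1" and \<phi>: "\<phi> \<in> polA UNIV" and D: "\<And>i j. D i j \<in> polA UNIV"
      "\<And>l x. l < \<delta> \<Longrightarrow> (H x - \<phi> (F x)) ^ \<kappa> * b l x = (\<Sum>t<\<delta>. D l t (F x) * b t x)" for \<kappa> \<phi> D z
    unfolding A_def cM_def
  proof (rule line_division[OF m(2) \<kappa> M(1) D(1) B(1) \<phi> y1])
    fix y \<mu>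
    assume "B y \<noteq> 0" "poly (char_poly (mat m m (\<lambda>(i, j). M i j y))) \<mu> = 0"
    then show "poly (char_poly (mat \<delta> \<delta> (\<lambda>(i, j). D i j y))) ((\<mu> / B y - \<phi> y) ^ \<kappa>) = 0"
      by (intro eigenvalue_transfer[where u = u and b = b and E = E and M = M and m = m and B = B and H = H])
        (use ind genG[OF uA] B(1) \<phi> E M D in blast)+
  qed
  have "\<forall>l. \<exists>r. (\<forall>t. r t \<in> polA UNIV) \<and> (\<forall>x. H x * b l x = (\<Sum>t<\<delta>. r t (F x) * b t x))"
    using genG[OF polA_mult[OF H bA]] by blast
  from choice[OF this] obtain D1 where D1: "\<And>i j. D1 i j \<in> polA UNIV"
    "\<And>l x. H x * b l x = (\<Sum>t<\<delta>. D1 l t (F x) * b t x)" by auto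
  have "\<exists>C\<in>polA UNIV. \<forall>x. A x = B x * C x"
  proof (rule pol_div[OF A B(1) y1])
    fix z
    have "\<exists>\<psi>. degree \<psi> = m \<and> lead_coeff \<psi> = 1 \<and>
      (\<forall>s. A (y1 + s *s z) = B (y1 + s *s z) * poly (coeff \<psi> (m - 1)) s) \<and>
      (\<forall>s. ev s \<psi> dvd pcompose (char_poly (mat \<delta> \<delta> (\<lambda>(i, j). D1 i j (y1 + s *s z)))) ([:- (\<lambda>_. 0) (y1 + s *s z), 1:] ^ 1) ^ m)"
      by (rule line) (use D1 in \<open>simp_all add: polA_zero\<close>)
    then show "\<exists>P. \<forall>s. A (y1 + s *s z) = B (y1 + s *s z) * poly P s" by blast
  qed
  then obtain T where T: "T \<in> polA UNIV" "\<And>x. A x = B x * T x" by blast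
  have "T y0 = - of_nat (q ^ CARD('n)) * \<phi> y0"
    if \<kappa>: "\<kappa> \<ge> 1" and \<phi>: "\<phi> \<in> polA UNIV" and rel: "\<And>f. f \<in> polA UNIV \<Longrightarrow> \<exists>D. (\<forall>\<beta>. D \<beta> \<in> polA UNIV \<and> D \<beta> y0 = 0) \<and>
       (\<forall>x. (H x - \<phi> (F x)) ^ \<kappa> * f x = (\<Sum>\<beta> | wt \<beta> < D0. D \<beta> (F x) * pmon \<beta> x))" for y0 \<kappa> \<phi>
  proof -
    have "\<forall>l. \<exists>D. (\<forall>\<beta>. D \<beta> \<in> polA UNIV \<and> D \<beta> y0 = 0) \<and>
       (\<forall>x. (H x - \<phi> (F x)) ^ \<kappa> * b l x = (\<Sum>\<beta>\<in>G. D \<beta> (F x) * pmon \<beta> x))"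
      using rel[OF bA] unfolding G_def by blast
    from choice[OF this] obtain D' where D': "\<And>l \<beta>. D' l \<beta> \<in> polA UNIV" "\<And>l \<beta>. D' l \<beta> y0 = 0"
      "\<And>l x. (H x - \<phi> (F x)) ^ \<kappa> * b l x = (\<Sum>\<beta>\<in>G. D' l \<beta> (F x) * pmon \<beta> x)" by auto
    define D where "D = (\<lambda>l t. D' l (hG t))"
    have D: "\<And>i j. D i j \<in> polA UNIV" "\<And>i j. D i j y0 = 0"
      "\<And>l x. (H x - \<phi> (F x)) ^ \<kappa> * b l x = (\<Sum>t<\<delta>. D l t (F x) * b t x)"
      using D' by (simp_all add: D_def sum_reindex_lessThan[OF hG] b_def)
    obtain \<psi> where \<psi>: "degree \<psi> = m" "lead_coeff \<psi> = 1"
      "\<And>s. A (y1 + s *s (y0 - y1)) = B (y1 + s *s (y0 - y1)) * poly (coeff \<psi> (m - 1)) s"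
      "\<And>s. ev s \<psi> dvd pcompose (char_poly (mat \<delta> \<delta> (\<lambda>(i, j). D i j (y1 + s *s (y0 - y1))))) ([:- \<phi> (y1 + s *s (y0 - y1)), 1:] ^ \<kappa>) ^ m"
      using line[OF \<kappa> \<phi> D(1) D(3), of "y0 - y1"] by blast
    \<comment> \<open>the line joins \<open>y1\<close>, where \<open>B \<noteq> 0\<close>, to \<open>y0\<close>, where \<open>B\<close> may vanish; the identity
      \<open>T = coeff \<psi> (m - 1)\<close> extends from the former to the latter\<close>
    obtain TP where TP: "\<And>s. T (y1 + s *s (y0 - y1)) = poly TP s" using polA_line[OF T(1), of y1 "y0 - y1"] by blast
    obtain BP where BP: "\<And>s. B (y1 + s *s (y0 - y1)) = poly BP s" using polA_line[OF B(1), of y1 "y0 - y1"] by blast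
    have "BP \<noteq> 0" using y1 BP[of 0] by auto
    moreover have "BP * TP = BP * coeff \<psi> (m - 1)"
      by (rule poly_eqI_alg_closed, unfold poly_mult) (rule \<psi>(3)[unfolded T(2) TP BP])
    ultimately have TPeq: "TP = coeff \<psi> (m - 1)" by simp
    have one: "y1 + 1 *s (y0 - y1) = y0" by simp
    have Ty0: "T y0 = coeff (ev 1 \<psi>) (m - 1)" using TP[of 1] unfolding one TPeq by simp
    have "mat \<delta> \<delta> (\<lambda>(i, j). D i j y0) = 0\<^sub>m \<delta> \<delta>" by (rule eq_matI) (auto simp: D(2))
    then have "char_poly (mat \<delta> \<delta> (\<lambda>(i, j). D i j y0)) = [:0, 1:] ^ \<delta>"
      by (simp add: char_poly_zero_mat)
    then have "ev 1 \<psi> dvd pcompose ([:0, 1:] ^ \<delta>) ([:- \<phi> y0, 1:] ^ \<kappa>) ^ m"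
      using \<psi>(4)[of 1] unfolding one by simp
    also have "pcompose ([:0, 1:] ^ \<delta>) ([:- \<phi> y0, 1:] ^ \<kappa>) ^ m = [:- \<phi> y0, 1:] ^ (\<kappa> * \<delta> * m)"
      by (simp add: pcompose_power pcompose_pCons power_mult)
    finally have dv: "ev 1 \<psi> dvd [:- \<phi> y0, 1:] ^ (\<kappa> * \<delta> * m)" .
    have "coeff (ev 1 \<psi>) m = 1" using \<psi>(1,2) by simp
    then have deg: "degree (ev 1 \<psi>) = m" using degree_ev_le[of 1 \<psi>] \<psi>(1) le_degree[of "ev 1 \<psi>" m] by simp
    have "lead_coeff (ev 1 \<psi>) = 1" using \<open>coeff (ev 1 \<psi>) m = 1\<close> deg by simp
    from monic_dvd_linear_power[OF dv this] have "ev 1 \<psi> = [:- \<phi> y0, 1:] ^ m" unfolding deg .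
    then show ?thesis using Ty0 coeff_linear_power_pred[OF m(2), of "\<phi> y0"] m(1) by simp
  qed
  then show ?thesis using T(1) by (intro bexI[of _ T]) blast+
qed

text \<open>  If \<open>p = F a\<close> is a completely ramified point, let \<open>\<phi>\<close> be the multiple of a coordinate with \<open>\<phi> p = H a\<close>. The
  forms \<open>g\<close>, the minors \<open>p\<^sub>j F\<^sub>i - p\<^sub>i F\<^sub>j\<close>, cut out the multiples of \<open>a\<close>, where \<open>H - \<phi> \<circ> F\<close> vanishes by
  homogeneity, so a power of it lies in the ideal of the minors. These vanish on the multiples of
  \<open>p\<close>, hence \<open>trace_exists\<close> gives the trace at every \<open>c p\<close>. It is linear in \<open>c\<close>, so the component of degree
  \<open>1\<close> of \<open>T\<close> has the same value at \<open>p\<close>.\<close>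

theorem trace_form:
  assumes H: "H \<in> form q"
  shows "\<exists>L\<in>form 1. \<forall>a. a \<noteq> 0 \<and> (\<forall>x. F x \<in> vec.span {F a} \<longrightarrow> x \<in> vec.span {a}) \<longrightarrow>
     L (F a) = of_nat (q ^ CARD('n)) * H a"
proof -
  have HA: "H \<in> polA UNIV" using H form_imp_pol polA_UNIV_iff by blast
  have FA: "(\<lambda>x. F x $ i) \<in> polA UNIV" for i using F form_imp_pol polA_UNIV_iff by blast
  from generation obtain D0 where gen: "\<forall>f\<in>polA UNIV. \<exists>r. (\<forall>\<beta>. r \<beta> \<in> polA UNIV) \<and>
     (\<forall>x. f x = (\<Sum>\<beta> | wt \<beta> < D0. r \<beta> (F x) * pmon \<beta> x))" by (elim exE)
  from trace_exists[OF HA gen] obtain T where T: "T \<in> polA UNIV" and T': "\<forall>y0 \<kappa> \<phi>. \<kappa> \<ge> 1 \<and> \<phi> \<in> polA UNIV \<and>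
    (\<forall>f\<in>polA UNIV. \<exists>D. (\<forall>\<beta>. D \<beta> \<in> polA UNIV \<and> D \<beta> y0 = 0) \<and>
       (\<forall>x. (H x - \<phi> (F x)) ^ \<kappa> * f x = (\<Sum>\<beta> | wt \<beta> < D0. D \<beta> (F x) * pmon \<beta> x))) \<longrightarrow>
    T y0 = - of_nat (q ^ CARD('n)) * \<phi> y0" by (elim bexE)
  have T_eq: "T y0 = - of_nat (q ^ CARD('n)) * \<phi> y0" if "\<kappa> \<ge> 1" "\<phi> \<in> polA UNIV"
    "\<And>f. f \<in> polA UNIV \<Longrightarrow> \<exists>D. (\<forall>\<beta>. D \<beta> \<in> polA UNIV \<and> D \<beta> y0 = 0) \<and>
       (\<forall>x. (H x - \<phi> (F x)) ^ \<kappa> * f x = (\<Sum>\<beta> | wt \<beta> < D0. D \<beta> (F x) * pmon \<beta> x))" for y0 \<kappa> \<phi>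
    using T'[rule_format, of \<kappa> \<phi> y0] that by blast
  have "(- 1) * hpart 1 T (F a) = of_nat (q ^ CARD('n)) * H a"
    if a: "a \<noteq> 0" "\<And>x. F x \<in> vec.span {F a} \<Longrightarrow> x \<in> vec.span {a}" for a
  proof -
    define p where "p = F a"
    have "p \<noteq> 0" using nz a(1) by (auto simp: p_def)
    then obtain i0 where i0: "p $ i0 \<noteq> 0" by (auto simp: Finite_Cartesian_Product.vec_eq_iff)
    define \<phi> where "\<phi> = (\<lambda>y :: 'k ^ 'n. H a / p $ i0 * y $ i0)"
    have \<phi>: "\<phi> \<in> polA UNIV" unfolding \<phi>_def by (intro polA_scale polA_coord) simp
    have H': "(\<lambda>x. H x - \<phi> (F x)) \<in> form q" unfolding \<phi>_def by (intro form_diff H form_scale F)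
    define g where "g = (\<lambda>(i, j) x. p $ j * F x $ i - p $ i * F x $ j)"
    have "\<exists>\<kappa> K. q \<le> \<kappa> * q \<and> (\<forall>j\<in>UNIV. K j \<in> form (\<kappa> * q - q)) \<and>
       (\<forall>x. (H x - \<phi> (F x)) ^ \<kappa> = (\<Sum>j\<in>UNIV. g j x * K j x))"
    proof (rule homogeneous_nullstellensatz[OF _ _ q H' q])
      fix x assume zero: "\<And>j. j \<in> UNIV \<Longrightarrow> g j x = 0"
      have "F x = (F x $ i0 / p $ i0) *s p"
      proof (subst Finite_Cartesian_Product.vec_eq_iff, intro allI)
        fix i
        have "p $ i0 * F x $ i - p $ i * F x $ i0 = 0" using zero[of "(i, i0)"] by (simp add: g_def)
        then show "F x $ i = ((F x $ i0 / p $ i0) *s p) $ i" using i0 by (simp add: field_simps)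
      qed
      then have "F x \<in> vec.span {F a}" unfolding p_def vec.span_singleton by blast
      then obtain c where c: "x = c *s a" using a(2)[of x] unfolding vec.span_singleton by blast
      have "H x = c ^ q * H a" unfolding c by (rule form_scaling[OF H])
      moreover have "F x $ i0 = c ^ q * p $ i0" unfolding c p_def by (rule form_scaling[OF F])
      ultimately show "H x - \<phi> (F x) = 0" using i0 by (simp add: \<phi>_def)
    next
      fix j :: "'n \<times> 'n"
      show "g j \<in> form q" unfolding g_def by (cases j) (auto intro!: form_diff form_scale F)
    qed simp
    then obtain \<kappa> K where \<kappa>: "q \<le> \<kappa> * q" and K: "\<And>j. K j \<in> form (\<kappa> * q - q)"
      and eq: "\<And>x. (H x - \<phi> (F x)) ^ \<kappa> = (\<Sum>j\<in>UNIV. g j x * K j x)" by blast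
    have \<kappa>1: "\<kappa> \<ge> 1" using \<kappa> q by (cases \<kappa>) auto
    have KA: "K j \<in> polA UNIV" for j using K form_imp_pol polA_UNIV_iff by blast
    have Tp: "T (c *s p) = - of_nat (q ^ CARD('n)) * (c * H a)" for c
    proof -
      have "T (c *s p) = - of_nat (q ^ CARD('n)) * \<phi> (c *s p)"
      proof (rule T_eq[OF \<kappa>1 \<phi>])
        fix f :: "'k ^ 'n \<Rightarrow> 'k" assume f: "f \<in> polA UNIV"
        have "\<forall>j. \<exists>r. (\<forall>\<beta>. r \<beta> \<in> polA UNIV) \<and> (\<forall>x. K j x * f x = (\<Sum>\<beta> | wt \<beta> < D0. r \<beta> (F x) * pmon \<beta> x))"
          using bspec[OF gen polA_mult[OF KA f]] by blast
        from choice[OF this] obtain r where rr: "\<forall>j. (\<forall>\<beta>. r j \<beta> \<in> polA UNIV) \<and>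
          (\<forall>x. K j x * f x = (\<Sum>\<beta> | wt \<beta> < D0. r j \<beta> (F x) * pmon \<beta> x))" by (elim exE)
        have r: "\<And>j \<beta>. r j \<beta> \<in> polA UNIV"
          "\<And>j x. K j x * f x = (\<Sum>\<beta> | wt \<beta> < D0. r j \<beta> (F x) * pmon \<beta> x)" using rr by blast+
        define D where "D = (\<lambda>\<beta> y. \<Sum>j\<in>UNIV. (p $ snd j * y $ fst j - p $ fst j * y $ snd j) * r j \<beta> y)"
        have "D \<beta> \<in> polA UNIV" for \<beta>
          unfolding D_def by (intro polA_sum polA_mult polA_diff polA_scale polA_coord r) auto
        moreover have "D \<beta> (c *s p) = 0" for \<beta> by (simp add: D_def mult_ac)
        moreover have "(H x - \<phi> (F x)) ^ \<kappa> * f x = (\<Sum>\<beta> | wt \<beta> < D0. D \<beta> (F x) * pmon \<beta> x)" for x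
        proof -
          have "(H x - \<phi> (F x)) ^ \<kappa> * f x = (\<Sum>j\<in>UNIV. g j x * (K j x * f x))"
            by (simp add: eq sum_distrib_right mult.assoc)
          also have "\<dots> = (\<Sum>j\<in>UNIV. \<Sum>\<beta> | wt \<beta> < D0. g j x * r j \<beta> (F x) * pmon \<beta> x)"
            by (simp add: r(2) sum_distrib_left mult.assoc)
          also have "\<dots> = (\<Sum>\<beta> | wt \<beta> < D0. D \<beta> (F x) * pmon \<beta> x)"
            unfolding D_def sum_distrib_right g_def by (simp add: case_prod_unfold) (rule sum.swap)
          finally show ?thesis .
        qed
        ultimately show "\<exists>D. (\<forall>\<beta>. D \<beta> \<in> polA UNIV \<and> D \<beta> (c *s p) = 0) \<and>
          (\<forall>x. (H x - \<phi> (F x)) ^ \<kappa> * f x = (\<Sum>\<beta> | wt \<beta> < D0. D \<beta> (F x) * pmon \<beta> x))" by blast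
      qed
      then show ?thesis using i0 by (simp add: \<phi>_def)
    qed
    \<comment> \<open>the polynomial \<open>c \<mapsto> T (c p)\<close>, whose linear coefficient is \<open>hpart 1 T p\<close>\<close>
    have "ray T p = [:0, - of_nat (q ^ CARD('n)) * H a:]"
      by (rule rayI) (simp add: Tp mult_ac)
    then show ?thesis by (simp add: hpart_def p_def)
  qed
  moreover obtain d where "T \<in> pol d" using T polA_UNIV_iff by blast
  then have "(\<lambda>y. (- 1) * hpart 1 T y) \<in> form 1" by (intro form_scale hpart_form)
  ultimately show ?thesis by (intro bexI[of _ "\<lambda>y. (- 1) * hpart 1 T y"]) blast+
qed

end

section \<open>Independence of the images\<close>

lemma wt_eq_1: "wt \<alpha> = 1 \<Longrightarrow> \<exists>a. \<alpha> = (\<lambda>i. if i = a then 1 else 0)"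
proof -
  assume wt: "wt \<alpha> = 1"
  then obtain a where a: "\<alpha> a \<noteq> 0" unfolding wt_def by (metis sum.neutral zero_neq_one)
  have "wt \<alpha> = \<alpha> a + (\<Sum>i\<in>UNIV-{a}. \<alpha> i)" unfolding wt_def by (rule sum.remove) auto
  then have 1: "\<alpha> a = 1" and "(\<Sum>i\<in>UNIV-{a}. \<alpha> i) = 0" using wt a by linarith+
  then have "\<forall>i\<in>UNIV-{a}. \<alpha> i = 0" by (subst (asm) sum_eq_0_iff) auto
  then have "\<alpha> = (\<lambda>i. if i = a then 1 else 0)" using 1 by (auto simp: fun_eq_iff)
  then show ?thesis by blast
qed

lemma form_1_add:
  assumes "L \<in> form 1" shows "L (x + y) = L x + L y"
  using assms unfolding form_def
proof (induction rule: pspan_induct)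
  case (add c \<alpha> g)
  then obtain a where "\<alpha> = (\<lambda>i. if i = a then 1 else 0)" using wt_eq_1[of \<alpha>] by auto
  then have pm: "pmon \<alpha> z = z $ a" for z :: "'a ^ 'b" by (simp only: pmon_unit)
  show ?case unfolding pm using add(2) by (simp add: algebra_simps)
qed simp

lemma form_1_sum:
  assumes "L \<in> form 1" shows "L (\<Sum>t\<in>T. u t *s t) = (\<Sum>t\<in>T. u t * L t)"
proof (induction T rule: infinite_finite_induct)
  case (insert t T)
  then show ?case using form_scaling[OF assms, of "u t" t] by (simp add: form_1_add[OF assms])
qed (use form_scaling[OF assms, of 0 0] in auto)

lemma separating_linear_form:
  fixes a c :: "'k :: field ^ 'n :: finite"
  assumes "a \<noteq> 0" "c \<notin> vec.span {a}"
  shows "\<exists>l\<in>form 1. l a = 0 \<and> l c \<noteq> 0"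
proof -
  obtain i where i: "a $ i \<noteq> 0" using assms(1) by (auto simp: Finite_Cartesian_Product.vec_eq_iff)
  have "\<exists>j. a $ i * c $ j - a $ j * c $ i \<noteq> 0"
  proof (rule ccontr)
    assume "\<nexists>j. a $ i * c $ j - a $ j * c $ i \<noteq> 0"
    then have "c = (c $ i / a $ i) *s a" using i by (auto simp: Finite_Cartesian_Product.vec_eq_iff field_simps)
    then have "c \<in> vec.span {a}" unfolding vec.span_singleton by blast
    then show False using assms(2) by simp
  qed
  then obtain j where j: "a $ i * c $ j - a $ j * c $ i \<noteq> 0" by blast
  have "(\<lambda>x. a $ i * x $ j - a $ j * x $ i) \<in> form 1" by (intro form_diff form_scale coord_form)
  then show ?thesis using j by (intro bexI[of _ "\<lambda>x. a $ i * x $ j - a $ j * x $ i"]) (auto simp: mult.commute)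
qed

text \<open>One linear form for every point of \<open>T\<close>; a coordinate that is not zero at \<open>c\<close> supplies the
  missing factors.\<close>

lemma separating_form:
  fixes \<alpha> :: "'i \<Rightarrow> 'k :: field ^ 'n :: finite"
  assumes T: "finite T" "card T \<le> q" and c: "c \<noteq> 0"
    and \<alpha>: "\<And>t. t \<in> T \<Longrightarrow> \<alpha> t \<noteq> 0" "\<And>t. t \<in> T \<Longrightarrow> c \<notin> vec.span {\<alpha> t}"
  shows "\<exists>H\<in>form q. H c \<noteq> 0 \<and> (\<forall>t\<in>T. H (\<alpha> t) = 0)"
proof -
  have "\<forall>t\<in>T. \<exists>l. l \<in> form 1 \<and> l (\<alpha> t) = 0 \<and> l c \<noteq> 0" using separating_linear_form \<alpha> by blast
  from bchoice[OF this] obtain l where l: "\<forall>t\<in>T. l t \<in> form 1 \<and> l t (\<alpha> t) = 0 \<and> l t c \<noteq> 0" by (elim exE)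
  obtain i where i: "c $ i \<noteq> 0" using c by (auto simp: Finite_Cartesian_Product.vec_eq_iff)
  define H where "H = (\<lambda>x. (\<Prod>t\<in>T. l t x) * (x $ i) ^ (q - card T))"
  have "H \<in> form ((\<Sum>t\<in>T. 1) + (q - card T) * 1)"
    unfolding H_def using l by (intro form_mult form_prod form_power coord_form) auto
  then have "H \<in> form q" using T by simp
  moreover have "H c \<noteq> 0" using l i T by (simp add: H_def)
  moreover have "H (\<alpha> t) = 0" if "t \<in> T" for t
    using l that T by (auto simp: H_def intro!: prod_zero)
  ultimately show ?thesis by blast
qed

lemma vec_independent_card_le:
  fixes S :: "('k :: field ^ 'n :: finite) set"
  assumes "vec.independent S" shows "finite S \<and> card S \<le> CARD('n)"
  using vec.independent_span_bound[of cart_basis S] assms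
  by (simp add: finite_cart_basis card_cart_basis)

context form_map
begin

lemma F_0: "F 0 = 0"
proof -
  have "F 0 $ i = 0" for i
    using form_scaling[OF F, where c = 0 and x = 0, of i] q by (cases q) auto
  then show ?thesis by (simp add: Finite_Cartesian_Product.vec_eq_iff)
qed

text \<open>  In a minimal dependent set \<open>T\<close> the remaining vectors \<open>T - {w}\<close> are independent, so there are at most
  \<open>CARD('n) \<le> q\<close> of them, and a form \<open>H\<close> of degree \<open>q\<close> vanishes at their preimages but not at the
  preimage of \<open>w\<close>. The linear form \<open>L\<close> of \<open>trace_form\<close> then contradicts the relation.\<close>

theorem independent_images:
  assumes qk: "(of_nat q :: 'k) \<noteq> 0" and qn: "CARD('n) \<le> q"
    and \<alpha>: "\<And>w. w \<in> W \<Longrightarrow> F (\<alpha> w) = w" "\<And>w. w \<in> W \<Longrightarrow> w \<noteq> 0"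
    and ram: "\<And>w x. w \<in> W \<Longrightarrow> F x \<in> vec.span {w} \<Longrightarrow> x \<in> vec.span {\<alpha> w}"
    and dist: "\<And>w w'. w \<in> W \<Longrightarrow> w' \<in> W \<Longrightarrow> w \<noteq> w' \<Longrightarrow> \<alpha> w \<notin> vec.span {\<alpha> w'}"
  shows "vec.independent W"
proof (rule ccontr)
  assume "\<not> vec.independent W"
  then obtain T0 u0 where T0: "finite T0" "T0 \<subseteq> W" "\<exists>v\<in>T0. u0 v \<noteq> 0" "(\<Sum>v\<in>T0. u0 v *s v) = 0"
    unfolding vec.dependent_explicit by blast
  then have "\<not> vec.independent T0" unfolding vec.dependent_finite[OF T0(1)] by blast
  define Q where "Q = (\<lambda>T. finite T \<and> T \<subseteq> W \<and> \<not> vec.independent T)"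
  have "Q T0" using T0 \<open>\<not> vec.independent T0\<close> by (simp add: Q_def)
  from arg_min_nat_lemma[of Q, OF this, of card] obtain T where QT: "Q T" and QTmin: "\<And>T'. Q T' \<Longrightarrow> card T \<le> card T'"
    by blast
  have T: "finite T" "T \<subseteq> W" "\<not> vec.independent T" using QT by (simp_all add: Q_def)
  obtain u w where u: "w \<in> T" "u w \<noteq> 0" "(\<Sum>t\<in>T. u t *s t) = 0"
    using T(3) unfolding vec.dependent_finite[OF T(1)] by blast
  have cT: "card (T - {w}) < card T" using u(1) T(1) by (intro psubset_card_mono) auto
  have "\<not> Q (T - {w})" using QTmin[of "T - {w}"] cT by linarith
  then have "vec.independent (T - {w})" using T by (auto simp: Q_def)
  then have "card (T - {w}) \<le> q" using vec_independent_card_le[of "T - {w}"] qn by linarith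
  have \<alpha>0: "\<alpha> t \<noteq> 0" if "t \<in> W" for t
  proof
    assume "\<alpha> t = 0"
    then show False using \<alpha>[OF that] F_0 by simp
  qed
  have "\<exists>H\<in>form q. H (\<alpha> w) \<noteq> 0 \<and> (\<forall>t\<in>T - {w}. H (\<alpha> t) = 0)"
  proof (rule separating_form)
    fix t assume "t \<in> T - {w}"
    then have "t \<in> W" "w \<in> W" "w \<noteq> t" using T(2) u(1) by auto
    then show "\<alpha> t \<noteq> 0" "\<alpha> w \<notin> vec.span {\<alpha> t}" using \<alpha>0 dist by blast+
  qed (use T u \<open>card (T - {w}) \<le> q\<close> \<alpha>0 in auto)
  then obtain H where H: "H \<in> form q" "H (\<alpha> w) \<noteq> 0" "\<And>t. t \<in> T - {w} \<Longrightarrow> H (\<alpha> t) = 0" by blast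
  from trace_form[OF H(1)] obtain L where L: "L \<in> form 1" and L': "\<forall>a. a \<noteq> 0 \<and> (\<forall>x. F x \<in> vec.span {F a} \<longrightarrow> x \<in> vec.span {a}) \<longrightarrow>
     L (F a) = of_nat (q ^ CARD('n)) * H a" by (elim bexE)
  have LF: "L t = of_nat (q ^ CARD('n)) * H (\<alpha> t)" if "t \<in> W" for t
    using L'[rule_format, of "\<alpha> t"] \<alpha>0[OF that] ram[OF that] \<alpha>(1)[OF that] by simp
  have "0 = (\<Sum>t\<in>T. u t * L t)" using form_1_sum[OF L, of u T] u(3) form_scaling[OF L, of 0 0] by simp
  also have "\<dots> = u w * L w + (\<Sum>t\<in>T-{w}. u t * L t)" using u(1) T(1) by (simp add: sum.remove)
  also have "(\<Sum>t\<in>T-{w}. u t * L t) = 0" using H(3) LF T(2) by (intro sum.neutral) auto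
  finally have "u w * (of_nat (q ^ CARD('n)) * H (\<alpha> w)) = 0" using LF[of w] u(1) T(2) by auto
  then show False using u(2) H(2) qk by simp
qed

end

section \<open>Points and local fractions\<close>

definition pt :: "'k :: field ^ 'n :: finite \<Rightarrow> ('k, 'n) proj" where
  "pt v = Abs_proj (vec.span {v})"

lemma line_pt: "v \<noteq> 0 \<Longrightarrow> line (pt v) = vec.span {v}"
  unfolding pt_def by (rule Abs_proj_inverse) auto

lemma in_line_pt: "v \<noteq> 0 \<Longrightarrow> v \<in> line (pt v)"
  by (simp add: line_pt vec.span_base)

lemma pt_eqI:
  assumes "v \<in> line p" "v \<noteq> 0" shows "pt v = p"
proof -
  obtain u where u: "u \<noteq> 0" "line p = vec.span {u}" by (rule line_eq_span)
  then obtain c where c: "v = c *s u" using assms(1) by (auto simp: vec.span_singleton)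
  then have "c \<noteq> 0" using assms(2) by auto
  have "vec.span {v} = vec.span {u}"
  proof (intro equalityI subsetI)
    fix x assume "x \<in> vec.span {v}"
    then show "x \<in> vec.span {u}" unfolding vec.span_singleton c by (auto simp: vector_smult_assoc)
  next
    fix x assume "x \<in> vec.span {u}"
    then obtain d where "x = d *s u" by (auto simp: vec.span_singleton)
    then have "x = (d / c) *s v" using \<open>c \<noteq> 0\<close> by (simp add: c vector_smult_assoc)
    then show "x \<in> vec.span {v}" unfolding vec.span_singleton by blast
  qed
  then show ?thesis using u(2) line_pt[OF assms(2)] by (metis line_inject)
qed

definition rep :: "('k :: field, 'n :: finite) proj \<Rightarrow> 'k ^ 'n" where
  "rep p = (SOME v. v \<in> line p \<and> v \<noteq> 0)"

lemma rep: "rep p \<in> line p" "rep p \<noteq> 0"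
proof -
  obtain u where "u \<noteq> 0" "line p = vec.span {u}" by (rule line_eq_span)
  then have "\<exists>v. v \<in> line p \<and> v \<noteq> 0" by (auto intro: vec.span_base)
  from someI_ex[OF this] show "rep p \<in> line p" "rep p \<noteq> 0" by (auto simp: rep_def)
qed

lemma pt_rep [simp]: "pt (rep p) = p"
  using rep pt_eqI by blast

lemma in_line_scale:
  assumes "v \<in> line p" "w \<in> line p" "v \<noteq> 0" "w \<noteq> 0"
  obtains c where "c \<noteq> 0" "w = c *s v"
proof -
  have "line p = vec.span {v}" using pt_eqI[OF assms(1,3)] line_pt[OF assms(3)] by simp
  then obtain c where "w = c *s v" using assms(2) by (auto simp: vec.span_singleton)
  then show ?thesis using that assms(4) by auto
qed

lemma pt_scale: "v \<noteq> 0 \<Longrightarrow> c \<noteq> 0 \<Longrightarrow> pt (c *s v) = pt v"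
proof (rule pt_eqI)
  assume "v \<noteq> 0" then show "c *s v \<in> line (pt v)" unfolding line_pt[OF \<open>v \<noteq> 0\<close>] vec.span_singleton by blast
qed simp

lemma homogeneous_mpoly_form: "homogeneous d P \<Longrightarrow> mpoly_eval P \<in> form d"
proof -
  assume P: "homogeneous d P"
  have "(\<lambda>x. \<Sum>m\<in>Poly_Mapping.keys P. Poly_Mapping.lookup P m * pmon (Poly_Mapping.lookup m) x) \<in> form d"
  proof (intro form_sum form_scale)
    fix m assume "m \<in> Poly_Mapping.keys P"
    then have "wt (Poly_Mapping.lookup m) = d" using P by (simp add: homogeneous_def wt_def)
    then show "pmon (Poly_Mapping.lookup m) \<in> form d" using pmon_form by metis
  qed
  then show ?thesis by (simp add: mpoly_eval_def[abs_def] pmon_def)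
qed

lemma homogeneous_add: "homogeneous d P \<Longrightarrow> homogeneous d Q \<Longrightarrow> homogeneous d (P + Q)"
  using Poly_Mapping.keys_add[of P Q] by (fastforce simp: homogeneous_def)

lemma form_imp_mpoly: "f \<in> form d \<Longrightarrow> \<exists>P. homogeneous d P \<and> f = mpoly_eval P"
  unfolding form_def
proof (induction rule: pspan_induct)
  case zero
  show ?case by (intro exI[of _ 0]) (auto simp: homogeneous_def)
next
  case (add c \<alpha> g)
  then obtain P where P: "homogeneous d P" "g = mpoly_eval P" by blast
  let ?m = "Poly_Mapping.Abs_poly_mapping \<alpha>"
  have m: "Poly_Mapping.lookup ?m = \<alpha>" by (simp add: Abs_poly_mapping_inverse)
  have "homogeneous d (Poly_Mapping.single ?m c)"
    using add(1) by (auto simp: homogeneous_def m wt_def)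
  moreover have "mpoly_eval (Poly_Mapping.single ?m c + P) x = c * pmon \<alpha> x + g x" for x
    by (simp add: mpoly_eval_add mpoly_eval_single m P pmon_def)
  ultimately show ?case using P(1) homogeneous_add
    by (intro exI[of _ "Poly_Mapping.single ?m c + P"]) (auto simp: fun_eq_iff)
qed

definition basic :: "('k :: field ^ 'n :: finite \<Rightarrow> 'k) \<Rightarrow> ('k, 'n) proj set" where
  "basic g = {x. \<exists>v\<in>line x. g v \<noteq> 0}"

lemma basic_iff:
  assumes "g \<in> form b" "v \<noteq> 0" shows "pt v \<in> basic g \<longleftrightarrow> g v \<noteq> 0"
proof
  assume "pt v \<in> basic g"
  then obtain c where "g (c *s v) \<noteq> 0" by (auto simp: basic_def line_pt[OF assms(2)] vec.span_singleton)
  then show "g v \<noteq> 0" by (auto simp: form_scaling[OF assms(1)])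
qed (use in_line_pt[OF assms(2)] in \<open>auto simp: basic_def\<close>)

lemma open_basic: "g \<in> form b \<Longrightarrow> openin zariski (basic g)"
proof -
  assume "g \<in> form b"
  then obtain P where P: "homogeneous b P" "g = mpoly_eval P" using form_imp_mpoly by blast
  then have "basic g = - proj_zeros {P}" by (auto simp: basic_def proj_zeros_def)
  then show ?thesis using P(1) unfolding openin_zariski by blast
qed

text \<open>The form \<open>g\<close> defines a basic open neighbourhood of \<open>pt v\<close> inside \<open>U\<close>.\<close>

definition cuts :: "('k :: field, 'n :: finite) proj set \<Rightarrow> 'k ^ 'n \<Rightarrow> nat \<Rightarrow> ('k ^ 'n \<Rightarrow> 'k) \<Rightarrow> bool" where
  "cuts U v b g \<longleftrightarrow> g \<in> form b \<and> g v \<noteq> 0 \<and> (\<forall>w. w \<noteq> 0 \<and> g w \<noteq> 0 \<longrightarrow> pt w \<in> U)"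

definition fraction_at :: "('k :: field, 'n :: finite) proj set \<Rightarrow> int \<Rightarrow> ('k ^ 'n \<Rightarrow> 'k) \<Rightarrow> 'k ^ 'n \<Rightarrow>
    nat \<Rightarrow> nat \<Rightarrow> ('k ^ 'n \<Rightarrow> 'k) \<Rightarrow> ('k ^ 'n \<Rightarrow> 'k) \<Rightarrow> bool" where
  "fraction_at U d \<tau> v a b f g \<longleftrightarrow> f \<in> form a \<and> int a = int b + d \<and> cuts U v b g \<and>
     (\<forall>w. w \<noteq> 0 \<and> g w \<noteq> 0 \<longrightarrow> \<tau> w = f w / g w)"

lemma cutsD:
  assumes "cuts U v b g"
  shows "g \<in> form b" "g v \<noteq> 0" "\<And>w. w \<noteq> 0 \<Longrightarrow> g w \<noteq> 0 \<Longrightarrow> pt w \<in> U"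
  using assms by (simp_all add: cuts_def)

lemma fraction_atD:
  assumes "fraction_at U d \<tau> v a b f g"
  shows "f \<in> form a" "g \<in> form b" "int a = int b + d" "g v \<noteq> 0"
    "\<And>w. w \<noteq> 0 \<Longrightarrow> g w \<noteq> 0 \<Longrightarrow> pt w \<in> U" "\<And>w. w \<noteq> 0 \<Longrightarrow> g w \<noteq> 0 \<Longrightarrow> \<tau> w = f w / g w"
  using assms by (simp_all add: cuts_def fraction_at_def)

lemma fraction_atI:
  assumes "f \<in> form a" "g \<in> form b" "int a = int b + d" "g v \<noteq> 0"
    "\<And>w. w \<noteq> 0 \<Longrightarrow> g w \<noteq> 0 \<Longrightarrow> pt w \<in> U \<and> \<tau> w = f w / g w"
  shows "\<exists>a b f g. fraction_at U d \<tau> v a b f g"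
proof -
  have "fraction_at U d \<tau> v a b f g" using assms by (simp add: cuts_def fraction_at_def)
  then show ?thesis by (intro exI)
qed

lemma open_cuts:
  assumes "openin zariski U" "v \<noteq> 0" "pt v \<in> U"
  shows "\<exists>b g. cuts U v b g"
proof -
  obtain S where S: "\<forall>P\<in>S. \<exists>d. homogeneous d P" "U = - proj_zeros S" using assms(1) openin_zariski by blast
  then obtain P w where P: "P \<in> S" "w \<in> line (pt v)" "mpoly_eval P w \<noteq> 0" using assms(3) by (auto simp: proj_zeros_def)
  obtain d where d: "homogeneous d P" using S P by blast
  have g: "mpoly_eval P \<in> form d" by (rule homogeneous_mpoly_form[OF d])
  have "pt v \<in> basic (mpoly_eval P)" using P by (auto simp: basic_def)
  then have "mpoly_eval P v \<noteq> 0" using basic_iff[OF g assms(2)] by simp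
  moreover have "pt w \<in> U" if "w \<noteq> 0" "mpoly_eval P w \<noteq> 0" for w
    using in_line_pt[OF that(1)] that P(1) S(2) by (auto simp: proj_zeros_def)
  ultimately have "cuts U v d (mpoly_eval P)" using g by (simp add: cuts_def)
  then show ?thesis by (intro exI)
qed

lemma topspace_zariski [simp]: "topspace zariski = UNIV"
proof -
  have "openin zariski (UNIV :: ('a :: field, 'b :: finite) proj set)"
  proof -
    have "basic (\<lambda>_ :: 'a ^ 'b. 1) = UNIV" using rep by (fastforce simp: basic_def)
    then show ?thesis using open_basic[OF form_const] by metis
  qed
  then show ?thesis using openin_subset by blast
qed

lemma open_UNIV [simp]: "openin zariski UNIV"
  using openin_topspace[of zariski] by simp

text \<open>  Sections of \<open>\<O>(d)\<close> over \<open>U\<close>, seen as functions \<open>\<tau>\<close> of nonzero vectors: a section \<open>s\<close> corresponds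
  to \<open>\<tau> v = s (pt v) v\<close>, and a regular function is the case \<open>d = 0\<close>. On this side no representative of a point
  has to be chosen. Every local expression \<open>f / g\<close> is taken on the basic open set of its own
  denominator.\<close>

definition loc_frac :: "('k :: field, 'n :: finite) proj set \<Rightarrow> int \<Rightarrow> ('k ^ 'n \<Rightarrow> 'k) \<Rightarrow> bool" where
  "loc_frac U d \<tau> \<longleftrightarrow> (\<forall>v. v \<noteq> 0 \<and> pt v \<in> U \<longrightarrow> (\<exists>a b f g. fraction_at U d \<tau> v a b f g))"

lemma loc_fracI: "(\<And>v. v \<noteq> 0 \<Longrightarrow> pt v \<in> U \<Longrightarrow> \<exists>a b f g. fraction_at U d \<tau> v a b f g) \<Longrightarrow> loc_frac U d \<tau>"
  by (simp add: loc_frac_def)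

lemma loc_fracD: "loc_frac U d \<tau> \<Longrightarrow> v \<noteq> 0 \<Longrightarrow> pt v \<in> U \<Longrightarrow> \<exists>a b f g. fraction_at U d \<tau> v a b f g"
  by (simp add: loc_frac_def)

lemma loc_frac_local:
  assumes "\<And>v. v \<noteq> 0 \<Longrightarrow> pt v \<in> U \<Longrightarrow> \<exists>W. pt v \<in> W \<and> W \<subseteq> U \<and> loc_frac W d \<tau>"
  shows "loc_frac U d \<tau>"
proof (rule loc_fracI)
  fix v :: "'a ^ 'b" assume v: "v \<noteq> 0" "pt v \<in> U"
  from assms[OF this] obtain W where W: "pt v \<in> W" "W \<subseteq> U" "loc_frac W d \<tau>" by blast
  obtain a b f g where fr: "fraction_at W d \<tau> v a b f g"
    using loc_fracD[OF W(3) v(1) W(1)] by (elim exE) (rule that)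
  note 1 = fraction_atD[OF fr]
  show "\<exists>a b f g. fraction_at U d \<tau> v a b f g"
    by (rule fraction_atI[OF 1(1-4)]) (use 1(5,6) W(2) in auto)
qed

lemma loc_frac_subset:
  assumes "loc_frac U d \<tau>" "openin zariski V" "V \<subseteq> U"
  shows "loc_frac V d \<tau>"
proof (rule loc_fracI)
  fix v :: "'a ^ 'b" assume v: "v \<noteq> 0" "pt v \<in> V"
  obtain a b f g where fr: "fraction_at U d \<tau> v a b f g"
    using loc_fracD[OF assms(1) v(1) subsetD[OF assms(3) v(2)]] by (elim exE) (rule that)
  note 1 = fraction_atD[OF fr]
  obtain c h where cu: "cuts V v c h" using open_cuts[OF assms(2) v] by (elim exE) (rule that)
  note 2 = cutsD[OF cu]
  show "\<exists>a b f g. fraction_at V d \<tau> v a b f g"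
    by (rule fraction_atI[OF form_mult[OF 1(1) 2(1)] form_mult[OF 1(2) 2(1)]]) (use 1 2 in auto)
qed

lemma loc_frac_cong:
  assumes "loc_frac U d \<tau>" "\<And>v. v \<noteq> 0 \<Longrightarrow> pt v \<in> U \<Longrightarrow> \<tau>' v = \<tau> v"
  shows "loc_frac U d \<tau>'"
proof (rule loc_fracI)
  fix v :: "'a ^ 'b" assume v: "v \<noteq> 0" "pt v \<in> U"
  obtain a b f g where fr: "fraction_at U d \<tau> v a b f g"
    using loc_fracD[OF assms(1) v] by (elim exE) (rule that)
  note 1 = fraction_atD[OF fr]
  show "\<exists>a b f g. fraction_at U d \<tau>' v a b f g"
    by (rule fraction_atI[OF 1(1-4)]) (use 1(5,6) assms(2) in auto)
qed

lemma loc_frac_form: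
  assumes "f \<in> form a" "openin zariski U" shows "loc_frac U (int a) f"
proof (rule loc_fracI)
  fix v :: "'a ^ 'b" assume v: "v \<noteq> 0" "pt v \<in> U"
  obtain c h where cu: "cuts U v c h" using open_cuts[OF assms(2) v] by (elim exE) (rule that)
  note 2 = cutsD[OF cu]
  show "\<exists>a' b f' g. fraction_at U (int a) f v a' b f' g"
    by (rule fraction_atI[OF form_mult[OF assms(1) 2(1)] 2(1)]) (use 2 in auto)
qed

lemma loc_frac_mult:
  assumes "loc_frac U d \<tau>" "loc_frac U e \<sigma>" shows "loc_frac U (d + e) (\<lambda>v. \<tau> v * \<sigma> v)"
proof (rule loc_fracI)
  fix v :: "'a ^ 'b" assume v: "v \<noteq> 0" "pt v \<in> U"
  obtain a b f g where fr: "fraction_at U d \<tau> v a b f g"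
    using loc_fracD[OF assms(1) v] by (elim exE) (rule that)
  note 1 = fraction_atD[OF fr]
  obtain a' b' f' g' where fr': "fraction_at U e \<sigma> v a' b' f' g'"
    using loc_fracD[OF assms(2) v] by (elim exE) (rule that)
  note 2 = fraction_atD[OF fr']
  show "\<exists>a b f g. fraction_at U (d + e) (\<lambda>v. \<tau> v * \<sigma> v) v a b f g"
    by (rule fraction_atI[OF form_mult[OF 1(1) 2(1)] form_mult[OF 1(2) 2(2)]]) (use 1 2 in auto)
qed

lemma loc_frac_add:
  assumes "loc_frac U d \<tau>" "loc_frac U d \<sigma>" shows "loc_frac U d (\<lambda>v. \<tau> v + \<sigma> v)"
proof (rule loc_fracI)
  fix v :: "'a ^ 'b" assume v: "v \<noteq> 0" "pt v \<in> U"
  obtain a b f g where fr: "fraction_at U d \<tau> v a b f g"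
    using loc_fracD[OF assms(1) v] by (elim exE) (rule that)
  note 1 = fraction_atD[OF fr]
  obtain a' b' f' g' where fr': "fraction_at U d \<sigma> v a' b' f' g'"
    using loc_fracD[OF assms(2) v] by (elim exE) (rule that)
  note 2 = fraction_atD[OF fr']
  have "a + b' = a' + b" using 1(3) 2(3) by linarith
  then have num: "(\<lambda>x. f x * g' x + f' x * g x) \<in> form (a + b')"
    using form_mult[OF 1(1) 2(2)] form_mult[OF 2(1) 1(2)] by (intro form_add) auto
  show "\<exists>a b f g. fraction_at U d (\<lambda>v. \<tau> v + \<sigma> v) v a b f g"
    by (rule fraction_atI[OF num form_mult[OF 1(2) 2(2)]]) (use 1 2 in \<open>auto simp: add_frac_eq\<close>)
qed

lemma loc_frac_zero: "openin zariski U \<Longrightarrow> loc_frac U d (\<lambda>v :: 'k :: field ^ 'n :: finite. 0)"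
proof (rule loc_fracI)
  fix v :: "'k ^ 'n" assume U: "openin zariski U" and v: "v \<noteq> 0" "pt v \<in> U"
  obtain c h where cu: "cuts U v c h" using open_cuts[OF U v] by (elim exE) (rule that)
  note 2 = cutsD[OF cu]
  obtain i where i: "v $ i \<noteq> 0" using v(1) by (auto simp: Finite_Cartesian_Product.vec_eq_iff)
  have g: "(\<lambda>x. h x * (x $ i) ^ nat (- d)) \<in> form (c + nat (- d) * 1)"
    using 2(1) by (intro form_mult form_power coord_form)
  show "\<exists>a b f g. fraction_at U d (\<lambda>v. 0) v a b f g"
    by (rule fraction_atI[OF form_zero[of "c + nat d"] g]) (use 2 i in auto)
qed

lemma loc_frac_sum:
  fixes m :: nat
  assumes "openin zariski U" "\<And>j. j < m \<Longrightarrow> loc_frac U d (\<tau> j)" shows "loc_frac U d (\<lambda>v. \<Sum>j<m. \<tau> j v)"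
  using assms by (induction m) (auto intro: loc_frac_zero loc_frac_add)

lemma loc_frac_divide:
  assumes "loc_frac U d \<tau>" "h \<in> form c" "\<And>v. v \<noteq> 0 \<Longrightarrow> pt v \<in> U \<Longrightarrow> h v \<noteq> 0"
  shows "loc_frac U (d - int c) (\<lambda>v. \<tau> v / h v)"
proof (rule loc_fracI)
  fix v :: "'a ^ 'b" assume v: "v \<noteq> 0" "pt v \<in> U"
  obtain a b f g where fr: "fraction_at U d \<tau> v a b f g"
    using loc_fracD[OF assms(1) v] by (elim exE) (rule that)
  note 1 = fraction_atD[OF fr]
  show "\<exists>a b f g. fraction_at U (d - int c) (\<lambda>v. \<tau> v / h v) v a b f g"
    by (rule fraction_atI[OF 1(1) form_mult[OF 1(2) assms(2)]]) (use 1 assms(3)[OF v] in auto)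
qed

lemma loc_frac_scaling:
  assumes "loc_frac U d \<tau>" "v \<noteq> 0" "pt v \<in> U" "c \<noteq> 0" "d \<ge> 0"
  shows "\<tau> (c *s v) = c ^ nat d * \<tau> v"
proof -
  obtain a b f g where fr: "fraction_at U d \<tau> v a b f g"
    using loc_fracD[OF assms(1,2,3)] by (elim exE) (rule that)
  note 1 = fraction_atD[OF fr]
  have a: "a = b + nat d" using 1(3) assms(5) by linarith
  have "g (c *s v) \<noteq> 0" using 1(4) assms(4) by (simp add: form_scaling[OF 1(2)])
  then have "\<tau> (c *s v) = f (c *s v) / g (c *s v)" using assms by (intro 1(6)) auto
  also have "\<dots> = c ^ nat d * (f v / g v)"
    using assms(4) by (simp add: form_scaling[OF 1(1)] form_scaling[OF 1(2)] a power_add)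
  finally show ?thesis using 1(6)[OF assms(2) 1(4)] by simp
qed

text \<open>An open neighbourhood can be shrunk to a basic open set, and the form that defines it can be
  multiplied into numerator and denominator of the fraction.\<close>

lemma local_fraction_iff:
  fixes U :: "('k :: field, 'n :: finite) proj set"
  shows "(\<forall>p\<in>U. \<exists>W a b F G. openin zariski W \<and> p \<in> W \<and> W \<subseteq> U \<and>
        homogeneous a F \<and> homogeneous b G \<and> int a = int b + d \<and>
        (\<forall>x\<in>W. \<forall>v \<in> line x - {0}. mpoly_eval G v \<noteq> 0 \<and> s x v = mpoly_eval F v / mpoly_eval G v))
   \<longleftrightarrow> loc_frac U d (\<lambda>v. s (pt v) v)" (is "?L \<longleftrightarrow> ?R")
proof
  assume L: ?L
  show ?R
  proof (rule loc_fracI)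
    fix v :: "'k ^ 'n" assume v: "v \<noteq> 0" "pt v \<in> U"
    from bspec[OF L v(2)] obtain W a b F G where W: "openin zariski W" "pt v \<in> W" "W \<subseteq> U"
      and h: "homogeneous a F" "homogeneous b G" "int a = int b + d"
      and e: "\<forall>x\<in>W. \<forall>v \<in> line x - {0}. mpoly_eval G v \<noteq> 0 \<and> s x v = mpoly_eval F v / mpoly_eval G v"
      by (elim exE conjE) (rule that)
    obtain c g where cu: "cuts W v c g" using open_cuts[OF W(1) v(1) W(2)] by (elim exE) (rule that)
    note g = cutsD[OF cu]
    have e': "mpoly_eval G w \<noteq> 0 \<and> s (pt w) w = mpoly_eval F w / mpoly_eval G w" if "w \<noteq> 0" "pt w \<in> W" for w
      using e that in_line_pt[OF that(1)] by blast
    show "\<exists>a b f g. fraction_at U d (\<lambda>v. s (pt v) v) v a b f g"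
      by (rule fraction_atI[OF form_mult[OF homogeneous_mpoly_form[OF h(1)] g(1)] form_mult[OF homogeneous_mpoly_form[OF h(2)] g(1)]])
        (use h(3) g(2,3) e' W v in auto)
  qed
next
  assume R: ?R
  show ?L
  proof
    fix p assume p: "p \<in> U"
    have pr: "pt (rep p) \<in> U" using p by simp
    obtain a b f g where fr: "fraction_at U d (\<lambda>v. s (pt v) v) (rep p) a b f g"
      using loc_fracD[OF R rep(2) pr] by (elim exE) (rule that)
    note 1 = fraction_atD[OF fr]
    obtain F where F: "homogeneous a F" "f = mpoly_eval F" using form_imp_mpoly[OF 1(1)] by blast
    obtain G where G: "homogeneous b G" "g = mpoly_eval G" using form_imp_mpoly[OF 1(2)] by blast
    have in_basic: "g v \<noteq> 0 \<and> pt v = x" if "x \<in> basic g" "v \<in> line x - {0}" for x v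
      using that basic_iff[OF 1(2), of v] pt_eqI[of v x] by auto
    have "basic g \<subseteq> U"
    proof
      fix x assume "x \<in> basic g"
      from in_basic[OF this, of "rep x"] show "x \<in> U" using rep[of x] 1(5)[of "rep x"] by auto
    qed
    moreover have "p \<in> basic g" using basic_iff[OF 1(2) rep(2)[of p]] 1(4) by simp
    moreover have "\<forall>x\<in>basic g. \<forall>v \<in> line x - {0}. mpoly_eval G v \<noteq> 0 \<and> s x v = mpoly_eval F v / mpoly_eval G v"
    proof (intro ballI)
      fix x v assume x: "x \<in> basic g" and v: "v \<in> line x - {0}"
      have "v \<noteq> 0" using v by simp
      then show "mpoly_eval G v \<noteq> 0 \<and> s x v = mpoly_eval F v / mpoly_eval G v"
        using in_basic[OF x v] 1(6)[of v] by (simp add: F(2) G(2))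
    qed
    ultimately show "\<exists>W a b F G. openin zariski W \<and> p \<in> W \<and> W \<subseteq> U \<and>
        homogeneous a F \<and> homogeneous b G \<and> int a = int b + d \<and>
        (\<forall>x\<in>W. \<forall>v \<in> line x - {0}. mpoly_eval G v \<noteq> 0 \<and> s x v = mpoly_eval F v / mpoly_eval G v)"
      using open_basic[OF 1(2)] F(1) G(1) 1(3)
      by (intro exI[of _ "basic g"] exI[of _ a] exI[of _ b] exI[of _ F] exI[of _ G] conjI)
  qed
qed

text \<open>Regular functions are defined with one common degree of numerator and denominator, sections
  with two degrees; this identifies the two forms.\<close>

lemma diagonal_ex: "(\<exists>d F G. A \<and> B \<and> C \<and> h d F \<and> h d G \<and> E F G) \<longleftrightarrow>
    (\<exists>a b F G. A \<and> B \<and> C \<and> h a F \<and> h b G \<and> a = b \<and> E F G)"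
  by blast

lemma regular_on_iff: "regular_on U h \<longleftrightarrow> loc_frac U 0 (\<lambda>v. h (pt v))"
proof -
  have "regular_on U h \<longleftrightarrow> (\<forall>p\<in>U. \<exists>W a b F G. openin zariski W \<and> p \<in> W \<and> W \<subseteq> U \<and>
        homogeneous a F \<and> homogeneous b G \<and> int a = int b + 0 \<and>
        (\<forall>x\<in>W. \<forall>v \<in> line x - {0}. mpoly_eval G v \<noteq> 0 \<and> h x = mpoly_eval F v / mpoly_eval G v))"
    unfolding regular_on_def add_0_right of_nat_eq_iff
    by (rule ball_cong[OF refl], rule ex_cong1, rule diagonal_ex)
  also have "\<dots> \<longleftrightarrow> loc_frac U 0 (\<lambda>v. h (pt v))" by (rule local_fraction_iff)
  finally show ?thesis .
qed

lemma twist_iff: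
  "s \<in> twist d U \<longleftrightarrow> (\<forall>x v. x \<notin> U \<or> v \<notin> line x - {0} \<longrightarrow> s x v = 0) \<and> loc_frac U d (\<lambda>v. s (pt v) v)"
  unfolding twist_def mem_Collect_eq by (rule arg_cong2[of _ _ _ _ "(\<and>)"], rule refl, rule local_fraction_iff)

section \<open>Global sections of the twisting sheaves\<close>

text \<open>Divisibility in \<open>k[s]\<close> can be tested locally at every point: a root of \<open>g\<close> has to be a root of
  \<open>f\<close>, and the common factor can be cancelled.\<close>

lemma poly_dvd_if_locally:
  fixes g f :: "'k :: alg_closed_field poly"
  assumes "g \<noteq> 0" "\<And>c. \<exists>u w. poly w c \<noteq> 0 \<and> g * u = f * w"
  shows "g dvd f"
  using assms
proof (induction "degree g" arbitrary: g f rule: less_induct)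
  case less
  show ?case
  proof (cases "degree g = 0")
    case True
    then obtain e where "g = [:e:]" using degree_eq_zeroE by blast
    then have "is_unit g" using less.prems(1) by (simp add: is_unit_triv)
    then show ?thesis by (rule unit_imp_dvd)
  next
    case False
    then obtain c where c: "poly g c = 0" using alg_closed_imp_poly_has_root by blast
    then have "[:-c, 1:] dvd g" using poly_eq_0_iff_dvd by blast
    then obtain g1 where g1: "g = [:-c, 1:] * g1" by (rule dvdE)
    obtain u w where "poly w c \<noteq> 0" "g * u = f * w" using less.prems(2)[of c] by blast
    then have "poly f c = 0" using c by (metis mult_eq_0_iff poly_mult)
    then have "[:-c, 1:] dvd f" using poly_eq_0_iff_dvd by blast
    then obtain f1 where f1: "f = [:-c, 1:] * f1" by (rule dvdE)
    have g1nz: "g1 \<noteq> 0" using less.prems(1) g1 by auto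
    have deg: "degree g1 < degree g" using g1nz unfolding g1 by (subst degree_mult_eq) auto
    have "\<exists>u w. poly w d \<noteq> 0 \<and> g1 * u = f1 * w" for d
    proof -
      obtain u w where uw: "poly w d \<noteq> 0" "g * u = f * w" using less.prems(2)[of d] by blast
      have "[:-c, 1:] * (g1 * u) = [:-c, 1:] * (f1 * w)" using uw(2) unfolding g1 f1 by (simp only: mult.assoc)
      then have "g1 * u = f1 * w" by (subst (asm) mult_cancel_left) auto
      then show ?thesis using uw(1) by blast
    qed
    from less.hyps[OF deg g1nz this] show ?thesis unfolding g1 f1 by (intro mult_dvd_mono dvd_refl)
  qed
qed

text \<open>The excluded vector \<open>0\<close> is avoided by multiplying with a coordinate.\<close>

lemma pol_zero_off_zeros:
  fixes f g :: "'k :: alg_closed_field ^ 'n :: finite \<Rightarrow> 'k"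
  assumes "f \<in> polA UNIV" "g \<in> polA UNIV" "g y \<noteq> 0" "\<And>w. w \<noteq> 0 \<Longrightarrow> g w \<noteq> 0 \<Longrightarrow> f w = 0"
  shows "f x = 0"
proof (rule ccontr)
  assume fx: "f x \<noteq> 0"
  obtain a where a: "f \<in> pol a" using assms(1) polA_UNIV_iff by blast
  obtain b where b: "g \<in> pol b" using assms(2) polA_UNIV_iff by blast
  obtain z where z: "f z \<noteq> 0" "g z \<noteq> 0" using pol_nonzero_mult[OF a b fx assms(3)] by blast
  have fg: "(\<lambda>x. f x * g x) \<in> pol (a + b)" using a b by (rule pol_mult)
  have "(\<lambda>x. x $ undefined) \<in> pol 1" by (rule form_imp_pol[OF coord_form])
  moreover have "f z * g z \<noteq> 0" using z by simp
  moreover have "(axis undefined 1 :: 'k ^ 'n) $ undefined \<noteq> 0" by simp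
  ultimately obtain w where "f w * g w \<noteq> 0" "w $ undefined \<noteq> 0"
    using pol_nonzero_mult[OF fg, of "\<lambda>x. x $ undefined" 1 z "axis undefined 1"] by blast
  moreover from this have "w \<noteq> 0" by auto
  ultimately show False using assms(4)[of w] by simp
qed

lemma form_polA: "f \<in> form d \<Longrightarrow> f \<in> polA UNIV"
  using form_imp_pol polA_UNIV_iff by blast

lemma exists_nonzero_vector: "\<exists>v :: 'k :: field ^ 'n :: finite. v \<noteq> 0"
  by (rule exI[of _ "axis undefined 1"]) (simp add: axis_eq_0_iff)

text \<open>  Any two local expressions satisfy \<open>f\<^sub>1 g = f g\<^sub>1\<close> identically. Fix one of them, \<open>f\<^sub>1 / g\<^sub>1\<close> near \<open>v1\<close>. On a
  line through \<open>v1\<close> that avoids the origin, the expressions at the other points show that \<open>g\<^sub>1\<close>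
  divides \<open>f\<^sub>1\<close> locally at every parameter; on the line through the origin this is homogeneity. By
  \<open>pol_div\<close> the quotient is a polynomial. Its component of degree \<open>d\<close> agrees with it off the origin.\<close>

theorem global_sections:
  fixes \<tau> :: "'k :: alg_closed_field ^ 'n :: finite \<Rightarrow> 'k"
  assumes \<tau>: "loc_frac UNIV d \<tau>" and d: "d \<ge> 0"
  shows "\<exists>C\<in>form (nat d). \<forall>v. v \<noteq> 0 \<longrightarrow> \<tau> v = C v"
proof -
  obtain v1 :: "'k ^ 'n" where v1: "v1 \<noteq> 0" using exists_nonzero_vector by blast
  obtain a1 b1 f1 g1 where fr1: "fraction_at UNIV d \<tau> v1 a1 b1 f1 g1"
    using loc_fracD[OF \<tau> v1 UNIV_I] by (elim exE) (rule that)
  note one = fraction_atD[OF fr1]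
  have agree: "f1 x * g x = f x * g1 x" if fr: "fraction_at UNIV d \<tau> v a b f g" for v a b f g x
  proof -
    note two = fraction_atD[OF fr]
    have "(\<lambda>x. f1 x * g x - f x * g1 x) \<in> polA UNIV"
      using one two by (intro polA_diff polA_mult form_polA)
    moreover have "(\<lambda>x. g1 x * g x) \<in> polA UNIV" using one two by (intro polA_mult form_polA)
    moreover obtain y where "g1 y * g y \<noteq> 0"
      using pol_nonzero_mult[OF form_imp_pol[OF one(2)] form_imp_pol[OF two(2)] one(4) two(4)] by auto
    moreover have "f1 w * g w - f w * g1 w = 0" if "w \<noteq> 0" "g1 w * g w \<noteq> 0" for w
    proof -
      have "g1 w \<noteq> 0" "g w \<noteq> 0" using that(2) by auto
      then have *: "f1 w = \<tau> w * g1 w" "f w = \<tau> w * g w"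
        using one(6)[OF that(1)] by simp (use two(6)[OF that(1)] \<open>g w \<noteq> 0\<close> in simp)
      show ?thesis unfolding * by simp
    qed
    ultimately have "f1 x * g x - f x * g1 x = 0"
      using pol_zero_off_zeros[of "\<lambda>x. f1 x * g x - f x * g1 x" "\<lambda>x. g1 x * g x"] by blast
    then show ?thesis by simp
  qed
  have "\<exists>C\<in>polA UNIV. \<forall>x. f1 x = g1 x * C x"
  proof (rule pol_div[OF form_polA[OF one(1)] form_polA[OF one(2)] one(4)])
    fix z
    show "\<exists>P. \<forall>s. f1 (v1 + s *s z) = g1 (v1 + s *s z) * poly P s"
    proof (cases "z \<in> vec.span {v1}")
      case True
      then obtain \<kappa> where z: "z = \<kappa> *s v1" by (auto simp: vec.span_singleton)
      have e1: "v1 + s *s z = (1 + s * \<kappa>) *s v1" for s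
        by (simp add: z vec.scale_left_distrib vector_smult_assoc)
      have a1: "a1 = b1 + nat d" using one(3) d by linarith
      have "f1 (v1 + s *s z) = g1 (v1 + s *s z) * poly (Polynomial.smult (f1 v1 / g1 v1) ([:1, \<kappa>:] ^ nat d)) s" for s
        unfolding e1 form_scaling[OF one(1)] form_scaling[OF one(2)] a1
        using one(4) by (simp add: power_add poly_power mult.commute)
      then show ?thesis by blast
    next
      case False
      have nz: "v1 + s *s z \<noteq> 0" for s
      proof
        assume *: "v1 + s *s z = 0"
        then have "s \<noteq> 0" using v1 by auto
        have "s *s z = - v1" using * by (metis add.commute add_eq_0_iff)
        then have "z = (- inverse s) *s v1"
          using \<open>s \<noteq> 0\<close> by (metis vec.scale_minus_left vec.scale_minus_right vec.scale_left_imp_eq vector_smult_assoc right_inverse vector_smult_lid mult_minus_right)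
        then show False using False unfolding vec.span_singleton by blast
      qed
      obtain fh where fh: "\<And>s. f1 (v1 + s *s z) = poly fh s" using polA_line[OF form_polA[OF one(1)], of v1 z] by blast
      obtain gh where gh: "\<And>s. g1 (v1 + s *s z) = poly gh s" using polA_line[OF form_polA[OF one(2)], of v1 z] by blast
      have "gh \<noteq> 0" using one(4) gh[of 0] by auto
      moreover have "\<exists>u w. poly w c \<noteq> 0 \<and> gh * u = fh * w" for c
      proof -
        obtain a b f g where fr: "fraction_at UNIV d \<tau> (v1 + c *s z) a b f g"
          using loc_fracD[OF \<tau> nz[of c] UNIV_I] by (elim exE) (rule that)
        note two = fraction_atD[OF fr]
        obtain u where u: "\<And>s. f (v1 + s *s z) = poly u s" using polA_line[OF form_polA[OF two(1)], of v1 z] by blast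
        obtain w where w: "\<And>s. g (v1 + s *s z) = poly w s" using polA_line[OF form_polA[OF two(2)], of v1 z] by blast
        have "gh * u = fh * w"
        proof (rule poly_eqI_alg_closed)
          fix s
          show "poly (gh * u) s = poly (fh * w) s"
            using agree[OF fr, of "v1 + s *s z"] by (simp add: fh gh u w mult.commute)
        qed
        moreover have "poly w c \<noteq> 0" using two(4) w by metis
        ultimately show ?thesis by blast
      qed
      ultimately have "gh dvd fh" by (rule poly_dvd_if_locally)
      then obtain P where "fh = gh * P" by (rule dvdE)
      then show ?thesis by (intro exI[of _ P]) (simp add: fh gh)
    qed
  qed
  then obtain C where C: "C \<in> polA UNIV" "\<And>x. f1 x = g1 x * C x" by blast
  have \<tau>C: "\<tau> v = C v" if v: "v \<noteq> 0" for v
  proof -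
    obtain a b f g where fr: "fraction_at UNIV d \<tau> v a b f g"
      using loc_fracD[OF \<tau> v UNIV_I] by (elim exE) (rule that)
    note two = fraction_atD[OF fr]
    have "(\<lambda>x. C x * g x - f x) \<in> polA UNIV"
      by (rule polA_diff[OF polA_mult[OF C(1) form_polA[OF two(2)]] form_polA[OF two(1)]])
    moreover have "C w * g w - f w = 0" if "w \<noteq> 0" "g1 w \<noteq> 0" for w
      using agree[OF fr, of w] that(2) by (simp add: C(2))
    ultimately have "C v * g v - f v = 0"
      using pol_zero_off_zeros[of "\<lambda>x. C x * g x - f x" g1] form_polA[OF one(2)] one(4) by blast
    then have "f v = C v * g v" by simp
    then show ?thesis using two(6)[OF v two(4)] two(4) by simp
  qed
  obtain e where e: "C \<in> pol e" using C(1) polA_UNIV_iff by blast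
  have "hpart (nat d) C v = C v" if v: "v \<noteq> 0" for v
  proof -
    have "infinite (UNIV - {0 :: 'k})" using infinite_UNIV_alg_closed by (simp add: Diff_infinite_finite)
    then have "ray C v = monom (C v) (nat d)"
    proof (rule poly_eq_if_eq_infinite)
      fix s :: 'k assume "s \<in> UNIV - {0}"
      then have s: "s \<noteq> 0" by simp
      have "C (s *s v) = s ^ nat d * C v"
        using loc_frac_scaling[OF \<tau> v UNIV_I s d] \<tau>C[OF v] \<tau>C[of "s *s v"] s v by simp
      then show "poly (ray C v) s = poly (monom (C v) (nat d)) s" by (simp add: poly_ray[OF e] poly_monom mult.commute)
    qed
    then show ?thesis by (simp add: hpart_def)
  qed
  then have "\<forall>v. v \<noteq> 0 \<longrightarrow> \<tau> v = hpart (nat d) C v" using \<tau>C by simp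
  moreover have "hpart (nat d) C \<in> form (nat d)" by (rule hpart_form[OF e])
  ultimately show ?thesis by (rule bexI)
qed

section \<open>Forms without common zeros define endomorphisms\<close>

definition coord_section :: "'n \<Rightarrow> ('k :: field, 'n :: finite) section_fun" where
  "coord_section i x v = (if v \<in> line x - {0} then v $ i else 0)"

lemma coord_section_twist: "(coord_section i :: ('k :: field, 'n :: finite) section_fun) \<in> twist 1 UNIV"
proof -
  have "loc_frac UNIV (int 1) (\<lambda>v. coord_section i (pt v) (v :: 'k ^ 'n))"
    by (rule loc_frac_cong[OF loc_frac_form[OF coord_form]]) (simp_all add: coord_section_def in_line_pt)
  then show ?thesis unfolding twist_iff by (auto simp: coord_section_def)
qed

lemma pullbackD:
  assumes "s \<in> pullback f M U"
  shows "x \<notin> U \<Longrightarrow> s x v = 0"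
    and "p \<in> U \<Longrightarrow> \<exists>W V (m :: nat) h t. openin zariski W \<and> p \<in> W \<and> W \<subseteq> U \<and>
        openin zariski V \<and> f ` W \<subseteq> V \<and>
        (\<forall>j<m. regular_on W (h j) \<and> t j \<in> M V) \<and>
        (\<forall>x\<in>W. \<forall>v. s x v = (\<Sum>j<m. h j x * t j (f x) v))"
  using assms unfolding pullback_def by blast+

context form_map
begin

definition pmap :: "('k, 'n) proj \<Rightarrow> ('k, 'n) proj" where
  "pmap x = pt (F (rep x))"

lemma F_nonzero: "v \<noteq> 0 \<Longrightarrow> F v \<noteq> 0"
  using nz by blast

lemma F_scale: "F (c *s v) = c ^ q *s F v"
  using form_scaling[OF F] by (simp add: Finite_Cartesian_Product.vec_eq_iff)

lemma pmap_pt: "v \<noteq> 0 \<Longrightarrow> pmap (pt v) = pt (F v)"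
proof -
  assume v: "v \<noteq> 0"
  obtain c where c: "c \<noteq> 0" "rep (pt v) = c *s v"
    by (rule in_line_scale[OF in_line_pt[OF v] rep(1) v rep(2)])
  then show ?thesis unfolding pmap_def c(2) F_scale using pt_scale[OF F_nonzero[OF v], of "c ^ q"] by simp
qed

lemma F_in_line: "v \<in> line x \<Longrightarrow> v \<noteq> 0 \<Longrightarrow> F v \<in> line (pmap x)"
  using pmap_pt[of v] pt_eqI[of v x] in_line_pt[OF F_nonzero] by metis

text \<open>On a line, \<open>F\<close> is the \<open>q\<close>-th power map up to a factor, which is surjective over an
  algebraically closed field.\<close>

lemma preimage_on_line:
  assumes "w \<in> line (pmap x)" "w \<noteq> 0"
  shows "\<exists>v. v \<in> line x \<and> v \<noteq> 0 \<and> F v = w"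
proof -
  obtain c where c: "c \<noteq> 0" "w = c *s F (rep x)"
    by (rule in_line_scale[OF F_in_line[OF rep(1,2)] assms(1) F_nonzero[OF rep(2)] assms(2)])
  obtain \<gamma> where \<gamma>: "\<gamma> ^ q = c" using nth_root_exists[of q c] q by auto
  have \<gamma>0: "\<gamma> \<noteq> 0" using \<gamma> c(1) q by auto
  have "\<gamma> *s rep x \<in> line x"
    using rep(1)[of x] pt_rep[of x] line_pt[OF rep(2)[of x]] vec.span_singleton[of "rep x"] by auto
  moreover have "F (\<gamma> *s rep x) = w" by (simp add: F_scale \<gamma> c(2))
  ultimately show ?thesis using \<gamma>0 rep(2)[of x] by (intro exI[of _ "\<gamma> *s rep x"]) simp
qed

lemma preimages_on_line:
  assumes "v \<in> line x" "v' \<in> line x" "v \<noteq> 0" "v' \<noteq> 0" "F v = F v'"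
  shows "\<exists>\<gamma>. \<gamma> \<noteq> 0 \<and> \<gamma> ^ q = 1 \<and> v' = \<gamma> *s v"
proof -
  obtain \<gamma> where \<gamma>: "\<gamma> \<noteq> 0" "v' = \<gamma> *s v" by (rule in_line_scale[OF assms(1-4)])
  then have "\<gamma> ^ q *s F v = 1 *s F v" using assms(5) by (simp add: F_scale)
  then have "\<gamma> ^ q = 1" using F_nonzero[OF assms(3)] by (metis vec.scale_right_imp_eq)
  then show ?thesis using \<gamma> by blast
qed

lemma loc_frac_comp:
  assumes "loc_frac V d \<tau>"
  shows "loc_frac (pmap -` V) (int q * d) (\<lambda>v. \<tau> (F v))"
proof (rule loc_fracI)
  fix v :: "'k ^ 'n" assume v: "v \<noteq> 0" "pt v \<in> pmap -` V"
  have Fv: "pt (F v) \<in> V" using v pmap_pt by simp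
  obtain a b f g where fr: "fraction_at V d \<tau> (F v) a b f g"
    using loc_fracD[OF assms F_nonzero[OF v(1)] Fv] by (elim exE) (rule that)
  note 1 = fraction_atD[OF fr]
  have deg: "int (q * a) = int (q * b) + int q * d" by (simp add: 1(3) distrib_left)
  show "\<exists>a b f g. fraction_at (pmap -` V) (int q * d) (\<lambda>v. \<tau> (F v)) v a b f g"
    by (rule fraction_atI[OF form_comp[OF 1(1) F] form_comp[OF 1(2) F] deg]) (use 1 pmap_pt F_nonzero in auto)
qed

lemma open_preimage:
  assumes "openin zariski V" shows "openin zariski (pmap -` V)"
proof (subst openin_subopen, intro ballI)
  fix x assume "x \<in> pmap -` V"
  then have "pt (F (rep x)) \<in> V" by (simp add: pmap_def)
  from open_cuts[OF assms F_nonzero[OF rep(2)] this] obtain b g where cu: "cuts V (F (rep x)) b g"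
    by (elim exE) (rule that)
  note g = cutsD[OF cu]
  have gF: "(\<lambda>v. g (F v)) \<in> form (q * b)" by (rule form_comp[OF g(1) F])
  have "x \<in> basic (\<lambda>v. g (F v))" using basic_iff[OF gF rep(2)[of x]] g(2) by simp
  moreover have "basic (\<lambda>v. g (F v)) \<subseteq> pmap -` V"
  proof
    fix y assume "y \<in> basic (\<lambda>v. g (F v))"
    then have "g (F (rep y)) \<noteq> 0" using basic_iff[OF gF rep(2)[of y]] by simp
    then show "y \<in> pmap -` V" using g(3)[OF F_nonzero[OF rep(2)]] by (simp add: pmap_def)
  qed
  ultimately show "\<exists>T. openin zariski T \<and> x \<in> T \<and> T \<subseteq> pmap -` V" using open_basic[OF gF] by blast
qed

theorem endomorphism_pmap: "endomorphism pmap"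
proof -
  have "continuous_map zariski zariski pmap"
  proof -
    have "{x \<in> topspace zariski. pmap x \<in> U} = pmap -` U" for U by auto
    then show ?thesis unfolding continuous_map_def using open_preimage by simp
  qed
  moreover have "regular_on (pmap -` V) (h \<circ> pmap)" if "regular_on V h" for V h
  proof -
    have "loc_frac (pmap -` V) (int q * 0) (\<lambda>v. h (pt (F v)))"
      by (rule loc_frac_comp) (use that in \<open>simp add: regular_on_iff\<close>)
    then have "loc_frac (pmap -` V) 0 (\<lambda>v. (h \<circ> pmap) (pt v))"
      by (simp, elim loc_frac_cong) (simp add: pmap_pt)
    then show ?thesis unfolding regular_on_iff .
  qed
  ultimately show ?thesis unfolding endomorphism_def by blast
qed

text \<open>Composition with \<open>F\<close> turns a homogeneous function of degree \<open>1\<close> on the line of the image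
  point into one of degree \<open>q\<close> on the line of the point. This is the isomorphism from the pullback of
  \<open>\<O>(1)\<close> to \<open>\<O>(q)\<close>.\<close>

definition pull :: "('k, 'n) section_fun \<Rightarrow> ('k, 'n) section_fun" where
  "pull s x v = (if v \<in> line x - {0} then s x (F v) else 0)"

lemma pull_twist:
  assumes s: "s \<in> pullback pmap (twist 1) U"
  shows "pull s \<in> twist (int q) U"
proof -
  have "loc_frac U (int q) (\<lambda>v. pull s (pt v) v)"
  proof (rule loc_frac_local)
    fix v :: "'k ^ 'n" assume v: "v \<noteq> 0" "pt v \<in> U"
    obtain W V h t and m :: nat where W: "openin zariski W" "pt v \<in> W" "W \<subseteq> U" "openin zariski V" "pmap ` W \<subseteq> V"
      and ht: "\<forall>j<m. regular_on W (h j) \<and> t j \<in> twist 1 V"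
      and eq: "\<forall>x\<in>W. \<forall>v. s x v = (\<Sum>j<m. h j x * t j (pmap x) v)"
      using pullbackD(2)[OF s v(2)] by (elim exE conjE) (rule that)
    have "loc_frac W (int q) (\<lambda>v. \<Sum>j<m. h j (pt v) * t j (pt (F v)) (F v))"
    proof (rule loc_frac_sum[OF W(1)])
      fix j assume j: "j < m"
      have "loc_frac V 1 (\<lambda>v. t j (pt v) v)" using ht j unfolding twist_iff by blast
      from loc_frac_comp[OF this] have "loc_frac (pmap -` V) (int q) (\<lambda>v. t j (pt (F v)) (F v))" by simp
      then have "loc_frac W (int q) (\<lambda>v. t j (pt (F v)) (F v))" by (rule loc_frac_subset[OF _ W(1)]) (use W(5) in auto)
      moreover have "loc_frac W 0 (\<lambda>v. h j (pt v))" using ht j regular_on_iff by blast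
      ultimately have "loc_frac W (0 + int q) (\<lambda>v. h j (pt v) * t j (pt (F v)) (F v))" by (intro loc_frac_mult)
      then show "loc_frac W (int q) (\<lambda>v. h j (pt v) * t j (pt (F v)) (F v))" by simp
    qed
    then have "loc_frac W (int q) (\<lambda>v. pull s (pt v) v)"
      by (rule loc_frac_cong) (simp add: pull_def in_line_pt eq pmap_pt)
    then show "\<exists>W. pt v \<in> W \<and> W \<subseteq> U \<and> loc_frac W (int q) (\<lambda>v. pull s (pt v) v)" using W by blast
  qed
  moreover have "\<forall>x v. x \<notin> U \<or> v \<notin> line x - {0} \<longrightarrow> pull s x v = 0"
    using pullbackD(1)[OF s] by (auto simp: pull_def)
  ultimately show ?thesis unfolding twist_iff by blast
qed

lemma pullback_off_line:
  assumes s: "s \<in> pullback pmap (twist 1) U" and v: "v \<notin> line (pmap x) - {0}"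
  shows "s x v = 0"
proof (cases "x \<in> U")
  case True
  obtain W V h t and m :: nat where W: "x \<in> W"
    and ht: "\<forall>j<m. regular_on W (h j) \<and> t j \<in> twist 1 V"
    and eq: "\<forall>x\<in>W. \<forall>v. s x v = (\<Sum>j<m. h j x * t j (pmap x) v)"
    using pullbackD(2)[OF s True] by (elim exE conjE) (rule that)
  have "t j (pmap x) v = 0" if "j < m" for j using ht that v unfolding twist_iff by blast
  then show ?thesis using eq W by simp
qed (rule pullbackD(1)[OF s])

lemma pull_inj:
  assumes s: "s \<in> pullback pmap (twist 1) U" and s': "s' \<in> pullback pmap (twist 1) U" and eq: "pull s = pull s'"
  shows "s = s'"
proof (intro ext)
  fix x w
  show "s x w = s' x w"
  proof (cases "w \<in> line (pmap x) - {0}")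
    case True
    then obtain v where v: "v \<in> line x" "v \<noteq> 0" "F v = w" using preimage_on_line by blast
    have "pull s x v = pull s' x v" using eq by simp
    then show ?thesis using v by (simp add: pull_def)
  qed (simp add: pullback_off_line[OF s] pullback_off_line[OF s'])
qed

text \<open>  A function \<open>t\<close> of degree \<open>q\<close> on a line is constant on the fibres of \<open>F\<close>, which are orbits of the
  \<open>q\<close>-th roots of unity, so it descends to the line of the image point. Where \<open>t = f / g\<close> and
  \<open>F\<^sub>i \<noteq> 0\<close>, it is the regular function \<open>f / (g F\<^sub>i)\<close> times the pullback of the coordinate \<open>i\<close>.\<close>

lemma pull_surj:
  assumes t: "t \<in> twist (int q) U"
  shows "\<exists>s\<in>pullback pmap (twist 1) U. pull s = t"
proof -
  have t0: "\<And>x v. x \<notin> U \<or> v \<notin> line x - {0} \<Longrightarrow> t x v = 0" and lt: "loc_frac U (int q) (\<lambda>v. t (pt v) v)"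
    using t unfolding twist_iff by blast+
  define pre where "pre = (\<lambda>x w. SOME v. v \<in> line x \<and> v \<noteq> 0 \<and> F v = w)"
  have pre: "pre x w \<in> line x \<and> pre x w \<noteq> 0 \<and> F (pre x w) = w" if "w \<in> line (pmap x) - {0}" for x w
    unfolding pre_def by (rule someI_ex) (use preimage_on_line that in blast)
  define s where "s = (\<lambda>x w. if x \<in> U \<and> w \<in> line (pmap x) - {0} then t x (pre x w) else 0)"
  have s_F: "s x (F v) = t x v" if x: "x \<in> U" and v: "v \<in> line x - {0}" for x v
  proof -
    have v': "v \<in> line x" "v \<noteq> 0" using v by auto
    have Fv: "F v \<in> line (pmap x) - {0}" using F_in_line[OF v'] F_nonzero[OF v'(2)] by simp
    note p = pre[OF Fv]
    from preimages_on_line[of v x "pre x (F v)"] p v' obtain \<gamma> where \<gamma>: "\<gamma> \<noteq> 0" "\<gamma> ^ q = 1" "pre x (F v) = \<gamma> *s v" by auto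
    have px: "pt v = x" by (rule pt_eqI[OF v'])
    have "t (pt (\<gamma> *s v)) (\<gamma> *s v) = \<gamma> ^ q * t (pt v) v"
      using loc_frac_scaling[OF lt v'(2) _ \<gamma>(1)] x px by simp
    then have "t x (\<gamma> *s v) = t x v" using pt_scale[OF v'(2) \<gamma>(1)] px \<gamma>(2) by simp
    then show ?thesis using Fv x \<gamma>(3) by (simp add: s_def)
  qed
  have "pull s = t"
  proof (intro ext)
    fix x v
    show "pull s x v = t x v"
    proof (cases "x \<in> U \<and> v \<in> line x - {0}")
      case True
      then show ?thesis using s_F by (simp add: pull_def)
    next
      case False
      then show ?thesis using t0[of x v] by (auto simp: pull_def s_def)
    qed
  qed
  moreover have "s \<in> pullback pmap (twist 1) U"
    unfolding pullback_def mem_Collect_eq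
  proof (intro conjI allI impI ballI)
    fix x v assume "x \<notin> U" then show "s x v = 0" by (simp add: s_def)
  next
    fix p assume p: "p \<in> U"
    have pr: "pt (rep p) \<in> U" using p by simp
    obtain a b f g where fr: "fraction_at U (int q) (\<lambda>v. t (pt v) v) (rep p) a b f g"
      using loc_fracD[OF lt rep(2) pr] by (elim exE) (rule that)
    note 1 = fraction_atD[OF fr]
    obtain i where i: "F (rep p) $ i \<noteq> 0"
      using F_nonzero[OF rep(2)[of p]] by (auto simp: Finite_Cartesian_Product.vec_eq_iff)
    define G where "G = (\<lambda>v. g v * F v $ i)"
    have G: "G \<in> form (b + q)" unfolding G_def by (rule form_mult[OF 1(2) F])
    have aq: "int a = int (b + q) + 0" using 1(3) by simp
    define W where "W = basic G"
    define h where "h = (\<lambda>x. f (rep x) / G (rep x))"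
    have inW: "g v \<noteq> 0" "F v $ i \<noteq> 0" "h x = f v / G v" if xv: "x \<in> W" "v \<in> line x" "v \<noteq> 0" for x v
    proof -
      have x: "pt v = x" by (rule pt_eqI[OF xv(2,3)])
      have "G v \<noteq> 0" using xv(1) basic_iff[OF G xv(3)] by (simp add: W_def x)
      then show "g v \<noteq> 0" "F v $ i \<noteq> 0" by (auto simp: G_def)
      obtain c where c: "c \<noteq> 0" "rep x = c *s v" by (rule in_line_scale[OF xv(2) rep(1) xv(3) rep(2)])
      have "a = b + q" using aq by linarith
      then show "h x = f v / G v" using c by (simp add: h_def form_scaling[OF 1(1)] form_scaling[OF G])
    qed
    have "W \<subseteq> U"
    proof
      fix x assume "x \<in> W"
      then show "x \<in> U" using 1(5)[OF rep(2)[of x] inW(1)[of x "rep x"]] rep[of x] by simp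
    qed
    moreover have "openin zariski W" unfolding W_def by (rule open_basic[OF G])
    moreover have "p \<in> W" using basic_iff[OF G rep(2)[of p]] 1(4) i by (simp add: W_def G_def)
    moreover have "regular_on W h" unfolding regular_on_iff
    proof (rule loc_fracI)
      fix v :: "'k ^ 'n" assume v: "v \<noteq> 0" "pt v \<in> W"
      have "G v \<noteq> 0" using basic_iff[OF G v(1)] v(2) by (simp add: W_def)
      then show "\<exists>a b f g. fraction_at W 0 (\<lambda>v. h (pt v)) v a b f g"
        by (intro fraction_atI[OF 1(1) G aq]) (use basic_iff[OF G] inW(3)[OF _ in_line_pt] in \<open>auto simp: W_def\<close>)
    qed
    moreover have "s x w = h x * coord_section i (pmap x) w" if x: "x \<in> W" for x w
    proof (cases "w \<in> line (pmap x) - {0}")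
      case True
      then obtain v where v: "v \<in> line x" "v \<noteq> 0" "F v = w" using preimage_on_line by blast
      have xU: "x \<in> U" using \<open>W \<subseteq> U\<close> x by blast
      have "s x w = t x v" using s_F[OF xU, of v] v by simp
      also have "\<dots> = f v / g v" using 1(6)[OF v(2) inW(1)[OF x v(1,2)]] pt_eqI[OF v(1,2)] by simp
      also have "\<dots> = h x * w $ i" using inW(2)[OF x v(1,2)] by (simp add: inW(3)[OF x v(1,2)] G_def v(3))
      finally show ?thesis using True by (simp add: coord_section_def)
    next
      case False
      then show ?thesis by (auto simp: s_def coord_section_def)
    qed
    ultimately show "\<exists>W V (m :: nat) h t. openin zariski W \<and> p \<in> W \<and> W \<subseteq> U \<and>
        openin zariski V \<and> pmap ` W \<subseteq> V \<and>
        (\<forall>j<m. regular_on W (h j) \<and> t j \<in> twist 1 V) \<and>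
        (\<forall>x\<in>W. \<forall>v. s x v = (\<Sum>j<m. h j x * t j (pmap x) v))"
      using coord_section_twist[of i]
      by (intro exI[of _ W] exI[of _ UNIV] exI[of _ "1 :: nat"] exI[of _ "\<lambda>_. h"] exI[of _ "\<lambda>_. coord_section i"]) simp
  qed
  ultimately show ?thesis by blast
qed

theorem sheaf_iso_pmap: "sheaf_iso (pullback pmap (twist 1)) (twist (int q))"
  unfolding sheaf_iso_def
proof (intro exI[of _ "\<lambda>_. pull"] conjI allI impI ballI)
  fix U :: "('k, 'n) proj set"
  show "bij_betw pull (pullback pmap (twist 1) U) (twist (int q) U)"
    unfolding bij_betw_def inj_on_def
  proof (intro conjI ballI impI equalityI subsetI)
    fix s s' assume "s \<in> pullback pmap (twist 1) U" "s' \<in> pullback pmap (twist 1) U" "pull s = pull s'"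
    then show "s = s'" by (rule pull_inj)
  next
    fix t assume "t \<in> pull ` pullback pmap (twist 1) U"
    then show "t \<in> twist (int q) U" using pull_twist by blast
  next
    fix t assume "t \<in> twist (int q) U"
    then show "t \<in> pull ` pullback pmap (twist 1) U" using pull_surj by blast
  qed
qed (auto simp: pull_def restrict_section_def fun_eq_iff)

end

section \<open>Endomorphisms of degree \<open>q\<close> are given by forms\<close>

definition pulled_coord :: "(('k :: field, 'n :: finite) proj \<Rightarrow> ('k, 'n) proj) \<Rightarrow> 'n \<Rightarrow>
    ('k, 'n) proj set \<Rightarrow> ('k, 'n) section_fun" where
  "pulled_coord f i U x v = (if x \<in> U then coord_section i (f x) v else 0)"

lemma pulled_coord_pullback:
  assumes U: "openin zariski U"
  shows "pulled_coord f i U \<in> pullback f (twist 1) U"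
  unfolding pullback_def mem_Collect_eq
proof (intro conjI allI impI ballI)
  fix p assume "p \<in> U"
  have "loc_frac U (int 0) (\<lambda>_. 1)" by (rule loc_frac_form[OF form_const U])
  then have "regular_on U (\<lambda>_. 1)" by (simp add: regular_on_iff)
  then show "\<exists>W V (m :: nat) h t. openin zariski W \<and> p \<in> W \<and> W \<subseteq> U \<and>
        openin zariski V \<and> f ` W \<subseteq> V \<and>
        (\<forall>j<m. regular_on W (h j) \<and> t j \<in> twist 1 V) \<and>
        (\<forall>x\<in>W. \<forall>v. pulled_coord f i U x v = (\<Sum>j<m. h j x * t j (f x) v))"
    using U \<open>p \<in> U\<close> coord_section_twist[of i]
    by (intro exI[of _ U] exI[of _ UNIV] exI[of _ "1 :: nat"] exI[of _ "\<lambda>_ _. 1"] exI[of _ "\<lambda>_. coord_section i"])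
      (simp add: pulled_coord_def)
qed (simp add: pulled_coord_def)

lemma restrict_pulled_coord:
  "V \<subseteq> U \<Longrightarrow> restrict_section V (pulled_coord f i U) = pulled_coord f i V"
  by (auto simp: restrict_section_def pulled_coord_def fun_eq_iff)

definition coord_open :: "'n \<Rightarrow> ('k :: field, 'n :: finite) proj set" where
  "coord_open j = basic (\<lambda>v. v $ j)"

lemma open_coord_open: "openin zariski (coord_open j)"
  unfolding coord_open_def by (rule open_basic[OF coord_form])

lemma coord_open_iff: "v \<in> line x \<Longrightarrow> v \<noteq> 0 \<Longrightarrow> x \<in> coord_open j \<longleftrightarrow> v $ j \<noteq> 0"
  unfolding coord_open_def using basic_iff[OF coord_form, of v j] pt_eqI[of v x] by simp

lemma twist_scale:
  assumes t: "t \<in> twist (int d) U" and v: "v \<in> line x" "v \<noteq> 0" and c: "c \<noteq> 0"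
  shows "t x (c *s v) = c ^ d * t x v"
proof (cases "x \<in> U")
  case True
  have "loc_frac U (int d) (\<lambda>v. t (pt v) v)" using t unfolding twist_iff by blast
  from loc_frac_scaling[OF this v(2) _ c] show ?thesis using True pt_eqI[OF v] pt_scale[OF v(2) c] by simp
next
  case False
  then show ?thesis using t unfolding twist_iff by simp
qed

lemma endomorphism_regular:
  "endomorphism f \<Longrightarrow> openin zariski V \<Longrightarrow> regular_on V h \<Longrightarrow> regular_on (f -` V) (\<lambda>x. h (f x))"
  unfolding endomorphism_def by (simp add: o_def)

lemma endomorphism_open: "endomorphism f \<Longrightarrow> openin zariski V \<Longrightarrow> openin zariski (f -` V)"
proof -
  assume "endomorphism f" "openin zariski V"
  then have "openin zariski {x \<in> topspace zariski. f x \<in> V}"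
    unfolding endomorphism_def continuous_map_def by blast
  moreover have "{x \<in> topspace zariski. f x \<in> V} = f -` V" by auto
  ultimately show ?thesis by simp
qed

text \<open>The quotient of a section of \<open>\<O>(1)\<close> by the coordinate \<open>j\<close>; by \<open>ratio_eq\<close> the choice of the
  representative is immaterial.\<close>

definition ratio :: "'n \<Rightarrow> ('k :: field, 'n :: finite) section_fun \<Rightarrow> ('k, 'n) proj \<Rightarrow> 'k" where
  "ratio j t y = t y (rep y) / rep y $ j"

lemma ratio_eq:
  assumes t: "t \<in> twist 1 V" and v: "v \<in> line y" "v \<noteq> 0"
  shows "ratio j t y = t y v / v $ j"
proof -
  obtain c where c: "c \<noteq> 0" "rep y = c *s v" by (rule in_line_scale[OF v(1) rep(1) v(2) rep(2)])
  have "t \<in> twist (int 1) V" using t by simp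
  from twist_scale[OF this v c(1)] show ?thesis using c by (simp add: ratio_def)
qed

lemma ratio_regular:
  assumes t: "t \<in> twist 1 V" and V: "openin zariski V"
  shows "regular_on (V \<inter> coord_open j) (ratio j t)"
proof -
  have O: "openin zariski (V \<inter> coord_open j)" by (rule openin_Int[OF V open_coord_open])
  have "loc_frac V 1 (\<lambda>v. t (pt v) v)" using t unfolding twist_iff by blast
  then have "loc_frac (V \<inter> coord_open j) 1 (\<lambda>v. t (pt v) v)" by (rule loc_frac_subset[OF _ O]) simp
  then have "loc_frac (V \<inter> coord_open j) (1 - int 1) (\<lambda>v. t (pt v) v / v $ j)"
    by (rule loc_frac_divide[OF _ coord_form]) (simp add: coord_open_iff[OF in_line_pt])
  then have "loc_frac (V \<inter> coord_open j) 0 (\<lambda>v. ratio j t (pt v))"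
    by (simp, elim loc_frac_cong) (simp add: ratio_eq[OF t in_line_pt])
  then show ?thesis by (simp add: regular_on_iff)
qed

lemma section_eq_ratio:
  assumes t: "t \<in> twist 1 V" and y: "y \<in> coord_open j"
  shows "t y u = ratio j t y * coord_section j y u"
proof (cases "u \<in> line y - {0}")
  case True
  then have u: "u \<in> line y" "u \<noteq> 0" by auto
  have "u $ j \<noteq> 0" using coord_open_iff[OF u] y by simp
  then show ?thesis using True by (simp add: ratio_eq[OF t u] coord_section_def)
next
  case False
  then have "t y u = 0" using t unfolding twist_iff by blast
  then show ?thesis using False by (auto simp: coord_section_def)
qed

lemma regular_sum_mult:
  fixes m :: nat
  assumes "openin zariski W" "\<And>k. k < m \<Longrightarrow> regular_on W (h k)" "\<And>k. k < m \<Longrightarrow> regular_on W (g k)"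
  shows "regular_on W (\<lambda>x. \<Sum>k<m. h k x * g k x)"
  unfolding regular_on_iff
proof (rule loc_frac_sum[OF assms(1)])
  fix k assume "k < m"
  then have "loc_frac W 0 (\<lambda>v. h k (pt v))" "loc_frac W 0 (\<lambda>v. g k (pt v))" using assms(2,3) unfolding regular_on_iff by blast+
  from loc_frac_mult[OF this] show "loc_frac W 0 (\<lambda>v. h k (pt v) * g k (pt v))" by simp
qed

lemma regular_subset: "regular_on U h \<Longrightarrow> openin zariski W \<Longrightarrow> W \<subseteq> U \<Longrightarrow> regular_on W h"
  unfolding regular_on_iff by (rule loc_frac_subset)

text \<open>  The isomorphism sends the pulled-back coordinates to global sections \<open>t i\<close> of \<open>\<O>(q)\<close>, which are
  forms \<open>C i\<close>. As it is linear over regular functions and compatible with restriction, the \<open>t i\<close> are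
  proportional to the coordinates of the image point. They have no common zero: where the coordinate \<open>j\<close> of the
  image point is not zero, every section of the pullback is a regular multiple of the pulled-back coordinate \<open>j\<close>, so
  every section of \<open>\<O>(q)\<close> is a regular multiple of \<open>t j\<close>.\<close>

theorem endomorphism_forms:
  fixes f :: "('k :: alg_closed_field, 'n :: finite) proj \<Rightarrow> ('k, 'n) proj"
  assumes f: "endomorphism f" and iso: "sheaf_iso (pullback f (twist 1)) (twist (int q))"
  shows "\<exists>F. (\<forall>i. (\<lambda>x. F x $ i) \<in> form q) \<and> (\<forall>v. v \<noteq> 0 \<longrightarrow> F v \<noteq> 0 \<and> F v \<in> line (f (pt v)))"
proof -
  from iso[unfolded sheaf_iso_def] obtain \<phi> where
    \<phi>1: "\<forall>U. openin zariski U \<longrightarrow>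
        bij_betw (\<phi> U) (pullback f (twist 1) U) (twist (int q) U) \<and>
        (\<forall>s \<in> pullback f (twist 1) U. \<forall>t \<in> pullback f (twist 1) U.
           \<phi> U (\<lambda>x v. s x v + t x v) = (\<lambda>x v. \<phi> U s x v + \<phi> U t x v)) \<and>
        (\<forall>h. \<forall>s \<in> pullback f (twist 1) U. regular_on U h \<longrightarrow>
           \<phi> U (\<lambda>x v. h x * s x v) = (\<lambda>x v. h x * \<phi> U s x v))" and
    \<phi>2: "\<forall>U V. openin zariski U \<and> openin zariski V \<and> V \<subseteq> U \<longrightarrow>
        (\<forall>s \<in> pullback f (twist 1) U. \<phi> V (restrict_section V s) = restrict_section V (\<phi> U s))"
    by (elim exE conjE) (rule that)
  have bij: "bij_betw (\<phi> U) (pullback f (twist 1) U) (twist (int q) U)" if "openin zariski U" for U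
    using \<phi>1 that by blast
  have lin: "\<phi> U (\<lambda>x v. h x * s x v) = (\<lambda>x v. h x * \<phi> U s x v)"
    if U: "openin zariski U" and s: "s \<in> pullback f (twist 1) U" and h: "regular_on U h" for U h s
    using conjunct2[OF conjunct2[OF \<phi>1[rule_format, OF U]], rule_format, OF s h] .
  have res: "\<phi> V (restrict_section V s) = restrict_section V (\<phi> U s)"
    if "openin zariski U" "openin zariski V" "V \<subseteq> U" "s \<in> pullback f (twist 1) U" for U V s
    using \<phi>2 that by blast
  define t where "t = (\<lambda>i. \<phi> UNIV (pulled_coord f i UNIV))"
  have t: "t i \<in> twist (int q) UNIV" for i
    unfolding t_def by (rule bij_betw_apply[OF bij[OF open_UNIV] pulled_coord_pullback[OF open_UNIV]])
  have t_res: "\<phi> W (pulled_coord f i W) x v = t i x v" if W: "openin zariski W" and x: "x \<in> W" for W i x v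
  proof -
    have "\<phi> W (restrict_section W (pulled_coord f i UNIV)) = restrict_section W (t i)"
      unfolding t_def by (rule res[OF open_UNIV W subset_UNIV pulled_coord_pullback[OF open_UNIV]])
    then show ?thesis using x by (simp add: restrict_pulled_coord) (simp add: restrict_section_def)
  qed
  have "\<forall>i. \<exists>C. C \<in> form q \<and> (\<forall>v. v \<noteq> 0 \<longrightarrow> t i (pt v) v = C v)"
  proof
    fix i
    have "loc_frac UNIV (int q) (\<lambda>v. t i (pt v) v)" using t[of i] unfolding twist_iff by blast
    from global_sections[OF this] show "\<exists>C. C \<in> form q \<and> (\<forall>v. v \<noteq> 0 \<longrightarrow> t i (pt v) v = C v)" by auto
  qed
  from choice[OF this] obtain C where C: "\<And>i. C i \<in> form q" "\<And>i v. v \<noteq> 0 \<Longrightarrow> t i (pt v) v = C i v" by auto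
  define Wj where "Wj = (\<lambda>j. f -` coord_open j)"
  have Wj: "openin zariski (Wj j)" for j unfolding Wj_def by (rule endomorphism_open[OF f open_coord_open])
  \<comment> \<open>the pulled-back coordinates are proportional to the image point\<close>
  have proportional: "t i x v = ratio j (coord_section i) (f x) * t j x v" if x: "x \<in> Wj j" for i j x v
  proof -
    have ci: "coord_section i \<in> twist 1 UNIV" by (rule coord_section_twist)
    have "regular_on (UNIV \<inter> coord_open j) (ratio j (coord_section i))" by (rule ratio_regular[OF ci open_UNIV])
    then have "regular_on (Wj j) (\<lambda>x. ratio j (coord_section i) (f x))"
      unfolding Wj_def Int_UNIV_left by (rule endomorphism_regular[OF f open_coord_open])
    from lin[OF Wj pulled_coord_pullback[OF Wj] this, of j]
    have "\<phi> (Wj j) (\<lambda>x v. ratio j (coord_section i) (f x) * pulled_coord f j (Wj j) x v) =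
       (\<lambda>x v. ratio j (coord_section i) (f x) * \<phi> (Wj j) (pulled_coord f j (Wj j)) x v)" .
    moreover have "(\<lambda>x v. ratio j (coord_section i) (f x) * pulled_coord f j (Wj j) x v) = pulled_coord f i (Wj j)"
      by (intro ext) (simp add: pulled_coord_def Wj_def section_eq_ratio[OF ci])
    ultimately have "\<phi> (Wj j) (pulled_coord f i (Wj j)) = (\<lambda>x v. ratio j (coord_section i) (f x) * \<phi> (Wj j) (pulled_coord f j (Wj j)) x v)" by simp
    from fun_cong[OF fun_cong[OF this, of x], of v] show ?thesis by (simp add: t_res[OF Wj x])
  qed
  \<comment> \<open>where the image has nonzero coordinate \<open>j\<close>, the section \<open>t j\<close> generates \<open>\<O>(q)\<close>\<close>
  have nonvanishing: "t j x v \<noteq> 0" if x: "x \<in> Wj j" and v: "v \<in> line x" "v \<noteq> 0" for j x v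
  proof -
    obtain l where l: "v $ l \<noteq> 0" using v(2) by (auto simp: Finite_Cartesian_Product.vec_eq_iff)
    \<comment> \<open>a section of \<open>\<O>(q)\<close> that does not vanish at \<open>x\<close>\<close>
    define X where "X = (\<lambda>x v. if x \<in> Wj j \<and> v \<in> line x - {0} then (v $ l) ^ q else 0)"
    have "(\<lambda>v. (v $ l) ^ q) \<in> form (q * 1)" by (rule form_power[OF coord_form])
    then have "loc_frac (Wj j) (int q) (\<lambda>v. (v $ l) ^ q)" using loc_frac_form[OF _ Wj] by simp
    then have "loc_frac (Wj j) (int q) (\<lambda>v. X (pt v) v)" by (rule loc_frac_cong) (simp add: X_def in_line_pt)
    then have "X \<in> twist (int q) (Wj j)" unfolding twist_iff by (auto simp: X_def)
    then have "X \<in> \<phi> (Wj j) ` pullback f (twist 1) (Wj j)"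
      using bij_betw_imp_surj_on[OF bij[OF Wj, of j]] by simp
    then obtain s where X: "X = \<phi> (Wj j) s" and s: "s \<in> pullback f (twist 1) (Wj j)" by (rule imageE)
    obtain W V h r and m :: nat where W: "openin zariski W" "x \<in> W" "W \<subseteq> Wj j" "openin zariski V" "f ` W \<subseteq> V"
      and hr: "\<forall>k<m. regular_on W (h k) \<and> r k \<in> twist 1 V"
      and eq: "\<forall>x\<in>W. \<forall>v. s x v = (\<Sum>k<m. h k x * r k (f x) v)"
      using pullbackD(2)[OF s x] by (elim exE conjE) (rule that)
    define g where "g = (\<lambda>x. \<Sum>k<m. h k x * ratio j (r k) (f x))"
    have g: "regular_on W g" unfolding g_def
    proof (rule regular_sum_mult[OF W(1)])
      fix k assume k: "k < m"
      then show "regular_on W (h k)" using hr by blast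
      have O: "openin zariski (V \<inter> coord_open j)" by (rule openin_Int[OF W(4) open_coord_open])
      have "regular_on (f -` (V \<inter> coord_open j)) (\<lambda>x. ratio j (r k) (f x))"
        by (rule endomorphism_regular[OF f O ratio_regular[OF _ W(4)]]) (use hr k in blast)
      then show "regular_on W (\<lambda>x. ratio j (r k) (f x))"
        by (rule regular_subset[OF _ W(1)]) (use W(3,5) in \<open>auto simp: Wj_def\<close>)
    qed
    have "restrict_section W s = (\<lambda>x v. g x * pulled_coord f j W x v)"
    proof (intro ext)
      fix y u
      show "restrict_section W s y u = g y * pulled_coord f j W y u"
      proof (cases "y \<in> W")
        case True
        then have fy: "f y \<in> coord_open j" using W(3) by (auto simp: Wj_def)
        have "s y u = (\<Sum>k<m. h k y * r k (f y) u)" using eq True by blast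
        also have "\<dots> = (\<Sum>k<m. h k y * (ratio j (r k) (f y) * coord_section j (f y) u))"
        proof (intro sum.cong refl)
          fix k assume "k \<in> {..<m}"
          then have "r k \<in> twist 1 V" using hr by blast
          from section_eq_ratio[OF this fy, of u]
          show "h k y * r k (f y) u = h k y * (ratio j (r k) (f y) * coord_section j (f y) u)" by simp
        qed
        also have "\<dots> = g y * coord_section j (f y) u" by (simp add: g_def sum_distrib_right mult.assoc)
        finally show ?thesis using True by (simp add: restrict_section_def pulled_coord_def)
      qed (simp add: restrict_section_def pulled_coord_def)
    qed
    then have "\<phi> W (restrict_section W s) = (\<lambda>x v. g x * \<phi> W (pulled_coord f j W) x v)"
      using lin[OF W(1) pulled_coord_pullback[OF W(1)] g] by simp
    moreover have "\<phi> W (restrict_section W s) = restrict_section W X"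
      using res[OF Wj W(1) W(3) s] X by simp
    ultimately have "restrict_section W X x v = g x * t j x v"
      using t_res[OF W(1,2), of j v] by (metis (no_types))
    moreover have "restrict_section W X x v = (v $ l) ^ q" using W(2) x v by (simp add: restrict_section_def X_def)
    ultimately show ?thesis using l by auto
  qed
  define F where "F = (\<lambda>v. \<chi> i. C i v)"
  have "F v \<noteq> 0 \<and> F v \<in> line (f (pt v))" if v: "v \<noteq> 0" for v
  proof -
    define w where "w = rep (f (pt v))"
    have w: "w \<in> line (f (pt v))" "w \<noteq> 0" using rep by (auto simp: w_def)
    obtain j where j: "w $ j \<noteq> 0" using w(2) by (auto simp: Finite_Cartesian_Product.vec_eq_iff)
    have x: "pt v \<in> Wj j" using coord_open_iff[OF w] j by (simp add: Wj_def)
    have Cj: "C j v \<noteq> 0" using nonvanishing[OF x in_line_pt[OF v] v] C(2)[OF v] by simp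
    have Ci: "C i v = w $ i / w $ j * C j v" for i
      using proportional[OF x, of i v] w C(2)[OF v] ratio_eq[OF coord_section_twist w, of j i]
      by (simp add: coord_section_def)
    have "F v = (C j v / w $ j) *s w"
      unfolding Finite_Cartesian_Product.vec_eq_iff F_def vec_lambda_beta by (intro allI, subst Ci) simp
    moreover have "C j v / w $ j \<noteq> 0" using Cj j by simp
    moreover have "line (f (pt v)) = vec.span {w}" using line_pt[OF w(2)] pt_eqI[OF w] by simp
    ultimately show ?thesis using w(2) by (auto simp: vec.span_singleton)
  qed
  moreover have "(\<lambda>x. F x $ i) \<in> form q" for i using C(1) by (simp add: F_def)
  ultimately show ?thesis by blast
qed

section \<open>Completely ramified points\<close>

text \<open>By \<open>preimage_on_line\<close> a representing vector of a completely ramified point is itself a value of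
  \<open>F\<close>, and its preimages under \<open>F\<close> lie on one line; this is the situation of \<open>independent_images\<close>.\<close>

theorem CR_independent:
  fixes f :: "('k :: alg_closed_field, 'n :: finite) proj \<Rightarrow> ('k, 'n) proj"
  assumes f: "endomorphism f" and iso: "sheaf_iso (pullback f (twist 1)) (twist (int q))"
    and qb: "q \<ge> 1" "CARD('n) \<le> q" and qk: "(of_nat q :: 'k) \<noteq> 0"
  shows "proj_independent (CR f) \<and> finite (CR f) \<and> card (CR f) \<le> CARD('n)"
proof -
  obtain F where F: "\<And>i. (\<lambda>x. F x $ i) \<in> form q" and Fl: "\<And>v. v \<noteq> 0 \<Longrightarrow> F v \<noteq> 0 \<and> F v \<in> line (f (pt v))"
    using endomorphism_forms[OF f iso] by blast
  interpret form_map F q by unfold_locales (use F qb Fl in blast)+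
  have f_pt: "f (pt v) = pt (F v)" if "v \<noteq> 0" for v using pt_eqI Fl[OF that] by metis
  have f_pmap: "f x = pmap x" for x using f_pt[OF rep(2), of x] by (simp add: pmap_def)
  have indep: "vec.independent (r ` CR f)" if r: "\<And>p. p \<in> CR f \<Longrightarrow> r p \<in> line p - {0}" for r
  proof -
    have "\<forall>w\<in>r ` CR f. \<exists>a. F a = w \<and> a \<noteq> 0 \<and> f -` {pt w} = {pt a}"
    proof
      fix w assume "w \<in> r ` CR f"
      then obtain p where p: "p \<in> CR f" "w = r p" by blast
      then obtain x where x: "f -` {p} = {x}" by (auto simp: CR_def)
      have w: "w \<in> line p" "w \<noteq> 0" using r[OF p(1)] p(2) by auto
      have "pmap x = p" using x f_pmap by auto
      then obtain a where a: "a \<in> line x" "a \<noteq> 0" "F a = w" using preimage_on_line[of w x] w by blast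
      then show "\<exists>a. F a = w \<and> a \<noteq> 0 \<and> f -` {pt w} = {pt a}"
        using x pt_eqI[OF w] pt_eqI[OF a(1,2)] by (intro exI[of _ a]) simp
    qed
    from bchoice[OF this] obtain \<alpha> where \<alpha>: "\<forall>w\<in>r ` CR f. F (\<alpha> w) = w \<and> \<alpha> w \<noteq> 0 \<and> f -` {pt w} = {pt (\<alpha> w)}"
      by (elim exE)
    have \<alpha>D: "F (\<alpha> w) = w" "\<alpha> w \<noteq> 0" "f -` {pt w} = {pt (\<alpha> w)}" if "w \<in> r ` CR f" for w
      using bspec[OF \<alpha> that] by simp_all
    have pt_w: "r (pt w) = w" "w \<noteq> 0" if w: "w \<in> r ` CR f" for w
    proof -
      obtain p where p: "w = r p" "p \<in> CR f" using w by (rule imageE)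
      then have "w \<in> line p" "w \<noteq> 0" using r[OF p(2)] by simp_all
      moreover from this have "pt w = p" by (rule pt_eqI)
      ultimately show "r (pt w) = w" "w \<noteq> 0" using p(1) by simp_all
    qed
    show ?thesis
    proof (rule independent_images[OF qk qb(2), of _ \<alpha>])
      fix w assume w: "w \<in> r ` CR f"
      show "F (\<alpha> w) = w" by (rule \<alpha>D(1)[OF w])
      show wnz: "w \<noteq> 0" by (rule pt_w(2)[OF w])
      fix x assume x: "F x \<in> vec.span {w}"
      show "x \<in> vec.span {\<alpha> w}"
      proof (cases "x = 0")
        case False
        have "F x \<in> line (pt w)" using x line_pt[OF wnz] by simp
        then have "pt (F x) = pt w" by (rule pt_eqI[OF _ F_nonzero[OF False]])
        then have "pt x \<in> f -` {pt w}" using f_pt[OF False] by simp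
        then have "pt x = pt (\<alpha> w)" using \<alpha>D(3)[OF w] by simp
        then have "x \<in> line (pt (\<alpha> w))" using in_line_pt[OF False] by simp
        then show ?thesis using line_pt[OF \<alpha>D(2)[OF w]] by simp
      qed (simp add: vec.span_zero)
    next
      fix w w' assume w: "w \<in> r ` CR f" "w' \<in> r ` CR f" "w \<noteq> w'"
      show "\<alpha> w \<notin> vec.span {\<alpha> w'}"
      proof
        assume "\<alpha> w \<in> vec.span {\<alpha> w'}"
        then have "\<alpha> w \<in> line (pt (\<alpha> w'))" using line_pt[OF \<alpha>D(2)[OF w(2)]] by simp
        then have "pt (\<alpha> w) = pt (\<alpha> w')" by (rule pt_eqI[OF _ \<alpha>D(2)[OF w(1)]])
        moreover have "pt w = f (pt (\<alpha> w))" "pt w' = f (pt (\<alpha> w'))"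
          using f_pt[OF \<alpha>D(2)] \<alpha>D(1) w(1,2) by simp_all
        ultimately have "r (pt w) = r (pt w')" by simp
        then show False using pt_w(1) w by simp
      qed
    qed
  qed
  have "vec.independent (rep ` CR f)" by (rule indep) (use rep in auto)
  then have "finite (rep ` CR f)" "card (rep ` CR f) \<le> CARD('n)" using vec_independent_card_le by blast+
  moreover have "inj_on rep (CR f)" by (metis inj_onI pt_rep)
  ultimately have "finite (CR f)" "card (CR f) \<le> CARD('n)" by (auto simp: card_image dest: finite_imageD)
  then show ?thesis unfolding proj_independent_def using indep by blast
qed

text \<open>If \<open>x\<^sub>j\<^sup>q = 0\<close> for all \<open>j \<noteq> i\<close> then \<open>x\<close> lies on the \<open>i\<close>-th axis, so every coordinate point is
  completely ramified for the power map.\<close>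

theorem power_map_attains_bound:
  assumes qb: "q \<ge> 1" "CARD('n :: finite) \<le> q" and qk: "(of_nat q :: 'k :: alg_closed_field) \<noteq> 0"
  shows "\<exists>f :: ('k, 'n) proj \<Rightarrow> ('k, 'n) proj. endomorphism f \<and> sheaf_iso (pullback f (twist 1)) (twist (int q)) \<and>
    finite (CR f) \<and> card (CR f) = CARD('n)"
proof -
  define F where "F = (\<lambda>v :: 'k ^ 'n. \<chi> i. (v $ i) ^ q)"
  interpret form_map F q
  proof
    fix i
    show "(\<lambda>x. F x $ i) \<in> form q" using form_power[OF coord_form[of i], of q] by (simp add: F_def)
  next
    fix x assume "F x = 0"
    then show "x = 0" using qb by (simp add: F_def Finite_Cartesian_Product.vec_eq_iff)
  qed (rule qb(1))
  have CR: "finite (CR pmap)" "card (CR pmap) \<le> CARD('n)"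
    using CR_independent[OF endomorphism_pmap sheaf_iso_pmap qb qk] by auto
  define e where "e = (\<lambda>i. axis i 1 :: 'k ^ 'n)"
  have e0: "e i \<noteq> 0" for i by (simp add: e_def axis_eq_0_iff)
  have Fe: "F (e i) = e i" for i using qb by (simp add: F_def e_def axis_def Finite_Cartesian_Product.vec_eq_iff)
  have span_e: "v \<in> vec.span {e i} \<longleftrightarrow> (\<forall>j. j \<noteq> i \<longrightarrow> v $ j = 0)" for v i
  proof
    assume "\<forall>j. j \<noteq> i \<longrightarrow> v $ j = 0"
    then have "v = v $ i *s e i" by (auto simp: e_def axis_def Finite_Cartesian_Product.vec_eq_iff)
    then show "v \<in> vec.span {e i}" unfolding vec.span_singleton by blast
  qed (auto simp: vec.span_singleton e_def axis_def)
  have "pt (e i) \<in> CR pmap" for i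
  proof -
    have "pmap -` {pt (e i)} = {pt (e i)}"
    proof (intro equalityI subsetI)
      fix x assume "x \<in> pmap -` {pt (e i)}"
      then have "F (rep x) \<in> line (pt (e i))" using F_in_line[OF rep(1,2), of x] by simp
      then have "rep x \<in> vec.span {e i}" using qb unfolding line_pt[OF e0] span_e by (simp add: F_def)
      then show "x \<in> {pt (e i)}" using pt_eqI[of "rep x" "pt (e i)"] rep(2)[of x] line_pt[OF e0, of i] by simp
    qed (use pmap_pt[OF e0] Fe in simp)
    then show ?thesis unfolding CR_def by blast
  qed
  then have "range (\<lambda>i. pt (e i)) \<subseteq> CR pmap" by blast
  then have "card (range (\<lambda>i. pt (e i))) \<le> card (CR pmap)" by (rule card_mono[OF CR(1)])
  moreover have "inj (\<lambda>i. pt (e i))"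
  proof (rule injI, rule ccontr)
    fix i j assume ij: "pt (e i) = pt (e j)" "i \<noteq> j"
    then have "e i \<in> vec.span {e j}" using in_line_pt[OF e0, of i] line_pt[OF e0, of j] by simp
    then have "e i $ i = 0" unfolding span_e using ij(2) by blast
    then show False by (simp add: e_def)
  qed
  then have "card (range (\<lambda>i. pt (e i))) = CARD('n)" by (simp add: card_image)
  ultimately have "card (CR pmap) = CARD('n)" using CR(2) by linarith
  then show ?thesis using endomorphism_pmap sheaf_iso_pmap CR(1) by blast
qed

theorem proposition5p1:
  fixes n :: nat
  assumes "n \<ge> 1" and "CARD('n :: finite) = n + 1"
  shows
    "(\<forall>(q :: int) (f :: ('k :: alg_closed_field, 'n) proj \<Rightarrow> ('k, 'n) proj).
        endomorphism f \<and> q > 1 \<and> sheaf_iso (pullback f (twist 1)) (twist q) \<and>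
        (of_int q :: 'k) \<noteq> 0 \<and> q \<ge> int n + 1 \<longrightarrow>
          proj_independent (CR f) \<and> finite (CR f) \<and> card (CR f) \<le> n + 1) \<and>
     (\<forall>q :: int. q \<ge> int n + 1 \<and> (of_int q :: 'k) \<noteq> 0 \<longrightarrow>
        (\<exists>f :: ('k, 'n) proj \<Rightarrow> ('k, 'n) proj.
          endomorphism f \<and> sheaf_iso (pullback f (twist 1)) (twist q) \<and>
          finite (CR f) \<and> card (CR f) = n + 1))"
proof (intro conjI allI impI)
  fix q :: int and f :: "('k, 'n) proj \<Rightarrow> ('k, 'n) proj"
  assume A: "endomorphism f \<and> q > 1 \<and> sheaf_iso (pullback f (twist 1)) (twist q) \<and>
        (of_int q :: 'k) \<noteq> 0 \<and> q \<ge> int n + 1"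
  define m where "m = nat q"
  have m: "q = int m" using A by (simp add: m_def)
  have "proj_independent (CR f) \<and> finite (CR f) \<and> card (CR f) \<le> CARD('n)"
    by (rule CR_independent[of f m]) (use A assms in \<open>auto simp: m\<close>)
  then show "proj_independent (CR f)" "finite (CR f)" "card (CR f) \<le> n + 1" using assms(2) by auto
next
  fix q :: int
  assume A: "q \<ge> int n + 1 \<and> (of_int q :: 'k) \<noteq> 0"
  define m where "m = nat q"
  have m: "q = int m" using A by (simp add: m_def)
  have "\<exists>f :: ('k, 'n) proj \<Rightarrow> ('k, 'n) proj. endomorphism f \<and> sheaf_iso (pullback f (twist 1)) (twist (int m)) \<and>
    finite (CR f) \<and> card (CR f) = CARD('n)"
    by (rule power_map_attains_bound) (use A assms in \<open>auto simp: m\<close>)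
  then show "\<exists>f :: ('k, 'n) proj \<Rightarrow> ('k, 'n) proj.
          endomorphism f \<and> sheaf_iso (pullback f (twist 1)) (twist q) \<and>
          finite (CR f) \<and> card (CR f) = n + 1" using assms(2) m by simp
qed

end
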